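(* Let $\mathbb K$ be a field and $x\in\mathbb K$. For every $k\ge0$ and $0\le r\le k$, the module $\mathsf C_k^{(r)}$ is an indecomposable $\mathsf M_k(x)$-module. If $x$ is such that $\mathsf M_k(x)$ is a semisimple $\mathbb K$-algebra, then $\{\mathsf C_k^{(r)}: 0\le r\le k\}$ is a complete set of pairwise nonisomorphic irreducible $\mathsf M_k(x)$-modules.
   Context: Motzkin algebra: a Motzkin $k$-diagram has top vertices $1,\dots,k$ and bottom vertices $1',\dots,k'$, edges each joining two distinct vertices, each vertex on at most one edge, edges planar (non-crossing inside the rectangle). Vertical edges join a top and a bottom vertex; the rank is the number of vertical edges. $\mathsf M_0(x)=\mathbb K$; $\mathsf M_k(x)$ is the free $\mathbb K$-module on Motzkin $k$-diagrams with product: stack $d_1$ above $d_2$ (bottom of $d_1$ identified with top of $d_2$), let $d_3$ join two outer vertices iff connected by a path, and $d_1d_2=x^\kappa d_3$ with $\kappa$ the number of closed loops in the middle row. Motzkin paths: $p=(a_1,\dots,a_k)$, $a_i\in\{-1,0,1\}$, all partial sums $\ge0$; $\mathrm{rank}(p)=\sum a_i$; $\mathcal P_k^r$ is the set of those of length $k$ and rank $r$. An index $i$ with $a_i=1$ is paired with the smallest $j>i$ with $a_i+\dots+a_j=0$, if it exists. The 1-factor of $p$: a row of vertices $1,\dots,k$ with paired indices joined by an edge, unpaired $a_i=1$ colored white, all others black; this is a bijection between paths and 1-factors (rows of black/white vertices with non-crossing edges among black vertices and no white vertex strictly between the ends of an edge). Module $\mathsf C_k^{(r)}$: the free $\mathbb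 K$-module with basis $\mathcal P_k^r$ ($\mathsf C_0^{(0)}=\mathbb K$). For a diagram $d$ and $p\in\mathcal P_k^r$, place $d$ above the 1-factor of $p$ identifying bottom vertex $i'$ with vertex $i$; let $\kappa(d,p)$ be the number of closed loops formed; let $q$ be the 1-factor on the top vertices in which two top vertices are joined iff they lie in a common connected component, and a top vertex is white iff its component contains a white vertex of $p$ (black otherwise). Then $d\cdot p=x^{\kappa(d,p)}q$ if $\mathrm{rank}(q)=r$ and $d\cdot p=0$ if $\mathrm{rank}(q)<r$, extended linearly. *)

theory Defs
  imports Main
begin

text \<open>Vertices: T i = top vertex i, B i = bottom vertex i', M i = vertex i of the
  middle row (used when stacking).  A diagram is a set of edges, each edge a
  two-element set of vertices.\<close>

datatype vtx = T nat | B nat | M nat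

type_synonym diag = "vtx set set"

definition verts :: "nat \<Rightarrow> vtx set" where
  "verts k = T ` {1..k} \<union> B ` {1..k}"

text \<open>Position of a vertex along the boundary of the rectangle, read cyclically:
  top vertices left to right, then bottom vertices right to left.\<close>
fun pos :: "nat \<Rightarrow> vtx \<Rightarrow> nat" where
  "pos k (T i) = i"
| "pos k (B i) = 2 * k + 1 - i"
| "pos k (M i) = 0"

definition motzkin_diagram :: "nat \<Rightarrow> diag \<Rightarrow> bool" where
  "motzkin_diagram k d \<longleftrightarrow>
     (\<forall>e\<in>d. \<exists>u v. e = {u, v} \<and> u \<noteq> v \<and> u \<in> verts k \<and> v \<in> verts k) \<and>
     (\<forall>e\<in>d. \<forall>e'\<in>d. e \<noteq> e' \<longrightarrow> e \<inter> e' = {}) \<and>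
     (\<forall>e\<in>d. \<forall>e'\<in>d. \<not> (\<exists>a b c c'. e = {a, b} \<and> e' = {c, c'} \<and>
         pos k a < pos k c \<and> pos k c < pos k b \<and> pos k b < pos k c'))"

definition diagrams :: "nat \<Rightarrow> diag set" where
  "diagrams k = {d. motzkin_diagram k d}"

definition idd :: "nat \<Rightarrow> diag" where
  "idd k = {{T i, B i} | i. i \<in> {1..k}}"

text \<open>A stacked picture is given by an upper edge set U and a lower edge set L
  (kept separate, so that coinciding edges form a 2-cycle).\<close>

definition conn2 :: "vtx set set \<Rightarrow> vtx set set \<Rightarrow> vtx \<Rightarrow> vtx \<Rightarrow> bool" where
  "conn2 U L = (\<lambda>a b. {a, b} \<in> U \<or> {a, b} \<in> L)\<^sup>*\<^sup>*"

fun is_mid :: "vtx \<Rightarrow> bool" where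
  "is_mid (M i) = True"
| "is_mid (T i) = False"
| "is_mid (B i) = False"

text \<open>Closed loops: connected components consisting of middle-row vertices each lying
  on an edge of U and on an edge of L (i.e. cycles in the middle row).\<close>
definition nloops :: "vtx set set \<Rightarrow> vtx set set \<Rightarrow> nat" where
  "nloops U L = card {C. \<exists>v. C = {w. conn2 U L v w} \<and>
      (\<forall>w\<in>C. is_mid w \<and> (\<exists>e\<in>U. w \<in> e) \<and> (\<exists>e\<in>L. w \<in> e))}"

fun bot_to_mid :: "vtx \<Rightarrow> vtx" where
  "bot_to_mid (B i) = M i"
| "bot_to_mid v = v"

fun top_to_mid :: "vtx \<Rightarrow> vtx" where
  "top_to_mid (T i) = M i"
| "top_to_mid v = v"

definition upper :: "diag \<Rightarrow> vtx set set" where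
  "upper d1 = (\<lambda>e. bot_to_mid ` e) ` d1"

definition lower :: "diag \<Rightarrow> vtx set set" where
  "lower d2 = (\<lambda>e. top_to_mid ` e) ` d2"

definition compose :: "nat \<Rightarrow> diag \<Rightarrow> diag \<Rightarrow> diag" where
  "compose k d1 d2 = {{u, v} | u v. u \<noteq> v \<and> u \<in> verts k \<and> v \<in> verts k \<and>
      conn2 (upper d1) (lower d2) u v}"

definition kappa_prod :: "diag \<Rightarrow> diag \<Rightarrow> nat" where
  "kappa_prod d1 d2 = nloops (upper d1) (lower d2)"

definition alg :: "nat \<Rightarrow> (diag \<Rightarrow> 'a::field) set" where
  "alg k = {f. \<forall>d. d \<notin> diagrams k \<longrightarrow> f d = 0}"

definition alg_mult :: "nat \<Rightarrow> 'a::field \<Rightarrow> (diag \<Rightarrow> 'a) \<Rightarrow> (diag \<Rightarrow> 'a) \<Rightarrow> diag \<Rightarrow> 'a" where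
  "alg_mult k x f g = (\<lambda>d3. \<Sum>d1\<in>diagrams k. \<Sum>d2\<in>diagrams k.
      if compose k d1 d2 = d3 then x ^ kappa_prod d1 d2 * f d1 * g d2 else 0)"

definition alg_one :: "nat \<Rightarrow> diag \<Rightarrow> 'a::field" where
  "alg_one k = (\<lambda>d. if d = idd k then 1 else 0)"

record ('a, 'm) amod =
  mcar :: "'m set"
  mzero :: 'm
  madd :: "'m \<Rightarrow> 'm \<Rightarrow> 'm"
  msmult :: "'a \<Rightarrow> 'm \<Rightarrow> 'm"
  mact :: "(diag \<Rightarrow> 'a) \<Rightarrow> 'm \<Rightarrow> 'm"

definition is_module :: "nat \<Rightarrow> 'a::field \<Rightarrow> ('a, 'm) amod \<Rightarrow> bool" where
  "is_module k x V \<longleftrightarrow>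
     mzero V \<in> mcar V \<and>
     (\<forall>u\<in>mcar V. \<forall>v\<in>mcar V. madd V u v \<in> mcar V) \<and>
     (\<forall>c. \<forall>v\<in>mcar V. msmult V c v \<in> mcar V) \<and>
     (\<forall>u\<in>mcar V. \<forall>v\<in>mcar V. \<forall>w\<in>mcar V. madd V (madd V u v) w = madd V u (madd V v w)) \<and>
     (\<forall>u\<in>mcar V. \<forall>v\<in>mcar V. madd V u v = madd V v u) \<and>
     (\<forall>v\<in>mcar V. madd V (mzero V) v = v) \<and>
     (\<forall>v\<in>mcar V. \<exists>w\<in>mcar V. madd V v w = mzero V) \<and>
     (\<forall>c. \<forall>u\<in>mcar V. \<forall>v\<in>mcar V. msmult V c (madd V u v) = madd V (msmult V c u) (msmult V c v)) \<and>
     (\<forall>c c'. \<forall>v\<in>mcar V. msmult V (c + c') v = madd V (msmult V c v) (msmult V c' v)) \<and>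
     (\<forall>c c'. \<forall>v\<in>mcar V. msmult V c (msmult V c' v) = msmult V (c * c') v) \<and>
     (\<forall>v\<in>mcar V. msmult V 1 v = v) \<and>
     (\<forall>a\<in>alg k. \<forall>v\<in>mcar V. mact V a v \<in> mcar V) \<and>
     (\<forall>a\<in>alg k. \<forall>b\<in>alg k. \<forall>v\<in>mcar V. mact V (\<lambda>d. a d + b d) v = madd V (mact V a v) (mact V b v)) \<and>
     (\<forall>a\<in>alg k. \<forall>u\<in>mcar V. \<forall>v\<in>mcar V. mact V a (madd V u v) = madd V (mact V a u) (mact V a v)) \<and>
     (\<forall>a\<in>alg k. \<forall>c. \<forall>v\<in>mcar V. mact V (\<lambda>d. c * a d) v = msmult V c (mact V a v)) \<and>
     (\<forall>a\<in>alg k. \<forall>c. \<forall>v\<in>mcar V. mact V a (msmult V c v) = msmult V c (mact V a v)) \<and>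
     (\<forall>a\<in>alg k. \<forall>b\<in>alg k. \<forall>v\<in>mcar V. mact V (alg_mult k x a b) v = mact V a (mact V b v)) \<and>
     (\<forall>v\<in>mcar V. mact V (alg_one k) v = v)"

definition submodule :: "nat \<Rightarrow> ('a::field, 'm) amod \<Rightarrow> 'm set \<Rightarrow> bool" where
  "submodule k V U \<longleftrightarrow> U \<subseteq> mcar V \<and> mzero V \<in> U \<and>
     (\<forall>u\<in>U. \<forall>w\<in>U. madd V u w \<in> U) \<and> (\<forall>c. \<forall>u\<in>U. msmult V c u \<in> U) \<and>
     (\<forall>a\<in>alg k. \<forall>u\<in>U. mact V a u \<in> U)"

definition direct_sum :: "('a, 'm) amod \<Rightarrow> 'm set \<Rightarrow> 'm set \<Rightarrow> bool" where
  "direct_sum V U W \<longleftrightarrow> U \<inter> W = {mzero V} \<and>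
     {madd V u w | u w. u \<in> U \<and> w \<in> W} = mcar V"

definition indecomposable :: "nat \<Rightarrow> ('a::field, 'm) amod \<Rightarrow> bool" where
  "indecomposable k V \<longleftrightarrow> mcar V \<noteq> {mzero V} \<and>
     (\<forall>U W. submodule k V U \<and> submodule k V W \<and> direct_sum V U W \<longrightarrow>
        U = {mzero V} \<or> W = {mzero V})"

definition irreducible_mod :: "nat \<Rightarrow> ('a::field, 'm) amod \<Rightarrow> bool" where
  "irreducible_mod k V \<longleftrightarrow> mcar V \<noteq> {mzero V} \<and>
     (\<forall>U. submodule k V U \<longrightarrow> U = {mzero V} \<or> U = mcar V)"

definition mod_iso :: "nat \<Rightarrow> ('a::field, 'm) amod \<Rightarrow> ('a, 'n) amod \<Rightarrow> bool" where
  "mod_iso k V W \<longleftrightarrow> (\<exists>f. bij_betw f (mcar V) (mcar W) \<and>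
     (\<forall>u\<in>mcar V. \<forall>v\<in>mcar V. f (madd V u v) = madd W (f u) (f v)) \<and>
     (\<forall>c. \<forall>v\<in>mcar V. f (msmult V c v) = msmult W c (f v)) \<and>
     (\<forall>a\<in>alg k. \<forall>v\<in>mcar V. f (mact V a v) = mact W a (f v)))"

definition semisimple_module :: "nat \<Rightarrow> ('a::field, 'm) amod \<Rightarrow> bool" where
  "semisimple_module k V \<longleftrightarrow>
     (\<forall>U. submodule k V U \<longrightarrow> (\<exists>W. submodule k V W \<and> direct_sum V U W))"

definition regmod :: "nat \<Rightarrow> 'a::field \<Rightarrow> ('a, diag \<Rightarrow> 'a) amod" where
  "regmod k x = \<lparr> mcar = alg k, mzero = (\<lambda>_. 0), madd = (\<lambda>f g d. f d + g d),
     msmult = (\<lambda>c f d. c * f d), mact = alg_mult k x \<rparr>"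

definition semisimple_algebra :: "nat \<Rightarrow> 'a::field \<Rightarrow> bool" where
  "semisimple_algebra k x \<longleftrightarrow> semisimple_module k (regmod k x)"

text \<open>A path (a_1,...,a_k) is the list [a_1,...,a_k]; a_i = p ! (i - 1).\<close>
definition motzkin_path :: "int list \<Rightarrow> bool" where
  "motzkin_path p \<longleftrightarrow> set p \<subseteq> {-1, 0, 1} \<and> (\<forall>n\<le>length p. 0 \<le> sum_list (take n p))"

definition paths :: "nat \<Rightarrow> nat \<Rightarrow> int list set" where
  "paths k r = {p. motzkin_path p \<and> length p = k \<and> sum_list p = int r}"

definition step :: "int list \<Rightarrow> nat \<Rightarrow> int" where
  "step p i = p ! (i - 1)"

definition paired :: "int list \<Rightarrow> nat \<Rightarrow> nat \<Rightarrow> bool" where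
  "paired p i j \<longleftrightarrow> 1 \<le> i \<and> i < j \<and> j \<le> length p \<and> step p i = 1 \<and>
     (\<Sum>t=i..j. step p t) = 0 \<and> (\<forall>j'. i < j' \<and> j' < j \<longrightarrow> (\<Sum>t=i..j'. step p t) \<noteq> 0)"

text \<open>1-factor: (edges, white vertices); all other vertices of 1..k are black.\<close>
definition onefactor :: "int list \<Rightarrow> nat set set \<times> nat set" where
  "onefactor p = ({{i, j} | i j. paired p i j},
                  {i \<in> {1..length p}. step p i = 1 \<and> \<not> (\<exists>j. paired p i j)})"

definition path_of :: "nat \<Rightarrow> nat set set \<times> nat set \<Rightarrow> int list" where
  "path_of k q = (THE p. motzkin_path p \<and> length p = k \<and> onefactor p = q)"

definition factor_lower :: "nat set set \<Rightarrow> vtx set set" where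
  "factor_lower E = (\<lambda>e. M ` e) ` E"

definition act_factor :: "nat \<Rightarrow> diag \<Rightarrow> int list \<Rightarrow> nat set set \<times> nat set" where
  "act_factor k d p = (let (E, W) = onefactor p; c = conn2 (upper d) (factor_lower E) in
     ({{i, j} | i j. i \<in> {1..k} \<and> j \<in> {1..k} \<and> i \<noteq> j \<and> c (T i) (T j)},
      {i \<in> {1..k}. \<exists>w\<in>W. c (T i) (M w)}))"

definition kappa_act :: "diag \<Rightarrow> int list \<Rightarrow> nat" where
  "kappa_act d p = nloops (upper d) (factor_lower (fst (onefactor p)))"

definition basis_act :: "nat \<Rightarrow> 'a::field \<Rightarrow> nat \<Rightarrow> diag \<Rightarrow> int list \<Rightarrow> int list \<Rightarrow> 'a" where
  "basis_act k x r d p = (let q = path_of k (act_factor k d p) in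
     if sum_list q = int r then (\<lambda>s. if s = q then x ^ kappa_act d p else 0) else (\<lambda>_. 0))"

definition Cmod :: "nat \<Rightarrow> 'a::field \<Rightarrow> nat \<Rightarrow> ('a, int list \<Rightarrow> 'a) amod" where
  "Cmod k x r = \<lparr> mcar = {v. \<forall>p. p \<notin> paths k r \<longrightarrow> v p = 0},
     mzero = (\<lambda>_. 0), madd = (\<lambda>u v s. u s + v s), msmult = (\<lambda>c v s. c * v s),
     mact = (\<lambda>a v s. \<Sum>d\<in>diagrams k. \<Sum>p\<in>paths k r. a d * v p * basis_act k x r d p s) \<rparr>"

end

theory Submission
  imports Defs "HOL-Library.Transitive_Closure_Table"
begin

text \<open>A stacked picture is a union of two matchings, so each of its components is a path or a cycle.
  Planarity of the product follows because, for a strand \<open>P\<close>, the parity of the number of vertices of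
  \<open>P\<close> to the left of a vertex in its row is constant along every other strand; the 1-factors inherit it
  by being completed to diagrams.  Loops are counted in the triple stack, whose components restrict
  bijectively to those of either partial product, which makes the action associative.

  Write \<open>(p, q)\<close> for the diagram of rank \<open>r\<close> with upper half \<open>p\<close> and lower half \<open>q\<close>, and let \<open>p0\<close> be the
  path with \<open>r\<close> initial up steps followed by level steps.  Then \<open>(p, p0) p0 = p\<close>, so \<open>p0\<close> generates the
  module of rank \<open>r\<close>, and the idempotent \<open>(p0, p0)\<close> maps this module onto the line spanned by \<open>p0\<close>.  In a
  direct decomposition one summand must therefore contain \<open>p0\<close>, which gives indecomposability.  As a
  quotient of the regular module it is semisimple whenever the algebra is, hence irreducible.  The
  idempotent \<open>(p0, p0)\<close> of rank \<open>r\<close> annihilates the modules of larger rank, so different ranks give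
  nonisomorphic modules.  If \<open>V\<close> is irreducible and \<open>(p, q)\<close> is a diagram of minimal rank \<open>r\<close> with
  \<open>(p, q) v\<close> nonzero for some \<open>v\<close>, then \<open>p' \<mapsto> (p', q) v\<close> is an isomorphism onto \<open>V\<close>.\<close>

section \<open>Graphs made of two matchings\<close>

text \<open>The base path \<open>p0\<close> has no edges, so \<open>(p, p0) p0 = p\<close> closes no
  loop and carries the coefficient 1 for every \<open>x\<close>. A base path with edges would
  produce powers of \<open>x\<close>, which vanish when \<open>x = 0\<close>. Since
  \<open>path_of\<close> is a definite description, no coefficient of the action can be computed
  before 1-factors are known to correspond to paths and to be preserved by diagrams. The
  calculations therefore run on pairs \<open>(E, W)\<close> of an edge set and a set of white
  vertices, and return to paths only at the end. The same layer occupies different rows in the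
  pictures of \<open>d1 d2\<close>, of \<open>d p\<close> and of \<open>d1 d2 p\<close>. Hence the
  graph theory is developed for arbitrary vertex types, and permutations of the rows carry its
  results from one picture to another. Minimality of the rank in the classification has a definite
  purpose: multiplying \<open>(p, q)\<close> by a diagram imitates the action on \<open>p\<close>
  only up to diagrams of smaller rank, and these must act as zero.\<close>

definition conn :: "'v set set \<Rightarrow> 'v \<Rightarrow> 'v \<Rightarrow> bool" where
  "conn X = (\<lambda>a b. {a, b} \<in> X)\<^sup>*\<^sup>*"

definition matching :: "'v set set \<Rightarrow> bool" where
  "matching X \<longleftrightarrow> (\<forall>e\<in>X. \<exists>u v. e = {u, v} \<and> u \<noteq> v) \<and>
     (\<forall>e\<in>X. \<forall>e'\<in>X. e \<noteq> e' \<longrightarrow> e \<inter> e' = {})"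

text \<open>\<open>U\<close> and \<open>L\<close> are kept apart because an edge lying in both is a
  2-cycle, which their union cannot show. Coverage by both matchings makes a finite component a
  cycle.\<close>

definition loops :: "'v set set \<Rightarrow> 'v set set \<Rightarrow> 'v set \<Rightarrow> 'v set set" where
  "loops U L R = {D. \<exists>v. D = {w. conn (U \<union> L) v w} \<and>
     (\<forall>w\<in>D. w \<in> R \<and> w \<in> \<Union>U \<and> w \<in> \<Union>L)}"

text \<open>The outer edges of a stacked picture once the vertices outside \<open>K\<close> are
  forgotten. The product of diagrams and the arcs of a diagram acting on a 1-factor both have this
  form.\<close>

definition contract :: "'v set set \<Rightarrow> 'v set \<Rightarrow> 'v set set" where
  "contract X K = {{u, v} | u v. u \<noteq> v \<and> u \<in> K \<and> v \<in> K \<and> conn X u v}"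

lemma conn2_conn: "conn2 U L = conn (U \<union> L)"
  by (simp add: conn2_def conn_def)

lemma conn_refl [simp]: "conn X u u"
  by (simp add: conn_def)

lemma conn_trans: "conn X u v \<Longrightarrow> conn X v w \<Longrightarrow> conn X u w"
  by (simp add: conn_def)

lemma conn_edge: "{u, v} \<in> X \<Longrightarrow> conn X u v"
  by (simp add: conn_def r_into_rtranclp)

lemma conn_step: "conn X u v \<Longrightarrow> {v, w} \<in> X \<Longrightarrow> conn X u w"
  by (blast intro: conn_trans conn_edge)

lemma conn_induct [consumes 1, case_names refl step]:
  assumes "conn X u v" "P u"
    and "\<And>v w. conn X u v \<Longrightarrow> {v, w} \<in> X \<Longrightarrow> P v \<Longrightarrow> P w"
  shows "P v"
  using assms unfolding conn_def by (rule rtranclp_induct)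

lemma conn_sym: "conn X u v \<Longrightarrow> conn X v u"
proof (induction rule: conn_induct)
  case (step v w)
  have "conn X w v" using step(2) by (simp add: conn_edge insert_commute)
  then show ?case using step(3) by (rule conn_trans)
qed simp

lemma conn_mono:
  assumes "X \<subseteq> Y" "conn X u v"
  shows "conn Y u v"
  using assms(2) by (induction rule: conn_induct) (use assms(1) in \<open>auto intro: conn_step\<close>)

lemma conn_closed:
  assumes "conn X u v" "u \<in> S" "\<And>a b. a \<in> S \<Longrightarrow> {a, b} \<in> X \<Longrightarrow> b \<in> S"
  shows "v \<in> S"
  using assms by (induction rule: conn_induct) auto

text \<open>Extra edges do not enlarge a component if those touching it were present already. This
  compares components of pictures with different layers.\<close>

lemma conn_absorb:
  assumes "conn (X \<union> Y) u v" "\<And>a b. conn X u a \<Longrightarrow> {a, b} \<in> Y \<Longrightarrow> {a, b} \<in> X"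
  shows "conn X u v"
  using assms by (induction rule: conn_induct) (auto intro: conn_step)

lemma conn_neq_Union:
  assumes "conn X u v" "u \<noteq> v"
  shows "u \<in> \<Union>X"
proof (rule ccontr)
  assume u: "u \<notin> \<Union>X"
  from assms(1) have "v \<in> {u}" by (rule conn_closed) (use u in auto)
  with assms(2) show False by simp
qed

lemma comp_eq: "conn X u v \<Longrightarrow> {w. conn X u w} = {w. conn X v w}"
  by (blast intro: conn_trans conn_sym)

lemma contract_edge:
  "{u, v} \<in> contract X K \<longleftrightarrow> u \<noteq> v \<and> u \<in> K \<and> v \<in> K \<and> conn X u v"
  unfolding contract_def by (auto simp: doubleton_eq_iff intro: conn_sym)

lemma conn_image:
  assumes "inj f"
  shows "conn ((`) f ` X) (f u) (f v) \<longleftrightarrow> conn X u v"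
proof
  assume "conn ((`) f ` X) (f u) (f v)"
  then have "f v \<in> f ` {w. conn X u w}"
  proof (rule conn_closed)
    fix a b assume "a \<in> f ` {w. conn X u w}" "{a, b} \<in> (`) f ` X"
    then obtain a' e where a: "a = f a'" "conn X u a'" "{a, b} = f ` e" "e \<in> X" by auto
    obtain b' where b: "b = f b'" using a(3) by blast
    have "f ` e = f ` {a', b'}" using a b by auto
    then have "e = {a', b'}" using assms by (metis inj_image_eq_iff)
    then show "b \<in> f ` {w. conn X u w}" using a b by (auto intro: conn_step)
  qed auto
  then show "conn X u v" using assms by (auto dest: injD)
next
  assume "conn X u v"
  then show "conn ((`) f ` X) (f u) (f v)"
  proof (induction rule: conn_induct)
    case (step v w)
    have "f ` {v, w} \<in> (`) f ` X" using step(2) by blast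
    then show ?case using step(3) by (simp add: conn_step)
  qed simp
qed

lemma loops_commute: "loops U L R = loops L U R"
  by (auto simp: loops_def Un_commute)

lemma loops_cong:
  assumes "\<And>w. w \<in> \<Union>U \<Longrightarrow> w \<in> \<Union>L \<Longrightarrow> w \<in> R \<longleftrightarrow> w \<in> R'"
  shows "loops U L R = loops U L R'"
  using assms unfolding loops_def by (smt (verit) Collect_cong)

lemma loops_image:
  assumes "bij f"
  shows "loops ((`) f ` U) ((`) f ` L) (f ` R) = (`) f ` loops U L R"
proof -
  have inj: "inj f" and surj: "surj f" using assms by (auto simp: bij_def)
  have comp: "{w. conn ((`) f ` U \<union> (`) f ` L) (f v) w} = f ` {w. conn (U \<union> L) v w}" for v
  proof -
    have "conn ((`) f ` U \<union> (`) f ` L) (f v) (f w) \<longleftrightarrow> conn (U \<union> L) v w" for w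
      using conn_image[OF inj, of "U \<union> L" v w] by (simp add: image_Un)
    then show ?thesis using surj by (auto simp: image_iff) (metis surjD)
  qed
  have ball: "(\<forall>w\<in>f ` D. w \<in> f ` R \<and> w \<in> \<Union>((`) f ` U) \<and> w \<in> \<Union>((`) f ` L)) \<longleftrightarrow>
     (\<forall>w\<in>D. w \<in> R \<and> w \<in> \<Union>U \<and> w \<in> \<Union>L)" for D
    using inj by (auto simp: inj_image_mem_iff)
  show ?thesis
  proof (intro subset_antisym subsetI)
    fix D assume "D \<in> loops ((`) f ` U) ((`) f ` L) (f ` R)"
    then obtain v' where "D = {w. conn ((`) f ` U \<union> (`) f ` L) v' w}"
      and b: "\<forall>w\<in>D. w \<in> f ` R \<and> w \<in> \<Union>((`) f ` U) \<and> w \<in> \<Union>((`) f ` L)"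
      unfolding loops_def by blast
    moreover obtain v where "v' = f v" using surj by (metis surjD)
    ultimately have D: "D = f ` {w. conn (U \<union> L) v w}" using comp by simp
    show "D \<in> (`) f ` loops U L R"
      using b unfolding D ball unfolding loops_def by blast
  next
    fix D assume "D \<in> (`) f ` loops U L R"
    then obtain v where D: "D = f ` {w. conn (U \<union> L) v w}"
      and b: "\<forall>w\<in>{w. conn (U \<union> L) v w}. w \<in> R \<and> w \<in> \<Union>U \<and> w \<in> \<Union>L"
      unfolding loops_def by blast
    show "D \<in> loops ((`) f ` U) ((`) f ` L) (f ` R)"
      unfolding loops_def mem_Collect_eq
      by (rule exI[of _ "f v"]) (use b D in \<open>simp only: ball comp simp_thms\<close>)
  qed
qed

lemma card_loops_image:
  assumes "bij f"
  shows "card (loops ((`) f ` U) ((`) f ` L) (f ` R)) = card (loops U L R)"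
  unfolding loops_image[OF assms]
  by (intro card_image inj_onI) (use bij_is_inj[OF assms] inj_image_eq_iff in metis)

section \<open>Matchings, and components of the union of two of them\<close>

lemma matching_edge: "matching X \<Longrightarrow> e \<in> X \<Longrightarrow> \<exists>u v. e = {u, v} \<and> u \<noteq> v"
  by (simp add: matching_def)

lemma matching_disjoint:
  "matching X \<Longrightarrow> e \<in> X \<Longrightarrow> e' \<in> X \<Longrightarrow> e \<noteq> e' \<Longrightarrow> e \<inter> e' = {}"
  unfolding matching_def by meson

lemma matching_unique:
  assumes "matching X" "{a, b} \<in> X" "{a, c} \<in> X"
  shows "b = c"
proof -
  have "{a, b} = {a, c}"
  proof (rule ccontr)
    assume "{a, b} \<noteq> {a, c}"
    then have "{a, b} \<inter> {a, c} = {}" using matching_disjoint[OF assms] by blast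
    then show False by simp
  qed
  then show ?thesis by (auto simp: doubleton_eq_iff)
qed

lemma matching_neq: "matching X \<Longrightarrow> {a, b} \<in> X \<Longrightarrow> a \<noteq> b"
  by (drule (1) matching_edge) (auto simp: doubleton_eq_iff)

lemma matching_partner:
  assumes "matching X" "a \<in> \<Union>X"
  obtains b where "b \<noteq> a" "{a, b} \<in> X"
proof -
  from assms(2) obtain e where e: "e \<in> X" "a \<in> e" by blast
  with matching_edge[OF assms(1)] obtain u v where "e = {u, v}" "u \<noteq> v" by blast
  with e that[of u] that[of v] show ?thesis by (auto simp: insert_commute[of v u])
qed

lemma matching_image:
  assumes "inj f" "matching X"
  shows "matching ((`) f ` X)"
  unfolding matching_def
proof (intro conjI ballI impI)
  fix e assume "e \<in> (`) f ` X"
  then obtain e' where "e = f ` e'" "e' \<in> X" by blast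
  moreover obtain u v where "e' = {u, v}" "u \<noteq> v"
    using matching_edge[OF assms(2) \<open>e' \<in> X\<close>] by blast
  ultimately have "e = {f u, f v} \<and> f u \<noteq> f v" using assms(1) by (simp add: inj_eq)
  then show "\<exists>u v. e = {u, v} \<and> u \<noteq> v" by blast
next
  fix e e' assume "e \<in> (`) f ` X" "e' \<in> (`) f ` X" "e \<noteq> e'"
  then obtain a b where "a \<in> X" "b \<in> X" "e = f ` a" "e' = f ` b" "a \<noteq> b" by blast
  then show "e \<inter> e' = {}" using matching_disjoint[OF assms(2)] image_Int[OF assms(1)]
    by (metis image_empty)
qed

lemma conn_matching:
  assumes "matching X"
  shows "conn X u v \<longleftrightarrow> u = v \<or> {u, v} \<in> X"
proof
  assume "conn X u v"
  then have "v \<in> {v. u = v \<or> {u, v} \<in> X}"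
    by (rule conn_closed) (use assms in \<open>auto dest: matching_unique simp: insert_commute\<close>)
  then show "u = v \<or> {u, v} \<in> X" by simp
qed (auto intro: conn_edge)

text \<open>\<open>S\<close> is the disjoint union of the edges contained in it, and each of these
  has two elements.\<close>

lemma even_card_matched:
  assumes "matching X" "finite S" "S \<subseteq> \<Union>X" "\<And>a b. a \<in> S \<Longrightarrow> {a, b} \<in> X \<Longrightarrow> b \<in> S"
  shows "even (card S)"
proof -
  let ?Y = "{e \<in> X. e \<subseteq> S}"
  have sub: "e \<subseteq> S" if "e \<in> X" "a \<in> e" "a \<in> S" for e a
  proof -
    obtain u v where "e = {u, v}" using matching_edge[OF assms(1) \<open>e \<in> X\<close>] by blast
    then show ?thesis using that assms(4) by (auto simp: insert_commute)
  qed
  have S: "\<Union>?Y = S"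
  proof (intro subset_antisym subsetI)
    fix a assume a: "a \<in> S"
    then obtain e where "e \<in> X" "a \<in> e" using assms(3) by blast
    then show "a \<in> \<Union>?Y" using sub a by blast
  qed blast
  have "card (\<Union>?Y) = sum card ?Y"
  proof (rule card_Union_disjoint)
    show "pairwise disjnt ?Y"
      unfolding pairwise_def disjnt_def using matching_disjoint[OF assms(1)] by simp
    show "finite e" if "e \<in> ?Y" for e using that assms(2) finite_subset by blast
  qed
  also have "\<dots> = (\<Sum>e\<in>?Y. 2)"
    by (rule sum.cong) (use matching_edge[OF assms(1)] in \<open>auto simp: card_2_iff\<close>)
  finally show ?thesis unfolding S by simp
qed

text \<open>The component is a path from one end to the other, and a distinct path between the ends is
  already closed under adjacency because no vertex has more than two neighbours.\<close>
lemma two_ends: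
  assumes U: "matching U" and L: "matching L"
    and uv: "conn (U \<union> L) u v" "u \<noteq> v"
    and u: "\<not> (u \<in> \<Union>U \<and> u \<in> \<Union>L)" and v: "\<not> (v \<in> \<Union>U \<and> v \<in> \<Union>L)"
    and w: "conn (U \<union> L) u w"
  shows "w = u \<or> w = v \<or> (w \<in> \<Union>U \<and> w \<in> \<Union>L)"
proof -
  let ?r = "\<lambda>a b. {a, b} \<in> U \<union> L"
  \<comment> \<open>Distinct neighbours must come from different matchings, so a third one has no
    matching left.\<close>
  have two: "a \<in> \<Union>U \<and> a \<in> \<Union>L \<and> (?r a c \<longrightarrow> c = b \<or> c = b')"
    if "?r a b" "?r a b'" "b \<noteq> b'" for a b b' c
    using that matching_unique[OF U] matching_unique[OF L] by auto
  have one: "c = b" if "?r a b" "?r a c" "\<not> (a \<in> \<Union>U \<and> a \<in> \<Union>L)" for a b c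
    using that two by blast
  from uv(1) obtain xs0 where "rtrancl_path ?r u xs0 v"
    unfolding conn_def rtranclp_eq_rtrancl_path by blast
  then obtain xs where path: "rtrancl_path ?r u xs v" and dist: "distinct (u # xs)"
    by (rule rtrancl_path_distinct)
  have xs: "xs \<noteq> []" using path uv(2) by (auto elim: rtrancl_path.cases)
  have last: "last xs = v" using path xs by (rule rtrancl_path_last)
  let ?ys = "u # xs"
  define n where "n = length xs"
  have n: "n > 0" using xs by (simp add: n_def)
  have yn: "?ys ! n = v" using last xs by (simp add: n_def last_conv_nth nth_Cons')
  have nb: "?r (?ys ! i) (?ys ! Suc i)" if "i < n" for i
    using rtrancl_path_nth[OF path, of i] that by (simp add: n_def)
  have inner: "?ys ! i \<in> \<Union>U \<and> ?ys ! i \<in> \<Union>L \<and>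
      (?r (?ys ! i) c \<longrightarrow> c = ?ys ! (i - 1) \<or> c = ?ys ! Suc i)" if "0 < i" "i < n" for i c
  proof (rule two)
    show "?r (?ys ! i) (?ys ! (i - 1))" using nb[of "i - 1"] that by (simp add: insert_commute)
    show "?r (?ys ! i) (?ys ! Suc i)" using nb that by blast
    show "?ys ! (i - 1) \<noteq> ?ys ! Suc i"
      using dist that nth_eq_iff_index_eq[OF dist, of "i - 1" "Suc i"] by (simp add: n_def)
  qed
  from w have "w \<in> set ?ys"
  proof (rule conn_closed)
    fix a b assume a: "a \<in> set ?ys" and b: "?r a b"
    then obtain i where i: "i \<le> n" "a = ?ys ! i"
      unfolding in_set_conv_nth by (auto simp: n_def less_Suc_eq_le)
    consider "i = 0" | "0 < i" "i < n" | "i = n" "i \<noteq> 0" using i by linarith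
    then have "\<exists>j\<le>n. b = ?ys ! j"
    proof cases
      case 1
      then have "b = ?ys ! 1" using one[of u "?ys ! 1" b] nb[of 0] n b i u by simp
      then show ?thesis using n by (intro exI[of _ 1]) simp
    next
      case 2
      then have "b = ?ys ! (i - 1) \<or> b = ?ys ! Suc i" using inner b i by blast
      moreover have "i - 1 \<le> n" "Suc i \<le> n" using 2 by auto
      ultimately show ?thesis by blast
    next
      case 3
      have "?r v (?ys ! (n - 1))" using nb[of "n - 1"] n yn by (simp add: insert_commute)
      then have "b = ?ys ! (n - 1)" using one[of v "?ys ! (n - 1)" b] b i 3 v yn by simp
      then show ?thesis by (intro exI[of _ "n - 1"]) simp
    qed
    then show "b \<in> set ?ys" unfolding in_set_conv_nth by (auto simp: n_def less_Suc_eq_le)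
  qed simp
  then obtain i where i: "i \<le> n" "w = ?ys ! i"
    unfolding in_set_conv_nth by (auto simp: n_def less_Suc_eq_le)
  consider "i = 0" | "0 < i" "i < n" | "i = n" using i by linarith
  then show ?thesis using inner i yn by cases auto
qed

text \<open>Parity: \<open>U\<close> pairs off the whole component, so its size is even; if
  \<open>v\<close> missed \<open>L\<close>, then \<open>L\<close> would pair off the component
  without \<open>v\<close>, whose size is odd.\<close>

lemma other_end:
  assumes U: "matching U" and L: "matching L"
    and fin: "finite {w. conn (U \<union> L) v w}"
    and deg: "\<And>w. conn (U \<union> L) v w \<Longrightarrow> w \<noteq> v \<Longrightarrow> w \<in> \<Union>U \<and> w \<in> \<Union>L"
    and v: "v \<in> \<Union>U"
  shows "v \<in> \<Union>L"
proof (rule ccontr)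
  assume v': "v \<notin> \<Union>L"
  let ?D = "{w. conn (U \<union> L) v w}"
  have "even (card ?D)"
    by (rule even_card_matched[OF U fin]) (use deg v in \<open>auto intro: conn_step\<close>)
  moreover have "even (card (?D - {v}))"
    by (rule even_card_matched[OF L]) (use deg v' fin in \<open>auto intro: conn_step\<close>)
  moreover have "card ?D = Suc (card (?D - {v}))" using fin by (intro card.remove) auto
  ultimately show False by presburger
qed

text \<open>Three layers \<open>A\<close>, \<open>B\<close>, \<open>C\<close> drawn between
  consecutive rows \<open>R0\<close> to \<open>R3\<close>. Abstract rows allow the last one to be
  empty when \<open>C\<close> is a 1-factor, and allow the picture to be read upside down.\<close>

locale stack =
  fixes A B C :: "'v set set" and R0 R1 R2 R3 :: "'v set"
  assumes mA: "matching A" and mB: "matching B" and mC: "matching C"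
    and A: "\<Union>A \<subseteq> R0 \<union> R1" and B: "\<Union>B \<subseteq> R1 \<union> R2" and C: "\<Union>C \<subseteq> R2 \<union> R3"
    and disj: "R0 \<inter> R1 = {}" "R0 \<inter> R2 = {}" "R0 \<inter> R3 = {}" "R1 \<inter> R2 = {}"
      "R1 \<inter> R3 = {}" "R2 \<inter> R3 = {}"
    and fin: "finite R1" "finite R2"
begin

abbreviation AB :: "'v set set" where "AB \<equiv> contract (A \<union> B) (R0 \<union> R2)"

definition loops3 :: "'v set set" where
  "loops3 = {D. \<exists>v. D = {w. conn (A \<union> B \<union> C) v w} \<and>
     (\<forall>w\<in>D. (w \<in> R1 \<and> w \<in> \<Union>A \<and> w \<in> \<Union>B) \<or> (w \<in> R2 \<and> w \<in> \<Union>B \<and> w \<in> \<Union>C))}"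

lemma contract_sub: "conn (AB \<union> C) u v \<Longrightarrow> conn (A \<union> B \<union> C) u v"
proof (induction rule: conn_induct)
  case (step v w)
  from step(2) have "conn (A \<union> B \<union> C) v w"
  proof
    assume "{v, w} \<in> AB"
    then have "conn (A \<union> B) v w" by (simp add: contract_edge)
    then show ?thesis by (rule conn_mono[rotated]) blast
  qed (auto intro: conn_edge)
  then show ?case using step(3) by (blast intro: conn_trans)
qed simp

text \<open>Whenever the path uses an edge of \<open>C\<close>, the preceding stretch through
  \<open>A\<close> and \<open>B\<close> is compressed to a single edge of the contraction; only the
  stretch after the last such edge remains, and \<open>w\<close> is where it begins.\<close>

lemma conn_split:
  assumes "conn (A \<union> B \<union> C) u v" "u \<notin> R1"
  shows "\<exists>w. w \<notin> R1 \<and> conn (AB \<union> C) u w \<and> conn (A \<union> B) w v"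
  using assms
proof (induction rule: conn_induct)
  case (step v v')
  then obtain w where w: "w \<notin> R1" "conn (AB \<union> C) u w" "conn (A \<union> B) w v" by blast
  show ?case
  proof (cases "{v, v'} \<in> C")
    case True
    then have v: "v \<in> R2 \<union> R3" "v' \<in> R2 \<union> R3" using C by auto
    have "w = v \<or> {w, v} \<in> AB"
    proof (cases "w = v")
      case False
      then have "w \<in> \<Union>(A \<union> B)" "v \<in> \<Union>(A \<union> B)"
        using w(3) conn_neq_Union conn_sym by metis+
      then have "w \<in> R0 \<union> R2" "v \<in> R0 \<union> R2" using w(1) v A B disj by auto
      then show ?thesis using False w(3) by (simp add: contract_edge)
    qed simp
    then have "conn (AB \<union> C) u v" using w(2) conn_step[OF w(2), of v] by auto
    then have "conn (AB \<union> C) u v'" by (rule conn_step) (use True in simp)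
    moreover have "v' \<notin> R1" using v disj by auto
    ultimately show ?thesis using conn_refl by metis
  next
    case False
    then have "conn (A \<union> B) w v'" using step(2) conn_step[OF w(3), of v'] by auto
    then show ?thesis using w by metis
  qed
qed (auto intro!: exI[of _ u])

lemma conn_contract:
  assumes "u \<notin> R1" "v \<notin> R1"
  shows "conn (AB \<union> C) u v \<longleftrightarrow> conn (A \<union> B \<union> C) u v"
proof
  assume "conn (A \<union> B \<union> C) u v"
  then obtain w where w: "w \<notin> R1" "conn (AB \<union> C) u w" "conn (A \<union> B) w v"
    using conn_split assms(1) by blast
  show "conn (AB \<union> C) u v"
  proof (cases "w = v")
    case False
    then have "w \<in> \<Union>(A \<union> B)" "v \<in> \<Union>(A \<union> B)" using w(3) conn_neq_Union conn_sym by metis+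
    then have "w \<in> R0 \<union> R2" "v \<in> R0 \<union> R2" using A B w(1) assms(2) by auto
    then have "{w, v} \<in> AB" using w(3) False by (simp add: contract_edge)
    then show ?thesis using conn_step[OF w(2), of v] by simp
  qed (use w in simp)
qed (rule contract_sub)

lemma conn_contract_outside:
  assumes "conn (AB \<union> C) u v" "u \<notin> R1"
  shows "v \<notin> R1"
proof -
  have "v \<in> - R1" using assms(1)
  proof (rule conn_closed)
    fix a b assume "{a, b} \<in> AB \<union> C"
    then have "b \<in> R0 \<union> R2 \<union> R3" using C by (auto simp: contract_edge)
    then show "b \<in> - R1" using disj by auto
  qed (use assms(2) in simp)
  then show ?thesis by simp
qed

text \<open>A loop avoiding \<open>R2\<close> meets no edge of \<open>C\<close>, so it is already a
  component of the first two layers.\<close>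

lemma loops3_row1: "{D \<in> loops3. D \<inter> R2 = {}} = loops A B R1"
proof -
  have sub: "{w. conn (A \<union> B) v w} \<subseteq> {w. conn (A \<union> B \<union> C) v w}" for v
    using conn_mono[of "A \<union> B" "A \<union> B \<union> C"] by blast
  have comp: "{w. conn (A \<union> B \<union> C) v w} = {w. conn (A \<union> B) v w}"
    if R1: "{w. conn (A \<union> B) v w} \<subseteq> R1" for v
  proof (intro subset_antisym sub subsetI CollectI)
    fix w assume "w \<in> {w. conn (A \<union> B \<union> C) v w}"
    then have "conn (A \<union> B \<union> C) v w" ..
    then show "conn (A \<union> B) v w"
    proof (rule conn_absorb)
      fix a b assume "conn (A \<union> B) v a" "{a, b} \<in> C"
      then show "{a, b} \<in> A \<union> B" using R1 C disj by blast
    qed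
  qed
  show ?thesis
  proof (intro subset_antisym subsetI)
    fix D assume "D \<in> {D \<in> loops3. D \<inter> R2 = {}}"
    then obtain v where v: "D = {w. conn (A \<union> B \<union> C) v w}"
      and b: "\<And>w. w \<in> D \<Longrightarrow> w \<in> R1 \<and> w \<in> \<Union>A \<and> w \<in> \<Union>B"
      unfolding loops3_def by blast
    have "D = {w. conn (A \<union> B) v w}" unfolding v by (rule comp) (use b sub v in blast)
    then show "D \<in> loops A B R1" using b unfolding loops_def by blast
  next
    fix D assume "D \<in> loops A B R1"
    then obtain v where v: "D = {w. conn (A \<union> B) v w}"
      and b: "\<And>w. w \<in> D \<Longrightarrow> w \<in> R1 \<and> w \<in> \<Union>A \<and> w \<in> \<Union>B"
      unfolding loops_def by blast
    have "D = {w. conn (A \<union> B \<union> C) v w}" unfolding v by (rule comp[symmetric]) (use b v in blast)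
    then show "D \<in> {D \<in> loops3. D \<inter> R2 = {}}" using b disj unfolding loops3_def by blast
  qed
qed

text \<open>By \<open>conn_contract\<close> the trace of a loop on \<open>R2\<close> is a component
  of the contracted picture. The real content is that coverage by two layers passes to the trace,
  and back from the trace to the vertices in \<open>R1\<close>.\<close>

lemma loops3_row2: "bij_betw (\<lambda>D. D \<inter> R2) {D \<in> loops3. D \<inter> R2 \<noteq> {}} (loops AB C R2)"
  unfolding bij_betw_def
proof (intro conjI subset_antisym subsetI)
  show "inj_on (\<lambda>D. D \<inter> R2) {D \<in> loops3. D \<inter> R2 \<noteq> {}}"
  proof (rule inj_onI)
    fix D D' assume D: "D \<in> {D \<in> loops3. D \<inter> R2 \<noteq> {}}" "D' \<in> {D \<in> loops3. D \<inter> R2 \<noteq> {}}"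
      and eq: "D \<inter> R2 = D' \<inter> R2"
    then obtain z where "z \<in> D" "z \<in> D'" by blast
    moreover obtain v v' where "D = {w. conn (A \<union> B \<union> C) v w}" "D' = {w. conn (A \<union> B \<union> C) v' w}"
      using D unfolding loops3_def by blast
    ultimately show "D = D'" using comp_eq by (metis mem_Collect_eq)
  qed
next
  fix D2 assume "D2 \<in> (\<lambda>D. D \<inter> R2) ` {D \<in> loops3. D \<inter> R2 \<noteq> {}}"
  then obtain D v w where D2: "D2 = D \<inter> R2" and v: "D = {w. conn (A \<union> B \<union> C) v w}"
    and w: "w \<in> D" "w \<in> R2"
    and deg: "\<And>w. w \<in> D \<Longrightarrow> (w \<in> R1 \<and> w \<in> \<Union>A \<and> w \<in> \<Union>B) \<or> (w \<in> R2 \<and> w \<in> \<Union>B \<and> w \<in> \<Union>C)"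
    unfolding loops3_def by blast
  have D: "D = {z. conn (A \<union> B \<union> C) w z}" using v w comp_eq by (metis mem_Collect_eq)
  have w1: "w \<notin> R1" using w disj by blast
  have "D \<inter> R2 = {z. conn (AB \<union> C) w z}"
  proof (intro subset_antisym subsetI)
    fix z assume "z \<in> D \<inter> R2"
    then show "z \<in> {z. conn (AB \<union> C) w z}" using conn_contract[of w z] D disj w1 by blast
  next
    fix z assume "z \<in> {z. conn (AB \<union> C) w z}"
    then have z: "conn (AB \<union> C) w z" by simp
    have "z \<notin> R1" using conn_contract_outside z w1 by blast
    moreover have "z \<in> D" using z D contract_sub by blast
    ultimately show "z \<in> D \<inter> R2" using deg by blast
  qed
  moreover have "z \<in> \<Union>AB" if z: "z \<in> D" "z \<in> R2" for z
  proof -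
    have sub: "{y. conn (A \<union> B) z y} \<subseteq> D"
    proof
      fix y assume "y \<in> {y. conn (A \<union> B) z y}"
      then have "conn (A \<union> B \<union> C) z y" using conn_mono[of "A \<union> B" "A \<union> B \<union> C"] by blast
      then show "y \<in> D" using z(1) D conn_trans by fast
    qed
    \<comment> \<open>Otherwise \<open>z\<close> is the only vertex of its component in
      \<open>A\<close> and \<open>B\<close> that may miss a layer; then \<open>other_end\<close>
      puts \<open>z\<close> on \<open>A\<close>, whose rows exclude \<open>R2\<close>.\<close>
    have "\<exists>z'. z' \<noteq> z \<and> z' \<in> R2 \<and> conn (B \<union> A) z z'"
    proof (rule ccontr)
      assume no: "\<not> ?thesis"
      have "z \<in> \<Union>A"
      proof (rule other_end[OF mB mA])
        have "{y. conn (B \<union> A) z y} \<subseteq> R1 \<union> R2" using sub deg by (auto simp: Un_commute)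
        then show "finite {y. conn (B \<union> A) z y}" using fin finite_subset by blast
        show "z \<in> \<Union>B" using z deg by blast
        show "w \<in> \<Union>B \<and> w \<in> \<Union>A" if "conn (B \<union> A) z w" "w \<noteq> z" for w
        proof -
          have "w \<in> D" using sub that by (auto simp: Un_commute)
          then show ?thesis using deg[of w] no that by blast
        qed
      qed
      then show False using A z disj by blast
    qed
    then obtain z' where "z' \<noteq> z" "z' \<in> R2" "conn (A \<union> B) z z'" by (auto simp: Un_commute)
    then show ?thesis using z unfolding contract_def by blast
  qed
  ultimately show "D2 \<in> loops AB C R2" using deg D2 disj unfolding loops_def by blast
next
  fix D2 assume "D2 \<in> loops AB C R2"
  then obtain v where D2: "D2 = {w. conn (AB \<union> C) v w}"
    and deg: "\<And>w. w \<in> D2 \<Longrightarrow> w \<in> R2 \<and> w \<in> \<Union>AB \<and> w \<in> \<Union>C"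
    unfolding loops_def by blast
  have v: "v \<in> D2" by (simp add: D2)
  have D2R: "w \<notin> R1" if "w \<in> D2" for w using deg[OF that] disj by auto
  let ?D = "{z. conn (A \<union> B \<union> C) v z}"
  have D: "z \<in> ?D \<and> z \<notin> R1 \<longleftrightarrow> z \<in> D2" for z
    using conn_contract[of v z] D2R[OF v] D2R[of z] unfolding D2 by auto
  have partner: "\<exists>w'. w' \<noteq> w \<and> w' \<in> R0 \<union> R2 \<and> conn (A \<union> B) w w'" if "w \<in> D2" for w
  proof -
    have "w \<in> \<Union>AB" using deg that by blast
    then obtain a b where "w \<in> {a, b}" "a \<noteq> b" "a \<in> R0 \<union> R2" "b \<in> R0 \<union> R2" "conn (A \<union> B) a b"
      unfolding contract_def by blast
    then show ?thesis using conn_sym[of "A \<union> B" a b] by auto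
  qed
  have "(z \<in> R1 \<and> z \<in> \<Union>A \<and> z \<in> \<Union>B) \<or> (z \<in> R2 \<and> z \<in> \<Union>B \<and> z \<in> \<Union>C)" if z: "z \<in> ?D" for z
  proof (cases "z \<in> R1")
    case False
    then have z2: "z \<in> D2" using D z by blast
    then obtain z' where "z' \<noteq> z" "conn (A \<union> B) z z'" using partner by blast
    then have "z \<in> \<Union>(A \<union> B)" by (metis conn_neq_Union)
    then show ?thesis using deg[OF z2] A disj by blast
  next
    case True
    obtain w where w: "w \<notin> R1" "conn (AB \<union> C) v w" "conn (A \<union> B) w z"
      using conn_split[of v z] z D2R[OF v] by auto
    then have w2: "w \<in> D2" using D2 by blast
    \<comment> \<open>The \<open>A\<close>-\<open>B\<close> strand through \<open>z\<close> has the
      ends \<open>w\<close> and \<open>w'\<close>, both outside \<open>R1\<close>, so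
      \<open>two_ends\<close> makes \<open>z\<close> an inner vertex covered by both layers.\<close>
    then obtain w' where w': "w' \<noteq> w" "w' \<in> R0 \<union> R2" "conn (A \<union> B) w w'" using partner by blast
    have "\<not> (w \<in> \<Union>A \<and> w \<in> \<Union>B)" using deg[OF w2] A disj by blast
    moreover have "\<not> (w' \<in> \<Union>A \<and> w' \<in> \<Union>B)" using w' A B disj by blast
    ultimately have "z = w \<or> z = w' \<or> (z \<in> \<Union>A \<and> z \<in> \<Union>B)"
      using two_ends[OF mA mB w'(3)] w'(1) w(3) by blast
    then show ?thesis using True w(1) w'(2) disj by blast
  qed
  then have "?D \<in> loops3" unfolding loops3_def by blast
  moreover have "?D \<inter> R2 = D2" using D deg D2R disj by blast
  ultimately show "D2 \<in> (\<lambda>D. D \<inter> R2) ` {D \<in> loops3. D \<inter> R2 \<noteq> {}}" using v by blast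
qed

lemma finite_loops3: "finite loops3"
proof -
  have "loops3 \<subseteq> (\<lambda>v. {w. conn (A \<union> B \<union> C) v w}) ` (R1 \<union> R2)"
  proof
    fix D assume "D \<in> loops3"
    then obtain v where v: "D = {w. conn (A \<union> B \<union> C) v w}" "\<forall>w\<in>D. w \<in> R1 \<or> w \<in> R2"
      unfolding loops3_def by blast
    then have "v \<in> R1 \<union> R2" by simp
    then show "D \<in> (\<lambda>v. {w. conn (A \<union> B \<union> C) v w}) ` (R1 \<union> R2)" using v(1) by blast
  qed
  then show ?thesis using fin finite_subset by blast
qed

lemma card_loops3: "card loops3 = card (loops A B R1) + card (loops AB C R2)"
proof -
  have "loops3 = {D \<in> loops3. D \<inter> R2 = {}} \<union> {D \<in> loops3. D \<inter> R2 \<noteq> {}}" by blast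
  then have "card loops3 = card {D \<in> loops3. D \<inter> R2 = {}} + card {D \<in> loops3. D \<inter> R2 \<noteq> {}}"
    using finite_loops3 card_Un_disjoint[of "{D \<in> loops3. D \<inter> R2 = {}}" "{D \<in> loops3. D \<inter> R2 \<noteq> {}}"]
    by fastforce
  then show ?thesis using loops3_row1 bij_betw_same_card[OF loops3_row2] by simp
qed

lemma reverse: "stack C B A R3 R2 R1 R0"
  using mA mB mC A B C disj fin by unfold_locales auto

end

text \<open>Both sides count the loops of the triple stack, once read from above and once from
  below.\<close>

lemma stack_loops_assoc:
  assumes "stack X Y Z R0 R1 R2 R3"
  shows "card (loops X Y R1) + card (loops (contract (X \<union> Y) (R0 \<union> R2)) Z R2) =
    card (loops Y Z R2) + card (loops X (contract (Y \<union> Z) (R1 \<union> R3)) R1)"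
proof -
  interpret s: stack X Y Z R0 R1 R2 R3 by (rule assms)
  interpret r: stack Z Y X R3 R2 R1 R0 by (rule s.reverse)
  have "s.loops3 = r.loops3" unfolding s.loops3_def r.loops3_def
    by (simp add: ac_simps disj_commute conj_commute)
  then show ?thesis using s.card_loops3 r.card_loops3
    by (simp add: loops_commute[of Y Z] loops_commute[of X "contract _ _"] Un_commute)
qed

section \<open>Planarity of the product of diagrams\<close>

text \<open>On \<open>verts k\<close> this agrees with \<open>bot_to_mid\<close>, but as an
  involution of all vertices it transports connectivity and loops in both directions. The map
  \<open>swap_top\<close> does the same for \<open>top_to_mid\<close>.\<close>

fun swap_bot :: "vtx \<Rightarrow> vtx" where
  "swap_bot (T i) = T i"
| "swap_bot (B i) = M i"
| "swap_bot (M i) = B i"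

fun swap_top :: "vtx \<Rightarrow> vtx" where
  "swap_top (T i) = M i"
| "swap_top (B i) = B i"
| "swap_top (M i) = T i"

text \<open>Moves the picture of a diagram over a 1-factor one row down, into the lower two layers
  of a triple stack; closing up cyclically makes it a bijection.\<close>

fun row_shift :: "vtx \<Rightarrow> vtx" where
  "row_shift (T i) = M i"
| "row_shift (M i) = B i"
| "row_shift (B i) = T i"

lemma swap_bot_swap_bot [simp]: "swap_bot (swap_bot v) = v"
  by (cases v) auto

lemma swap_top_swap_top [simp]: "swap_top (swap_top v) = v"
  by (cases v) auto

lemma bij_swap_bot: "bij swap_bot"
  by (rule involuntory_imp_bij) simp

lemma bij_swap_top: "bij swap_top"
  by (rule involuntory_imp_bij) simp

lemma bij_row_shift: "bij row_shift"
proof (rule bijI)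
  show "inj row_shift"
  proof (rule injI)
    fix x y show "row_shift x = row_shift y \<Longrightarrow> x = y" by (cases x; cases y) auto
  qed
  have "row_shift (row_shift (row_shift v)) = v" for v by (cases v) auto
  then show "surj row_shift" by (rule surjI[of row_shift "\<lambda>v. row_shift (row_shift v)"])
qed

lemma T_in_verts [simp]: "T i \<in> verts k \<longleftrightarrow> i \<in> {1..k}"
  and B_in_verts [simp]: "B i \<in> verts k \<longleftrightarrow> i \<in> {1..k}"
  and M_in_verts [simp]: "M i \<notin> verts k"
  by (auto simp: verts_def)

lemma verts_cases:
  "v \<in> verts k \<Longrightarrow> (\<exists>i. v = T i \<and> 1 \<le> i \<and> i \<le> k) \<or> (\<exists>i. v = B i \<and> 1 \<le> i \<and> i \<le> k)"
  by (auto simp: verts_def)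

lemma finite_verts: "finite (verts k)"
  by (simp add: verts_def)

lemma diagramD:
  assumes "d \<in> diagrams k"
  shows "e \<in> d \<Longrightarrow> \<exists>u v. e = {u, v} \<and> u \<noteq> v \<and> u \<in> verts k \<and> v \<in> verts k"
    and "e \<in> d \<Longrightarrow> e' \<in> d \<Longrightarrow> e \<noteq> e' \<Longrightarrow> e \<inter> e' = {}"
    and "e \<in> d \<Longrightarrow> e' \<in> d \<Longrightarrow> \<not> (\<exists>a b c c'. e = {a, b} \<and> e' = {c, c'} \<and>
         pos k a < pos k c \<and> pos k c < pos k b \<and> pos k b < pos k c')"
proof -
  note d = assms[unfolded diagrams_def motzkin_diagram_def mem_Collect_eq]
  show "e \<in> d \<Longrightarrow> \<exists>u v. e = {u, v} \<and> u \<noteq> v \<and> u \<in> verts k \<and> v \<in> verts k"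
    by (rule d[THEN conjunct1, THEN bspec])
  show "e \<in> d \<Longrightarrow> e' \<in> d \<Longrightarrow> e \<noteq> e' \<Longrightarrow> e \<inter> e' = {}"
    by (rule d[THEN conjunct2, THEN conjunct1, THEN bspec, THEN bspec, THEN mp])
  show "e \<in> d \<Longrightarrow> e' \<in> d \<Longrightarrow> \<not> (\<exists>a b c c'. e = {a, b} \<and> e' = {c, c'} \<and>
         pos k a < pos k c \<and> pos k c < pos k b \<and> pos k b < pos k c')"
    by (rule d[THEN conjunct2, THEN conjunct2, THEN bspec, THEN bspec])
qed

lemma diagram_matching:
  assumes "d \<in> diagrams k"
  shows "matching d"
  unfolding matching_def
proof (intro conjI ballI impI)
  fix e assume "e \<in> d"
  from diagramD(1)[OF assms this] show "\<exists>u v. e = {u, v} \<and> u \<noteq> v" by blast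
qed (rule diagramD(2)[OF assms])

lemma diagram_Union:
  assumes "d \<in> diagrams k"
  shows "\<Union>d \<subseteq> verts k"
proof (rule Union_least)
  fix e assume "e \<in> d"
  from diagramD(1)[OF assms this] show "e \<subseteq> verts k" by blast
qed

lemma diagram_edge:
  assumes "d \<in> diagrams k" "{u, v} \<in> d"
  shows "u \<noteq> v" "u \<in> verts k" "v \<in> verts k"
  using matching_neq[OF diagram_matching[OF assms(1)] assms(2)] diagram_Union[OF assms(1)] assms(2)
  by auto

lemma diagram_noncrossing:
  assumes "d \<in> diagrams k" "{a, b} \<in> d" "{c, c'} \<in> d"
    "pos k a < pos k c" "pos k c < pos k b" "pos k b < pos k c'"
  shows False
  by (rule notE[OF diagramD(3)[OF assms(1-3)]], intro exI conjI, (rule refl)+, (rule assms)+)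

lemma disjoint_edgesI:
  assumes "\<And>e. e \<in> X \<Longrightarrow> \<exists>u v. e = {u, v}" "\<And>a b c. {a, b} \<in> X \<Longrightarrow> {a, c} \<in> X \<Longrightarrow> b = c"
    and e: "e \<in> X" "e' \<in> X" "e \<noteq> e'"
  shows "e \<inter> e' = {}"
proof (rule equals0I)
  fix a assume a: "a \<in> e \<inter> e'"
  have other: "\<exists>b. e = {a, b}" if "e \<in> X" "a \<in> e" for e
    using assms(1)[OF that(1)] that(2) by (auto simp: insert_commute)
  obtain b c where "e = {a, b}" "e' = {a, c}" using other[of e] other[of e'] e a by auto
  then show False using assms(2)[of a b c] e by simp
qed

lemma diagramI:
  assumes "\<And>e. e \<in> d \<Longrightarrow> \<exists>u v. e = {u, v} \<and> u \<noteq> v \<and> u \<in> verts k \<and> v \<in> verts k"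
    and "\<And>a b c. {a, b} \<in> d \<Longrightarrow> {a, c} \<in> d \<Longrightarrow> b = c"
    and nc: "\<And>a b c c'. {a, b} \<in> d \<Longrightarrow> {c, c'} \<in> d \<Longrightarrow>
      pos k a < pos k c \<Longrightarrow> pos k c < pos k b \<Longrightarrow> pos k b < pos k c' \<Longrightarrow> False"
  shows "d \<in> diagrams k"
  unfolding diagrams_def motzkin_diagram_def mem_Collect_eq
proof (intro conjI ballI impI)
  fix e e' assume "e \<in> d" "e' \<in> d" "e \<noteq> e'"
  then show "e \<inter> e' = {}" by (rule disjoint_edgesI[rotated 2]) (use assms(1,2) in blast)+
next
  fix e e' assume "e \<in> d" "e' \<in> d"
  then show "\<not> (\<exists>a b c c'. e = {a, b} \<and> e' = {c, c'} \<and>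
       pos k a < pos k c \<and> pos k c < pos k b \<and> pos k b < pos k c')"
    using nc by auto
qed (rule assms(1))

lemma finite_diagrams: "finite (diagrams k)"
proof (rule finite_subset)
  show "diagrams k \<subseteq> Pow (Pow (verts k))" using diagram_Union by blast
qed (simp add: finite_verts)

lemma upper_swap:
  assumes "d \<in> diagrams k"
  shows "upper d = (`) swap_bot ` d"
proof -
  have "bot_to_mid ` e = swap_bot ` e" if "e \<in> d" for e
  proof (rule image_cong[OF refl])
    fix v assume "v \<in> e"
    then have "v \<in> verts k" using diagram_Union[OF assms] that by blast
    then show "bot_to_mid v = swap_bot v" by (cases v) auto
  qed
  then show ?thesis unfolding upper_def by (auto simp: image_iff)
qed

lemma lower_swap:
  assumes "d \<in> diagrams k"
  shows "lower d = (`) swap_top ` d"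
proof -
  have "top_to_mid ` e = swap_top ` e" if "e \<in> d" for e
  proof (rule image_cong[OF refl])
    fix v assume "v \<in> e"
    then have "v \<in> verts k" using diagram_Union[OF assms] that by blast
    then show "top_to_mid v = swap_top v" by (cases v) auto
  qed
  then show ?thesis unfolding lower_def by (auto simp: image_iff)
qed

lemma matching_upper: "d \<in> diagrams k \<Longrightarrow> matching (upper d)"
  by (simp add: upper_swap matching_image bij_is_inj bij_swap_bot diagram_matching)

lemma matching_lower: "d \<in> diagrams k \<Longrightarrow> matching (lower d)"
  by (simp add: lower_swap matching_image bij_is_inj bij_swap_top diagram_matching)

lemma edge_image_iff:
  assumes "\<And>v. f (f v) = v"
  shows "{u, v} \<in> (`) f ` X \<longleftrightarrow> {f u, f v} \<in> X"
proof
  assume "{u, v} \<in> (`) f ` X"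
  then obtain e where "e \<in> X" "{u, v} = f ` e" by blast
  then have "f ` {u, v} = e" using assms by (simp add: image_image)
  then show "{f u, f v} \<in> X" using \<open>e \<in> X\<close> by simp
next
  assume "{f u, f v} \<in> X"
  then have "f ` {f u, f v} \<in> (`) f ` X" by blast
  then show "{u, v} \<in> (`) f ` X" using assms by simp
qed

lemma upper_edge: "d \<in> diagrams k \<Longrightarrow> {u, v} \<in> upper d \<longleftrightarrow> {swap_bot u, swap_bot v} \<in> d"
  by (simp add: upper_swap edge_image_iff)

lemma lower_edge: "d \<in> diagrams k \<Longrightarrow> {u, v} \<in> lower d \<longleftrightarrow> {swap_top u, swap_top v} \<in> d"
  by (simp add: lower_swap edge_image_iff)

lemma mem_Union_upper: "d \<in> diagrams k \<Longrightarrow> v \<in> \<Union>(upper d) \<longleftrightarrow> swap_bot v \<in> \<Union>d"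
  by (auto simp: upper_swap) (metis image_eqI swap_bot_swap_bot)

lemma mem_Union_lower: "d \<in> diagrams k \<Longrightarrow> v \<in> \<Union>(lower d) \<longleftrightarrow> swap_top v \<in> \<Union>d"
  by (auto simp: lower_swap) (metis image_eqI swap_top_swap_top)

lemma Union_upper: "d \<in> diagrams k \<Longrightarrow> \<Union>(upper d) \<subseteq> T ` {1..k} \<union> M ` {1..k}"
proof
  fix v assume d: "d \<in> diagrams k" "v \<in> \<Union>(upper d)"
  then have "swap_bot v \<in> verts k" using mem_Union_upper diagram_Union by blast
  then show "v \<in> T ` {1..k} \<union> M ` {1..k}" by (cases v) auto
qed

lemma Union_lower: "d \<in> diagrams k \<Longrightarrow> \<Union>(lower d) \<subseteq> M ` {1..k} \<union> B ` {1..k}"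
proof
  fix v assume d: "d \<in> diagrams k" "v \<in> \<Union>(lower d)"
  then have "swap_top v \<in> verts k" using mem_Union_lower diagram_Union by blast
  then show "v \<in> M ` {1..k} \<union> B ` {1..k}" by (cases v) auto
qed

section \<open>The side of a strand on which a vertex lies\<close>

fun cnt :: "vtx set \<Rightarrow> vtx \<Rightarrow> nat" where
  "cnt S (T i) = card {j. j < i \<and> T j \<in> S}"
| "cnt S (B i) = card {j. j < i \<and> B j \<in> S}"
| "cnt S (M i) = card {j. j < i \<and> M j \<in> S}"

lemma pos_inj: "u \<in> verts k \<Longrightarrow> v \<in> verts k \<Longrightarrow> pos k u = pos k v \<Longrightarrow> u = v"
  by (cases u; cases v) auto

text \<open>Planarity makes the set of vertices of \<open>S\<close> strictly between
  \<open>a\<close> and \<open>b\<close> closed under \<open>d\<close>, so their number is even. If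
  \<open>a\<close> and \<open>b\<close> share a row, this number is the difference of the two
  counts. For a vertical edge it counts the vertices to the right, the two counts are those to the
  left, and \<open>S\<close> itself is even.\<close>

lemma even_cnt_edge:
  assumes d: "d \<in> diagrams k" and S: "S \<subseteq> \<Union>d"
    and cl: "\<And>a b. a \<in> S \<Longrightarrow> {a, b} \<in> d \<Longrightarrow> b \<in> S"
    and ab: "{a, b} \<in> d" "a \<notin> S"
  shows "even (cnt S a) \<longleftrightarrow> even (cnt S b)"
proof -
  have "even (cnt S a) \<longleftrightarrow> even (cnt S b)"
    if ab: "{a, b} \<in> d" and aS: "a \<notin> S" and bS: "b \<notin> S" and lt: "pos k a < pos k b" for a b
  proof -
    let ?S' = "{z \<in> S. pos k a < pos k z \<and> pos k z < pos k b}"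
    have V: "S \<subseteq> verts k" using S diagram_Union[OF d] by blast
    then have fS: "finite S" using finite_verts finite_subset by blast
    have evS: "even (card S)" using even_card_matched[OF diagram_matching[OF d] fS S cl] .
    have "even (card ?S')"
    proof (rule even_card_matched[OF diagram_matching[OF d]])
      show "finite ?S'" using fS by simp
      show "?S' \<subseteq> \<Union>d" using S by blast
      fix z z' assume z: "z \<in> ?S'" and e: "{z, z'} \<in> d"
      have z'S: "z' \<in> S" using cl z e by blast
      then have "z' \<noteq> a" "z' \<noteq> b" using aS bS by auto
      moreover have "a \<in> verts k" "b \<in> verts k" "z' \<in> verts k"
        using ab diagram_Union[OF d] V z'S by auto
      ultimately have ne: "pos k z' \<noteq> pos k a" "pos k z' \<noteq> pos k b" using pos_inj by blast+
      have "\<not> pos k b < pos k z'" using diagram_noncrossing[OF d ab e] z by auto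
      moreover have "\<not> pos k z' < pos k a"
        using diagram_noncrossing[OF d, of z' z a b] ab e z by (auto simp: insert_commute)
      ultimately show "z' \<in> ?S'" using z'S ne by auto
    qed
    have vs: "a \<in> verts k" "b \<in> verts k" using ab diagram_Union[OF d] by auto
    have fr: "finite {j. P j \<and> T j \<in> S}" "finite {j. P j \<and> B j \<in> S}" for P
      by (rule finite_subset[of _ "{1..k}"]; use V in force)+
    show ?thesis
    proof (cases a)
      case aT: (T i)
      show ?thesis
      proof (cases b)
        case bT: (T j)
        have S'_eq: "?S' = T ` {t. (i < t \<and> t < j) \<and> T t \<in> S}"
        proof (intro subset_antisym subsetI)
          fix z assume z: "z \<in> ?S'"
          then have "z \<in> verts k" using V by blast
          then show "z \<in> T ` {t. (i < t \<and> t < j) \<and> T t \<in> S}"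
            using z vs aT bT by (cases z) auto
        qed (use aT bT in auto)
        have "{t. t < j \<and> T t \<in> S} = {t. t < i \<and> T t \<in> S} \<union> {t. (i < t \<and> t < j) \<and> T t \<in> S}"
        proof (rule set_eqI)
          fix t show "t \<in> {t. t < j \<and> T t \<in> S} \<longleftrightarrow>
            t \<in> {t. t < i \<and> T t \<in> S} \<union> {t. (i < t \<and> t < j) \<and> T t \<in> S}"
            by (cases t i rule: linorder_cases) (use aS aT bT lt in auto)
        qed
        then have "cnt S b = card ({t. t < i \<and> T t \<in> S} \<union> {t. (i < t \<and> t < j) \<and> T t \<in> S})"
          unfolding bT cnt.simps by (rule arg_cong)
        also have "\<dots> = cnt S a + card {t. (i < t \<and> t < j) \<and> T t \<in> S}"
          unfolding aT cnt.simps by (rule card_Un_disjoint[OF fr(1) fr(1)]) auto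
        also have "card {t. (i < t \<and> t < j) \<and> T t \<in> S} = card ?S'"
          unfolding S'_eq by (simp add: card_image inj_on_def)
        finally show ?thesis using \<open>even (card ?S')\<close> by simp
      next
        case bB: (B j)
        have "S = T ` {t. t < i \<and> T t \<in> S} \<union> (B ` {t. t < j \<and> B t \<in> S} \<union> ?S')"
        proof (intro subset_antisym subsetI)
          fix z assume z: "z \<in> S"
          then have "z \<noteq> a" "z \<noteq> b" "z \<in> verts k" using aS bS V by auto
          then show "z \<in> T ` {t. t < i \<and> T t \<in> S} \<union> (B ` {t. t < j \<and> B t \<in> S} \<union> ?S')"
            using z vs aT bB by (cases z) auto
        qed auto
        then have "card S = card (T ` {t. t < i \<and> T t \<in> S} \<union> (B ` {t. t < j \<and> B t \<in> S} \<union> ?S'))"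
          by (rule arg_cong)
        also have "\<dots> = card (T ` {t. t < i \<and> T t \<in> S}) + card (B ` {t. t < j \<and> B t \<in> S} \<union> ?S')"
          by (rule card_Un_disjoint) (use fr fS aT bB vs in auto)
        also have "card (B ` {t. t < j \<and> B t \<in> S} \<union> ?S') = card (B ` {t. t < j \<and> B t \<in> S}) + card ?S'"
          by (rule card_Un_disjoint) (use fr fS aT bB vs in auto)
        finally have "card S = cnt S a + (cnt S b + card ?S')"
          using aT bB by (simp add: card_image inj_on_def)
        then show ?thesis using evS \<open>even (card ?S')\<close> by presburger
      qed (use vs in auto)
    next
      case aB: (B i)
      then obtain j where bB: "b = B j" using vs lt by (cases b) auto
      \<comment> \<open>Positions run from right to left along the bottom row, so the earlier end is
        the right one.\<close>
      have ij: "j < i" using aB bB vs lt by auto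
      have S'_eq: "?S' = B ` {t. (j < t \<and> t < i) \<and> B t \<in> S}"
      proof (intro subset_antisym subsetI)
        fix z assume z: "z \<in> ?S'"
        then have "z \<in> verts k" using V by blast
        then show "z \<in> B ` {t. (j < t \<and> t < i) \<and> B t \<in> S}"
          using z vs aB bB by (cases z) auto
      qed (use vs aB bB in auto)
      have "{t. t < i \<and> B t \<in> S} = {t. t < j \<and> B t \<in> S} \<union> {t. (j < t \<and> t < i) \<and> B t \<in> S}"
      proof (rule set_eqI)
        fix t show "t \<in> {t. t < i \<and> B t \<in> S} \<longleftrightarrow>
          t \<in> {t. t < j \<and> B t \<in> S} \<union> {t. (j < t \<and> t < i) \<and> B t \<in> S}"
          by (cases t j rule: linorder_cases) (use bS aB bB ij in auto)
      qed
      then have "cnt S a = card ({t. t < j \<and> B t \<in> S} \<union> {t. (j < t \<and> t < i) \<and> B t \<in> S})"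
        unfolding aB cnt.simps by (rule arg_cong)
      also have "\<dots> = cnt S b + card {t. (j < t \<and> t < i) \<and> B t \<in> S}"
        unfolding bB cnt.simps by (rule card_Un_disjoint[OF fr(2) fr(2)]) auto
      also have "card {t. (j < t \<and> t < i) \<and> B t \<in> S} = card ?S'"
        unfolding S'_eq by (simp add: card_image inj_on_def)
      finally show ?thesis using \<open>even (card ?S')\<close> by simp
    qed (use vs in auto)
  qed
  note * = this
  have "b \<notin> S" using cl[of b a] ab by (auto simp: insert_commute)
  moreover have "pos k a < pos k b \<or> pos k b < pos k a"
    using diagram_edge[OF d ab(1)] pos_inj linorder_neqE_nat by blast
  ultimately show ?thesis using *[of a b] *[of b a] ab by (auto simp: insert_commute)
qed

lemma compose_contract: "compose k d1 d2 = contract (upper d1 \<union> lower d2) (verts k)"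
  unfolding compose_def contract_def conn2_conn ..

lemma outer_end:
  assumes "d1 \<in> diagrams k" "d2 \<in> diagrams k" "u \<in> verts k"
  shows "\<not> (u \<in> \<Union>(upper d1) \<and> u \<in> \<Union>(lower d2))"
proof
  assume "u \<in> \<Union>(upper d1) \<and> u \<in> \<Union>(lower d2)"
  then have "u \<in> T ` {1..k} \<union> M ` {1..k}" "u \<in> M ` {1..k} \<union> B ` {1..k}"
    using Union_upper[OF assms(1)] Union_lower[OF assms(2)] by (meson subsetD)+
  then show False using assms(3) by (cases u) auto
qed

text \<open>A strand meets the outer rows only in its two ends, so its counts there become sums of
  such indicators.\<close>

lemma card_below:
  "card {j::nat. j = a \<and> j < i} = (if a < i then 1 else 0)"
  "a \<noteq> b \<Longrightarrow> card {j::nat. j < i \<and> (j = a \<or> j = b)} =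
     (if a < i then 1 else 0) + (if b < i then 1 else 0)"
proof -
  have "{j. j = a \<and> j < i} = (if a < i then {a} else {})" by auto
  then show "card {j::nat. j = a \<and> j < i} = (if a < i then 1 else 0)" by simp
  assume "a \<noteq> b"
  moreover have "{j. j < i \<and> (j = a \<or> j = b)} =
    (if a < i then if b < i then {a, b} else {a} else if b < i then {b} else {})" by auto
  ultimately show "card {j::nat. j < i \<and> (j = a \<or> j = b)} =
     (if a < i then 1 else 0) + (if b < i then 1 else 0)" by simp
qed

text \<open>The parity of \<open>cnt P\<close> tells on which side of the strand \<open>P\<close> a vertex lies, and it is constant
  along every other strand.\<close>
lemma strands_noncrossing:
  assumes d1: "d1 \<in> diagrams k" and d2: "d2 \<in> diagrams k"
    and uv: "conn (upper d1 \<union> lower d2) u v" and uv': "conn (upper d1 \<union> lower d2) u' v'"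
    and V: "u \<in> verts k" "v \<in> verts k" "u' \<in> verts k" "v' \<in> verts k"
    and lt: "pos k u < pos k u'" "pos k u' < pos k v" "pos k v < pos k v'"
  shows False
proof -
  let ?U = "upper d1" and ?L = "lower d2"
  define P where "P = {w. conn (?U \<union> ?L) u w}"
  have ne: "u \<noteq> v" "u \<noteq> u'" "u' \<noteq> v" "u \<noteq> v'" "v \<noteq> v'" using lt by auto
  have P: "w = u \<or> w = v \<or> (w \<in> \<Union>?U \<and> w \<in> \<Union>?L)" if "w \<in> P" for w
    using two_ends[OF matching_upper[OF d1] matching_lower[OF d2] uv ne(1)
      outer_end[OF d1 d2 V(1)] outer_end[OF d1 d2 V(2)]] that unfolding P_def by simp
  have uP: "u \<in> P" "v \<in> P" using uv by (auto simp: P_def)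
  have Pcl: "b \<in> P" if "a \<in> P" "{a, b} \<in> ?U \<union> ?L" for a b
    using that conn_step[of "?U \<union> ?L" u a b] unfolding P_def by simp
  have PV: "w \<in> P \<and> w \<in> verts k \<longleftrightarrow> w = u \<or> w = v" for w
    using P[of w] outer_end[OF d1 d2, of w] uP V by auto
  have uvU: "u \<in> \<Union>(?U \<union> ?L)" "v \<in> \<Union>(?U \<union> ?L)"
    using conn_neq_Union[OF uv ne(1)] conn_neq_Union[OF conn_sym[OF uv]] ne(1) by auto
  have PT: "T i \<in> \<Union>?U" if "T i \<in> P" for i
    using P[OF that] uvU Union_lower[OF d2] by auto
  have PB: "B i \<in> \<Union>?L" if "B i \<in> P" for i
    using P[OF that] uvU Union_upper[OF d1] by auto
  have PM: "M i \<in> \<Union>?U" "M i \<in> \<Union>?L" if "M i \<in> P" for i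
    using P[OF that] V by auto
  \<comment> \<open>The strand in the coordinates of each diagram, where it is a union of edges and
    \<open>even_cnt_edge\<close> applies.\<close>
  let ?S1 = "{z \<in> \<Union>d1. swap_bot z \<in> P}" and ?S2 = "{z \<in> \<Union>d2. swap_top z \<in> P}"
  have c1: "cnt ?S1 z = cnt P (swap_bot z)" if "z \<in> verts k" for z
  proof -
    have "T j \<in> ?S1 \<longleftrightarrow> T j \<in> P" "B j \<in> ?S1 \<longleftrightarrow> M j \<in> P" for j
      using PT[of j] PM(1)[of j] mem_Union_upper[OF d1, of "T j"] mem_Union_upper[OF d1, of "M j"]
      by (simp; argo)+
    then show ?thesis using that by (cases z) simp_all
  qed
  have c2: "cnt ?S2 z = cnt P (swap_top z)" if "z \<in> verts k" for z
  proof -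
    have "B j \<in> ?S2 \<longleftrightarrow> B j \<in> P" "T j \<in> ?S2 \<longleftrightarrow> M j \<in> P" for j
      using PB[of j] PM(2)[of j] mem_Union_lower[OF d2, of "B j"] mem_Union_lower[OF d2, of "M j"]
      by (simp; argo)+
    then show ?thesis using that by (cases z) simp_all
  qed
  have inv: "even (cnt P w) = even (cnt P w')" if w: "w \<notin> P" "{w, w'} \<in> ?U \<union> ?L" for w w'
    using w(2)
  proof
    assume "{w, w'} \<in> ?U"
    then have e: "{swap_bot w, swap_bot w'} \<in> d1" using upper_edge[OF d1] by blast
    have "even (cnt ?S1 (swap_bot w)) = even (cnt ?S1 (swap_bot w'))"
    proof (rule even_cnt_edge[OF d1 _ _ e])
      fix a b assume "a \<in> ?S1" "{a, b} \<in> d1"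
      then show "b \<in> ?S1" using Pcl[of "swap_bot a" "swap_bot b"] upper_edge[OF d1] by auto
    qed (use w in auto)
    then show ?thesis using c1[of "swap_bot w"] c1[of "swap_bot w'"] diagram_edge[OF d1 e] by simp
  next
    assume "{w, w'} \<in> ?L"
    then have e: "{swap_top w, swap_top w'} \<in> d2" using lower_edge[OF d2] by blast
    have "even (cnt ?S2 (swap_top w)) = even (cnt ?S2 (swap_top w'))"
    proof (rule even_cnt_edge[OF d2 _ _ e])
      fix a b assume "a \<in> ?S2" "{a, b} \<in> d2"
      then show "b \<in> ?S2" using Pcl[of "swap_top a" "swap_top b"] lower_edge[OF d2] by auto
    qed (use w in auto)
    then show ?thesis using c2[of "swap_top w"] c2[of "swap_top w'"] diagram_edge[OF d2 e] by simp
  qed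
  have "v' \<in> {w. w \<notin> P \<and> even (cnt P w) = even (cnt P u')}" using uv'
  proof (rule conn_closed)
    show "u' \<in> {w. w \<notin> P \<and> even (cnt P w) = even (cnt P u')}" using PV[of u'] V ne by auto
    fix a b assume a: "a \<in> {w. w \<notin> P \<and> even (cnt P w) = even (cnt P u')}" "{a, b} \<in> ?U \<union> ?L"
    then have "b \<notin> P" using Pcl[of b a] by (auto simp: insert_commute)
    then show "b \<in> {w. w \<notin> P \<and> even (cnt P w) = even (cnt P u')}" using a inv[of a b] by auto
  qed
  then have ev: "even (cnt P v') = even (cnt P u')" by simp
  have cT: "cnt P (T i) = card {j. j < i \<and> (T j = u \<or> T j = v)}" if "i \<le> k" for i
  proof -
    have "T j \<in> P \<longleftrightarrow> T j = u \<or> T j = v" for j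
      using PV[of "T j"] subsetD[OF Union_upper[OF d1] PT[of j]] by auto
    then show ?thesis by simp
  qed
  have cB: "cnt P (B i) = card {j. j < i \<and> (B j = u \<or> B j = v)}" if "i \<le> k" for i
  proof -
    have "B j \<in> P \<longleftrightarrow> B j = u \<or> B j = v" for j
      using PV[of "B j"] subsetD[OF Union_lower[OF d2] PB[of j]] by auto
    then show ?thesis by simp
  qed
  \<comment> \<open>Positions list the top row before the bottom row, so \<open>lt\<close> leaves
    five placements of the four ends. In each of them the counts at \<open>u'\<close> and
    \<open>v'\<close> differ in parity.\<close>
  show False
    using verts_cases[OF V(1)] verts_cases[OF V(2)] verts_cases[OF V(3)] verts_cases[OF V(4)] ev lt ne
    by (elim disjE exE conjE)
      (auto simp: cT cB card_below split: if_splits simp del: cnt.simps)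
qed

text \<open>By \<open>two_ends\<close> a strand has no third outer vertex, which makes the edges
  disjoint; \<open>strands_noncrossing\<close> gives planarity.\<close>

lemma compose_diagram:
  assumes d1: "d1 \<in> diagrams k" and d2: "d2 \<in> diagrams k"
  shows "compose k d1 d2 \<in> diagrams k"
proof -
  let ?D = "compose k d1 d2"
  have edge: "{u, v} \<in> ?D \<longleftrightarrow> u \<noteq> v \<and> u \<in> verts k \<and> v \<in> verts k \<and> conn (upper d1 \<union> lower d2) u v"
    for u v by (simp add: compose_contract contract_edge)
  have dbl: "\<exists>u v. e = {u, v} \<and> u \<noteq> v \<and> u \<in> verts k \<and> v \<in> verts k" if "e \<in> ?D" for e
    using that unfolding compose_def by auto
  have uniq: "b = c" if "{a, b} \<in> ?D" "{a, c} \<in> ?D" for a b c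
    using two_ends[OF matching_upper[OF d1] matching_lower[OF d2], of a b c] that
      outer_end[OF d1 d2, of a] outer_end[OF d1 d2, of b] outer_end[OF d1 d2, of c]
    unfolding edge by auto
  show ?thesis
    by (rule diagramI[OF dbl uniq]) (use strands_noncrossing[OF d1 d2] in \<open>auto simp: edge\<close>)
qed

section \<open>Motzkin paths and 1-factors\<close>

text \<open>The weak inequalities in the last clause also keep white vertices off the ends of edges.
  Edges are unordered, so both crossing clauses speak of either orientation.\<close>

definition factor :: "nat \<Rightarrow> nat set set \<Rightarrow> nat set \<Rightarrow> bool" where
  "factor k E W \<longleftrightarrow> matching E \<and> \<Union>E \<subseteq> {1..k} \<and> W \<subseteq> {1..k} \<and>
     (\<forall>i j a b. {i, j} \<in> E \<longrightarrow> {a, b} \<in> E \<longrightarrow> \<not> (i < a \<and> a < j \<and> j < b)) \<and>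
     (\<forall>i j w. {i, j} \<in> E \<longrightarrow> w \<in> W \<longrightarrow> \<not> (i \<le> w \<and> w \<le> j))"

definition height :: "int list \<Rightarrow> nat \<Rightarrow> int" where
  "height p n = sum_list (take n p)"

lemma height_Suc: "n < length p \<Longrightarrow> height p (Suc n) = height p n + p ! n"
  by (simp add: height_def take_Suc_conv_app_nth)

lemma height_step: "1 \<le> i \<Longrightarrow> i \<le> length p \<Longrightarrow> height p i = height p (i - 1) + step p i"
  using height_Suc[of "i - 1" p] by (simp add: step_def)

lemma sum_step:
  assumes "1 \<le> i" "i \<le> Suc j" "j \<le> length p"
  shows "(\<Sum>t=i..j. step p t) = height p j - height p (i - 1)"
  using assms
proof (induction j)
  case 0
  then show ?case by (simp add: height_def)
next
  case (Suc j)
  show ?case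
  proof (cases "i = Suc (Suc j)")
    case False
    then have "i \<le> Suc j" using Suc.prems by simp
    then have "(\<Sum>t=i..Suc j. step p t) = height p j - height p (i - 1) + step p (Suc j)"
      using Suc by (simp add: sum.nat_ivl_Suc')
    then show ?thesis using height_step[of "Suc j" p] Suc.prems by simp
  qed simp
qed

text \<open>Pairing in terms of heights: step \<open>j\<close> is the first return to the level held
  before step \<open>i\<close>. As no step values occur, uniqueness and nesting reduce to comparing
  heights.\<close>

definition excursion :: "int list \<Rightarrow> nat \<Rightarrow> nat \<Rightarrow> bool" where
  "excursion p i j \<longleftrightarrow> 1 \<le> i \<and> i < j \<and> j \<le> length p \<and> height p j = height p (i - 1) \<and>
     (\<forall>n. i \<le> n \<and> n < j \<longrightarrow> height p (i - 1) < height p n)"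

lemma step_cases:
  assumes "set p \<subseteq> {-1, 0, 1}" "1 \<le> i" "i \<le> length p"
  shows "step p i = -1 \<or> step p i = 0 \<or> step p i = 1"
proof -
  have "p ! (i - 1) \<in> set p" using assms by simp
  then show ?thesis using assms(1) unfolding step_def by auto
qed

text \<open>Steps change the height by at most one, so after an up step the path cannot sink below
  its former level without visiting it. Partial sums that start at 1 and avoid 0 therefore stay
  positive.\<close>

lemma paired_excursion:
  assumes p: "set p \<subseteq> {-1, 0, 1}"
  shows "paired p i j \<longleftrightarrow> excursion p i j"
proof
  assume *: "paired p i j"
  then have i: "1 \<le> i" "i < j" "j \<le> length p" "step p i = 1" by (auto simp: paired_def)
  have ne: "height p n \<noteq> height p (i - 1)" if "i < n" "n < j" for n
  proof -
    have "(\<Sum>t=i..n. step p t) \<noteq> 0" using * that by (auto simp: paired_def)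
    then show ?thesis using sum_step[of i n p] i that by simp
  qed
  have "height p j = height p (i - 1)" using * sum_step[of i j p] i by (simp add: paired_def)
  moreover have "height p (i - 1) < height p n" if "i \<le> n" "n < j" for n
    using that
  proof (induction n rule: dec_induct)
    case base
    then show ?case using height_step[of i p] i by simp
  next
    case (step n)
    have "step p (Suc n) \<ge> -1" using step_cases[OF p, of "Suc n"] step i by auto
    then have "height p (Suc n) \<ge> height p n - 1" using height_step[of "Suc n" p] step i by simp
    then show ?case using ne[of "Suc n"] step by fastforce
  qed
  ultimately show "excursion p i j" using i by (simp add: excursion_def)
next
  assume *: "excursion p i j"
  then have i: "1 \<le> i" "i < j" "j \<le> length p" "height p j = height p (i - 1)"
    and gt: "\<And>n. i \<le> n \<Longrightarrow> n < j \<Longrightarrow> height p (i - 1) < height p n"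
    by (auto simp: excursion_def)
  have "step p i = 1"
    using step_cases[OF p, of i] gt[of i] height_step[of i p] i by auto
  moreover have "(\<Sum>t=i..j. step p t) = 0" using sum_step[of i j p] i by simp
  moreover have "(\<Sum>t=i..n. step p t) \<noteq> 0" if "i < n" "n < j" for n
    using sum_step[of i n p] i gt[of n] that by simp
  ultimately show "paired p i j" using i by (simp add: paired_def)
qed

lemma excursion_unique_right: "excursion p i j \<Longrightarrow> excursion p i j' \<Longrightarrow> j = j'"
proof -
  have "False" if "excursion p i j" "excursion p i j'" "j < j'" for j j'
  proof -
    have "i \<le> j" using that by (simp add: excursion_def)
    then have "height p (i - 1) < height p j" using that(2,3) by (simp add: excursion_def)
    then show False using that(1) by (simp add: excursion_def)
  qed
  then show "excursion p i j \<Longrightarrow> excursion p i j' \<Longrightarrow> j = j'" by (meson linorder_neqE_nat)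
qed

lemma excursion_unique_left: "excursion p i j \<Longrightarrow> excursion p i' j \<Longrightarrow> i = i'"
proof -
  have "False" if "excursion p i j" "excursion p i' j" "i < i'" for i i'
  proof -
    have "i \<le> i' - 1 \<and> i' - 1 < j" using that by (auto simp: excursion_def)
    then have "height p (i - 1) < height p (i' - 1)" using that by (auto simp: excursion_def)
    then show False using that by (auto simp: excursion_def)
  qed
  then show "excursion p i j \<Longrightarrow> excursion p i' j \<Longrightarrow> i = i'" by (meson linorder_neqE_nat)
qed

text \<open>Just before step \<open>a\<close> the path is higher than at \<open>j\<close>, whereas
  up to \<open>b\<close> it never sinks below its level before \<open>a\<close>.\<close>

lemma excursion_noncrossing:
  assumes "excursion p i j" "excursion p a b" "i < a" "a < j"
  shows "b < j"
proof (rule ccontr)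
  assume b: "\<not> b < j"
  have "i \<le> a - 1" "a - 1 < j" using assms by auto
  then have "height p j < height p (a - 1)" using assms(1) by (auto simp: excursion_def)
  moreover have "height p (a - 1) \<le> height p j"
    using assms b by (cases "j = b") (auto simp: excursion_def intro: less_imp_le)
  ultimately show False by simp
qed

lemma excursion_steps:
  assumes "set p \<subseteq> {-1, 0, 1}" "excursion p i j"
  shows "step p i = 1" "step p j = -1"
proof -
  show "step p i = 1" using assms paired_excursion[OF assms(1)] by (auto simp: paired_def)
  have "height p j < height p (j - 1)"
  proof -
    have "i \<le> j - 1" "j - 1 < j" using assms(2) by (auto simp: excursion_def)
    then show ?thesis using assms(2) by (auto simp: excursion_def)
  qed
  moreover have j: "1 \<le> j" "j \<le> length p" using assms(2) by (auto simp: excursion_def)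
  ultimately show "step p j = -1" using step_cases[OF assms(1) j] height_step[OF j] by auto
qed

lemma excursion_exists_right:
  assumes p: "set p \<subseteq> {-1, 0, 1}" and i: "1 \<le> i" "i < m" "m \<le> length p" "step p i = 1"
    and m: "height p m \<le> height p (i - 1)"
  shows "\<exists>j. excursion p i j"
proof -
  define j where "j = (LEAST n. i \<le> n \<and> height p n \<le> height p (i - 1))"
  have j: "i \<le> j" "height p j \<le> height p (i - 1)"
    using LeastI[of "\<lambda>n. i \<le> n \<and> height p n \<le> height p (i - 1)" m] m i unfolding j_def by auto
  have jm: "j \<le> m" unfolding j_def by (rule Least_le) (use m i in auto)
  have less: "height p (i - 1) < height p n" if "i \<le> n" "n < j" for n
    using not_less_Least[of n "\<lambda>n. i \<le> n \<and> height p n \<le> height p (i - 1)"] that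
    unfolding j_def[symmetric] by auto
  have hi: "height p i = height p (i - 1) + 1" using height_step[of i p] i by simp
  then have ij: "i < j" using j by (cases "i = j") auto
  have "height p (i - 1) < height p (j - 1)" using less[of "j - 1"] ij by auto
  moreover have "height p j \<ge> height p (j - 1) - 1"
    using height_step[of j p] step_cases[OF p, of j] ij jm i by auto
  ultimately have "height p j = height p (i - 1)" using j by simp
  then show ?thesis using ij jm i less unfolding excursion_def by auto
qed

text \<open>The partner follows the last time \<open>n < j\<close> at which the path is no higher
  than at \<open>j\<close>. Time 0 is a candidate because heights are nonnegative.\<close>

lemma excursion_exists_left:
  assumes p: "motzkin_path p" and j: "1 \<le> j" "j \<le> length p" "step p j = -1"
  shows "\<exists>i. excursion p i j"
proof -
  have s: "set p \<subseteq> {-1, 0, 1}" and nn: "\<And>n. n \<le> length p \<Longrightarrow> 0 \<le> height p n"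
    using p by (auto simp: motzkin_path_def height_def)
  define n where "n = Max {n. n < j \<and> height p n \<le> height p j}"
  have fin: "finite {n. n < j \<and> height p n \<le> height p j}" by simp
  have "0 \<in> {n. n < j \<and> height p n \<le> height p j}" using j nn[of j] by (auto simp: height_def)
  then have "n \<in> {n. n < j \<and> height p n \<le> height p j}"
    unfolding n_def by (intro Max_in[OF fin]) blast
  then have n: "n < j" "height p n \<le> height p j" by auto
  have gt: "height p j < height p m" if "n < m" "m < j" for m
    using Max_ge[OF fin, of m] that unfolding n_def[symmetric] by fastforce
  have hj: "height p j = height p (j - 1) - 1" using height_step[of j p] j by simp
  then have "n \<noteq> j - 1" using n by auto
  then have nj: "Suc n < j" using n by simp
  have "height p (Suc n) \<le> height p n + 1"
    using height_step[of "Suc n" p] step_cases[OF s, of "Suc n"] nj j by auto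
  then have "height p n = height p j" using gt[of "Suc n"] nj n by simp
  then have "excursion p (Suc n) j" using nj j gt unfolding excursion_def by auto
  then show ?thesis ..
qed

lemma onefactor_edge:
  "set p \<subseteq> {-1, 0, 1} \<Longrightarrow> {i, j} \<in> fst (onefactor p) \<longleftrightarrow> excursion p i j \<or> excursion p j i"
  by (auto simp: onefactor_def doubleton_eq_iff paired_excursion)

lemma onefactor_white:
  "set p \<subseteq> {-1, 0, 1} \<Longrightarrow> w \<in> snd (onefactor p) \<longleftrightarrow>
     1 \<le> w \<and> w \<le> length p \<and> step p w = 1 \<and> \<not> (\<exists>j. excursion p w j)"
  by (auto simp: onefactor_def paired_excursion)

lemma onefactor_factor:
  assumes "motzkin_path p" "length p = k"
  shows "factor k (fst (onefactor p)) (snd (onefactor p))"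
proof -
  let ?E = "fst (onefactor p)" and ?W = "snd (onefactor p)"
  have s: "set p \<subseteq> {-1, 0, 1}" using assms by (simp add: motzkin_path_def)
  have ex: "\<exists>i j. e = {i, j} \<and> excursion p i j" if "e \<in> ?E" for e
    using that by (auto simp: onefactor_def paired_excursion[OF s])
  have lt: "i < j" if "excursion p i j" for i j using that by (simp add: excursion_def)
  have no: "\<not> (excursion p i j \<and> excursion p j a)" for i j a
    using excursion_steps[OF s, of i j] excursion_steps[OF s, of j a] by auto
  have "matching ?E"
    unfolding matching_def
  proof (intro conjI ballI impI)
    fix e assume "e \<in> ?E"
    then obtain i j where "e = {i, j}" "excursion p i j" using ex by blast
    moreover have "i \<noteq> j" using lt[OF calculation(2)] by simp
    ultimately show "\<exists>u v. e = {u, v} \<and> u \<noteq> v" by blast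
  next
    fix e e' assume e: "e \<in> ?E" "e' \<in> ?E" "e \<noteq> e'"
    obtain i j where ij: "e = {i, j}" "excursion p i j" using ex e by blast
    obtain a b where ab: "e' = {a, b}" "excursion p a b" using ex e by blast
    have "i \<noteq> a" "j \<noteq> b" "j \<noteq> a" "i \<noteq> b"
      using ij ab e(3) excursion_unique_right[OF ij(2), of b] excursion_unique_left[OF ij(2), of a]
        no[of i j b] no[of a b j] by auto
    then show "e \<inter> e' = {}" using ij ab by auto
  qed
  moreover have "\<Union>?E \<subseteq> {1..k}"
  proof
    fix i assume "i \<in> \<Union>?E"
    then obtain a b where "i \<in> {a, b}" "excursion p a b" using ex by blast
    then show "i \<in> {1..k}" using assms by (auto simp: excursion_def)
  qed
  moreover have "?W \<subseteq> {1..k}" using assms by (auto simp: onefactor_def)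
  moreover have "\<not> (i < a \<and> a < j \<and> j < b)" if "{i, j} \<in> ?E" "{a, b} \<in> ?E" for i j a b
  proof
    assume *: "i < a \<and> a < j \<and> j < b"
    then have "excursion p i j" "excursion p a b"
      using that lt[of j i] lt[of b a] by (auto simp: onefactor_edge[OF s])
    then show False using excursion_noncrossing[of p i j a b] * by simp
  qed
  moreover have "\<not> (i \<le> w \<and> w \<le> j)" if "{i, j} \<in> ?E" "w \<in> ?W" for i j w
  proof
    assume *: "i \<le> w \<and> w \<le> j"
    have w: "1 \<le> w" "w \<le> length p" "step p w = 1" "\<not> (\<exists>j. excursion p w j)"
      using that by (auto simp: onefactor_white[OF s])
    have ij: "excursion p i j" using that(1) * lt[of j i] by (auto simp: onefactor_edge[OF s])
    have "w \<noteq> i" "w \<noteq> j" using ij w excursion_steps[OF s ij] by auto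
    then have "i \<le> w - 1" "w - 1 < j" "w < j" using * by auto
    \<comment> \<open>At \<open>j\<close> the path is no higher than before the up step
      \<open>w\<close>, so this step would be paired.\<close>
    then have "height p j \<le> height p (w - 1)" using ij by (auto simp: excursion_def intro: less_imp_le)
    then have "\<exists>j. excursion p w j"
      using excursion_exists_right[OF s w(1) \<open>w < j\<close> _ w(3)] ij by (auto simp: excursion_def)
    then show False using w by blast
  qed
  ultimately show ?thesis unfolding factor_def by blast
qed

text \<open>Each step can be read off the 1-factor: up at a white vertex or a left end, down at a
  right end, level elsewhere. Nonnegativity enters through \<open>excursion_exists_left\<close>, by
  which no down step is unpaired.\<close>

lemma onefactor_inj:
  assumes "motzkin_path p" "motzkin_path q" "length p = length q" "onefactor p = onefactor q"
  shows "p = q"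
proof (rule nth_equalityI)
  have char: "(step p i = 1 \<longleftrightarrow> i \<in> snd (onefactor p) \<or> (\<exists>j>i. {i, j} \<in> fst (onefactor p))) \<and>
      (step p i = -1 \<longleftrightarrow> (\<exists>j<i. {j, i} \<in> fst (onefactor p)))"
    if p: "motzkin_path p" and i: "1 \<le> i" "i \<le> length p" for p i
  proof -
    have s: "set p \<subseteq> {-1, 0, 1}" using p by (simp add: motzkin_path_def)
    have lt: "i < j" if "excursion p i j" for i j using that by (simp add: excursion_def)
    have "(\<exists>j>i. {i, j} \<in> fst (onefactor p)) \<longleftrightarrow> (\<exists>j. excursion p i j)"
      using lt by (auto simp: onefactor_edge[OF s]) (metis less_asym)
    moreover have "(\<exists>j<i. {j, i} \<in> fst (onefactor p)) \<longleftrightarrow> (\<exists>j. excursion p j i)"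
      using lt by (auto simp: onefactor_edge[OF s]) (metis less_asym)
    ultimately show ?thesis
      using excursion_steps[OF s] excursion_exists_left[OF p i] i
      by (auto simp: onefactor_white[OF s])
  qed
  fix n assume n: "n < length p"
  have "step p (Suc n) = step q (Suc n)"
    using char[OF assms(1), of "Suc n"] char[OF assms(2), of "Suc n"] n assms
      step_cases[of p "Suc n"] step_cases[of q "Suc n"] by (auto simp: motzkin_path_def)
  then show "p ! n = q ! n" by (simp add: step_def)
qed (rule assms(3))

section \<open>Reconstruction of a path from its 1-factor\<close>

definition factor_path :: "nat \<Rightarrow> nat set set \<Rightarrow> nat set \<Rightarrow> int list" where
  "factor_path k E W = map (\<lambda>i. if i \<in> W \<or> (\<exists>j>i. {i, j} \<in> E) then 1
     else if \<exists>j<i. {i, j} \<in> E then -1 else 0) [1..<Suc k]"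

text \<open>The edges passing over the gap between \<open>n\<close> and \<open>n + 1\<close>,
  represented by their left ends.\<close>

definition openings :: "nat set set \<Rightarrow> nat \<Rightarrow> nat set" where
  "openings E n = {i. i \<le> n \<and> (\<exists>j>n. {i, j} \<in> E)}"

lemma factorD:
  assumes "factor k E W"
  shows "matching E" "\<Union>E \<subseteq> {1..k}" "W \<subseteq> {1..k}"
    "{i, j} \<in> E \<Longrightarrow> {a, b} \<in> E \<Longrightarrow> i < a \<Longrightarrow> a < j \<Longrightarrow> j < b \<Longrightarrow> False"
    "{i, j} \<in> E \<Longrightarrow> w \<in> W \<Longrightarrow> i \<le> w \<Longrightarrow> w \<le> j \<Longrightarrow> False"
proof -
  note f = assms[unfolded factor_def]
  show "matching E" "\<Union>E \<subseteq> {1..k}" "W \<subseteq> {1..k}" by (simp_all only: f)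
  note 4 = f[THEN conjunct2, THEN conjunct2, THEN conjunct2, THEN conjunct1, rule_format]
    and 5 = f[THEN conjunct2, THEN conjunct2, THEN conjunct2, THEN conjunct2, rule_format]
  show "{i, j} \<in> E \<Longrightarrow> {a, b} \<in> E \<Longrightarrow> i < a \<Longrightarrow> a < j \<Longrightarrow> j < b \<Longrightarrow> False"
    using 4[of i j a b] by simp
  show "{i, j} \<in> E \<Longrightarrow> w \<in> W \<Longrightarrow> i \<le> w \<Longrightarrow> w \<le> j \<Longrightarrow> False"
    using 5[of i j w] by simp
qed

lemma edge_set_eqI:
  assumes "\<And>e. e \<in> X \<Longrightarrow> \<exists>a b. e = {a, b}" "\<And>e. e \<in> Y \<Longrightarrow> \<exists>a b. e = {a, b}"
    and eq: "\<And>a b. {a, b} \<in> X \<longleftrightarrow> {a, b} \<in> Y"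
  shows "X = Y"
proof (intro subset_antisym subsetI)
  fix e assume e: "e \<in> X"
  with assms(1)[OF e] eq show "e \<in> Y" by (elim exE) simp
next
  fix e assume e: "e \<in> Y"
  with assms(2)[OF e] eq show "e \<in> X" by (elim exE) simp
qed

lemma factor_edge: "factor k E W \<Longrightarrow> e \<in> E \<Longrightarrow> \<exists>a b. e = {a, b}"
  using matching_edge[OF factorD(1), of k E W e] by auto

lemma factor_finite: "factor k E W \<Longrightarrow> finite W"
  by (rule finite_subset[OF factorD(3)]) simp_all

lemma factor_white_edge:
  assumes "factor k E W" "w \<in> W"
  shows "{w, j} \<notin> E"
  using factorD(5)[OF assms(1) _ assms(2), of w j] factorD(5)[OF assms(1) _ assms(2), of j w]
    linear[of w j] by (auto simp: insert_commute)

lemma factor_path_step: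
  assumes "1 \<le> i" "i \<le> k"
  shows "step (factor_path k E W) i = (if i \<in> W \<or> (\<exists>j>i. {i, j} \<in> E) then 1
     else if \<exists>j<i. {i, j} \<in> E then -1 else 0)"
proof -
  have "[1..<Suc k] ! (i - 1) = i" using assms by (simp add: nth_upt del: upt_Suc)
  then show ?thesis using assms unfolding step_def factor_path_def
    by (subst nth_map) (auto simp del: upt_Suc)
qed

lemma factor_path_length: "length (factor_path k E W) = k"
  by (simp add: factor_path_def)

lemma finite_openings: "finite (openings E n)"
  by (rule finite_subset[of _ "{..n}"]) (auto simp: openings_def)

lemma openings_Suc:
  assumes "\<And>i. i \<le> n \<Longrightarrow> {i, Suc n} \<notin> E"
  shows "openings E (Suc n) = openings E n \<union> {i. i = Suc n \<and> (\<exists>j>Suc n. {i, j} \<in> E)}"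
proof -
  have "(\<exists>j>Suc n. {i, j} \<in> E) \<longleftrightarrow> (\<exists>j>n. {i, j} \<in> E)" if "i \<le> n" for i
    using assms[OF that] by (metis Suc_lessD Suc_lessI)
  then show ?thesis by (auto simp: openings_def le_Suc_eq)
qed

text \<open>A white vertex raises the height for good, an edge only from its left end until its
  right end.\<close>

lemma factor_path_height:
  assumes F: "factor k E W" and "n \<le> k"
  shows "height (factor_path k E W) n = int (card {w \<in> W. w \<le> n} + card (openings E n))"
  using assms(2)
proof (induction n)
  case 0
  have "{w \<in> W. w \<le> 0} = {}" using factorD(3)[OF F] by auto
  moreover have "openings E 0 = {}" using factorD(2)[OF F] by (auto simp: openings_def)
  ultimately show ?case by (simp add: height_def)
next
  case (Suc n)
  let ?m = "Suc n" and ?p = "factor_path k E W"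
  have m: "matching E" by (rule factorD(1)[OF F])
  have fW: "finite {w \<in> W. w \<le> n}" using factor_finite[OF F] by simp
  have h: "height ?p ?m = height ?p n + step ?p ?m"
    using height_step[of ?m ?p] Suc.prems by (simp add: factor_path_length)
  have st: "step ?p ?m = (if ?m \<in> W \<or> (\<exists>j>?m. {?m, j} \<in> E) then 1
     else if \<exists>j<?m. {?m, j} \<in> E then -1 else 0)"
    by (rule factor_path_step) (use Suc.prems in auto)
  have notin: "?m \<notin> openings E n" by (simp add: openings_def)
  have IH: "height ?p n = int (card {w \<in> W. w \<le> n} + card (openings E n))" using Suc by simp
  have W': "?m \<notin> W \<Longrightarrow> {w \<in> W. w \<le> ?m} = {w \<in> W. w \<le> n}" by (auto simp: le_Suc_eq)
  consider "?m \<in> W" | j where "?m \<notin> W" "?m < j" "{?m, j} \<in> E" | j where "?m \<notin> W" "j < ?m" "{?m, j} \<in> E"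
    | "?m \<notin> W" "\<And>j. {?m, j} \<notin> E"
    using matching_neq[OF m] by (metis linorder_neqE_nat)
  then show ?case
  proof cases
    case 1
    have no: "{?m, j} \<notin> E" "{j, ?m} \<notin> E" for j
      using factor_white_edge[OF F 1] by (auto simp: insert_commute)
    have "openings E ?m = openings E n"
      using no by (auto simp: openings_Suc)
    moreover have "{w \<in> W. w \<le> ?m} = insert ?m {w \<in> W. w \<le> n}" using 1 by auto
    ultimately show ?thesis using h st 1 IH fW by simp
  next
    case 2
    have no: "{i, ?m} \<notin> E" if "i \<le> n" for i
      using matching_unique[OF m 2(3), of i] 2 that by (auto simp: insert_commute)
    have "openings E ?m = insert ?m (openings E n)"
      using 2 no by (auto simp: openings_Suc)
    then show ?thesis using h st 2 IH W' notin finite_openings[of E n] by auto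
  next
    case 3
    have jE: "{j, ?m} \<in> E" using 3 by (simp add: insert_commute)
    have uni: "i = j" if "{?m, i} \<in> E" for i using matching_unique[OF m 3(3) that] by simp
    have uni': "i = ?m" if "{j, i} \<in> E" for i using matching_unique[OF m jE that] by simp
    have "openings E n = insert j (openings E ?m)"
    proof (intro subset_antisym subsetI)
      fix i assume "i \<in> openings E n"
      then obtain b where b: "i \<le> n" "n < b" "{i, b} \<in> E" by (auto simp: openings_def)
      show "i \<in> insert j (openings E ?m)"
      proof (cases "b = ?m")
        case True
        then show ?thesis using uni[of i] b by (simp add: insert_commute)
      next
        case False
        then show ?thesis using b by (auto simp: openings_def intro!: exI[of _ b])
      qed
    next
      fix i assume "i \<in> insert j (openings E ?m)"
      then consider "i = j" | b where "i \<le> ?m" "?m < b" "{i, b} \<in> E" by (auto simp: openings_def)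
      then show "i \<in> openings E n"
      proof cases
        case 1
        then show ?thesis using 3(2) jE by (auto simp: openings_def intro!: exI[of _ ?m])
      next
        case 2
        have "i \<noteq> ?m" using uni[of b] 2 3(2) by auto
        then show ?thesis using 2 by (auto simp: openings_def intro!: exI[of _ b])
      qed
    qed
    moreover have "j \<notin> openings E ?m" using uni' by (auto simp: openings_def)
    moreover have "step ?p ?m = -1"
    proof -
      have "\<not> (\<exists>i>?m. {?m, i} \<in> E)" using uni 3(2) by auto
      then show ?thesis using st 3 by auto
    qed
    ultimately show ?thesis using h IH W'[OF 3(1)] finite_openings[of E ?m] by simp
  next
    case 4
    then have no: "{j, ?m} \<notin> E" for j by (simp add: insert_commute)
    have "openings E ?m = openings E n"
      using 4(2) no by (auto simp: openings_Suc)
    then show ?thesis using h st 4 IH W' by simp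
  qed
qed

lemma factor_path_motzkin:
  assumes "factor k E W"
  shows "motzkin_path (factor_path k E W)"
  unfolding motzkin_path_def
proof (intro conjI allI impI)
  show "set (factor_path k E W) \<subseteq> {-1, 0, 1}" by (auto simp: factor_path_def)
  fix n assume "n \<le> length (factor_path k E W)"
  then show "0 \<le> sum_list (take n (factor_path k E W))"
    using factor_path_height[OF assms, of n] by (simp add: height_def factor_path_length)
qed

lemma factor_path_sum:
  assumes "factor k E W"
  shows "sum_list (factor_path k E W) = int (card W)"
proof -
  have "{w \<in> W. w \<le> k} = W" using factorD(3)[OF assms] by auto
  moreover have "openings E k = {}" using factorD(2)[OF assms] by (fastforce simp: openings_def)
  ultimately show ?thesis using factor_path_height[OF assms, of k]
    by (simp add: height_def factor_path_length)
qed

text \<open>No white vertex lies under an edge, and by noncrossing the same edges are open before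
  and after it, so the heights agree; strictly inside, the edge itself is open in addition. After a
  white vertex the height never falls back, because no edge passes over that vertex.\<close>

lemma onefactor_factor_path:
  assumes F: "factor k E W"
  shows "onefactor (factor_path k E W) = (E, W)"
proof -
  let ?p = "factor_path k E W"
  have s: "set ?p \<subseteq> {-1, 0, 1}" using factor_path_motzkin[OF F] by (simp add: motzkin_path_def)
  have m: "matching E" by (rule factorD(1)[OF F])
  have fW: "finite {w \<in> W. w \<le> n}" for n using factor_finite[OF F] by simp
  have range: "i \<in> {1..k} \<and> j \<in> {1..k}" if "{i, j} \<in> E" for i j
    using factorD(2)[OF F] that by blast
  have exc: "excursion ?p i j" if e: "{i, j} \<in> E" "i < j" for i j
  proof -
    have ij: "1 \<le> i" "j \<le> k" using range[OF e(1)] by auto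
    have W: "{w \<in> W. w \<le> n} = {w \<in> W. w \<le> i - 1}" if "i \<le> n" "n \<le> j" for n
      using factorD(5)[OF F e(1)] that by fastforce
    have below: "b > j" if ab: "{a, b} \<in> E" "a \<le> i - 1" "i - 1 < b" for a b
    proof -
      have "a < i" "i \<le> b" using ab ij by auto
      moreover have "b \<noteq> i" "b \<noteq> j"
        using matching_unique[OF m, of i j a] matching_unique[OF m, of j i a] ab e \<open>a < i\<close>
        by (auto simp: insert_commute)
      moreover have "\<not> b < j" using factorD(4)[OF F ab(1) e(1)] calculation by auto
      ultimately show ?thesis by simp
    qed
    have "openings E j = openings E (i - 1)"
    proof (intro subset_antisym subsetI)
      fix a assume "a \<in> openings E j"
      then obtain b where b: "a \<le> j" "j < b" "{a, b} \<in> E" by (auto simp: openings_def)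
      have "a \<noteq> i" "a \<noteq> j"
        using matching_unique[OF m, of i j b] matching_unique[OF m, of j i b] b e
        by (auto simp: insert_commute)
      moreover have "\<not> (i < a \<and> a < j)" using factorD(4)[OF F e(1) b(3)] b(2) by auto
      ultimately have "a \<le> i - 1" using b by auto
      then show "a \<in> openings E (i - 1)" using b e by (auto simp: openings_def intro!: exI[of _ b])
    next
      fix a assume "a \<in> openings E (i - 1)"
      then obtain b where b: "a \<le> i - 1" "i - 1 < b" "{a, b} \<in> E" by (auto simp: openings_def)
      then show "a \<in> openings E j" using below[OF b(3,1,2)] e by (auto simp: openings_def intro!: exI[of _ b])
    qed
    then have "height ?p j = height ?p (i - 1)"
      using factor_path_height[OF F, of j] factor_path_height[OF F, of "i - 1"] W[of j] e ij by simp
    moreover have "height ?p (i - 1) < height ?p n" if n: "i \<le> n" "n < j" for n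
    proof -
      have "insert i (openings E (i - 1)) \<subseteq> openings E n"
      proof
        fix a assume "a \<in> insert i (openings E (i - 1))"
        then consider "a = i" | b where "a \<le> i - 1" "i - 1 < b" "{a, b} \<in> E" by (auto simp: openings_def)
        then show "a \<in> openings E n"
        proof cases
          case 1
          then show ?thesis using n e by (auto simp: openings_def intro!: exI[of _ j])
        next
          case 2
          then show ?thesis using below[OF 2(3,1,2)] n
            by (auto simp: openings_def intro!: exI[of _ b])
        qed
      qed
      then have "card (insert i (openings E (i - 1))) \<le> card (openings E n)"
        by (rule card_mono[OF finite_openings])
      moreover have "i \<notin> openings E (i - 1)" using ij by (auto simp: openings_def)
      ultimately have "card (openings E (i - 1)) < card (openings E n)"
        using finite_openings[of E "i - 1"] by simp
      then show ?thesis
        using factor_path_height[OF F, of n] factor_path_height[OF F, of "i - 1"] W[of n] n ij by simp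
    qed
    ultimately show ?thesis using e ij by (auto simp: excursion_def factor_path_length)
  qed
  have white: "\<not> excursion ?p w j" if w: "w \<in> W" for w j
  proof
    assume j: "excursion ?p w j"
    have w1: "1 \<le> w" "w \<le> k" using factorD(3)[OF F] w by auto
    have jk: "j \<le> k" "w < j" using j by (auto simp: excursion_def factor_path_length)
    have "openings E (w - 1) = {}"
      using factorD(5)[OF F _ w] by (fastforce simp: openings_def)
    moreover have "card {v \<in> W. v \<le> w - 1} < card {v \<in> W. v \<le> j}"
    proof (rule psubset_card_mono[OF fW])
      have "w \<in> {v \<in> W. v \<le> j}" "w \<notin> {v \<in> W. v \<le> w - 1}" using w w1 jk by auto
      moreover have "{v \<in> W. v \<le> w - 1} \<subseteq> {v \<in> W. v \<le> j}" using jk by auto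
      ultimately show "{v \<in> W. v \<le> w - 1} \<subset> {v \<in> W. v \<le> j}" by blast
    qed
    ultimately have "height ?p (w - 1) < height ?p j"
      using factor_path_height[OF F, of j] factor_path_height[OF F, of "w - 1"] w1 jk by simp
    then show False using j by (simp add: excursion_def)
  qed
  have pair: "excursion ?p i j \<longleftrightarrow> {i, j} \<in> E \<and> i < j" for i j
  proof
    assume x: "excursion ?p i j"
    then have i: "1 \<le> i" "i \<le> k" "i < j" by (auto simp: excursion_def factor_path_length)
    have "step ?p i = 1" by (rule excursion_steps(1)[OF s x])
    then have "i \<in> W \<or> (\<exists>j>i. {i, j} \<in> E)"
      using factor_path_step[OF i(1,2), of E W] by (auto split: if_splits)
    then obtain j' where "j' > i" "{i, j'} \<in> E" using white x by blast
    moreover have "j' = j" using excursion_unique_right exc calculation x by blast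
    ultimately show "{i, j} \<in> E \<and> i < j" by simp
  qed (use exc in simp)
  have "fst (onefactor ?p) = E"
  proof (intro subset_antisym subsetI)
    fix e assume "e \<in> fst (onefactor ?p)"
    then show "e \<in> E" by (auto simp: onefactor_def paired_excursion[OF s] pair)
  next
    fix e assume e: "e \<in> E"
    then obtain i j where ij: "e = {i, j}" "i \<noteq> j" using matching_edge[OF m e] by blast
    then have "excursion ?p i j \<or> excursion ?p j i"
      using e pair[of i j] pair[of j i] by (auto simp: insert_commute)
    then show "e \<in> fst (onefactor ?p)" using ij onefactor_edge[OF s, of i j] by simp
  qed
  moreover have "w \<in> snd (onefactor ?p) \<longleftrightarrow> w \<in> W" for w
  proof
    assume "w \<in> snd (onefactor ?p)"
    then have w: "1 \<le> w" "w \<le> k" "step ?p w = 1" "\<not> (\<exists>j. excursion ?p w j)"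
      by (auto simp: onefactor_white[OF s] factor_path_length)
    then have "w \<in> W \<or> (\<exists>j>w. {w, j} \<in> E)"
      using factor_path_step[OF w(1,2), of E W] by (auto split: if_splits)
    then show "w \<in> W" using w(4) pair by blast
  next
    assume w: "w \<in> W"
    then have w1: "1 \<le> w" "w \<le> k" using factorD(3)[OF F] by auto
    then show "w \<in> snd (onefactor ?p)"
      using white[OF w] factor_path_step[OF w1, of E W] w
      by (simp add: onefactor_white[OF s] factor_path_length)
  qed
  ultimately show ?thesis by (metis prod.collapse set_eqI)
qed

lemma path_of_onefactor:
  assumes "motzkin_path p" "length p = k"
  shows "path_of k (onefactor p) = p"
  unfolding path_of_def
proof (rule the_equality)
  fix q assume "motzkin_path q \<and> length q = k \<and> onefactor q = onefactor p"
  then show "q = p" using onefactor_inj[of q p] assms by auto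
qed (use assms in simp)

lemma path_of_factor:
  assumes "factor k E W"
  shows "path_of k (E, W) = factor_path k E W"
  using path_of_onefactor[OF factor_path_motzkin[OF assms] factor_path_length]
  by (simp add: onefactor_factor_path[OF assms])

lemma sum_list_onefactor:
  assumes "motzkin_path p"
  shows "sum_list p = int (card (snd (onefactor p)))"
proof -
  let ?E = "fst (onefactor p)" and ?W = "snd (onefactor p)"
  have F: "factor (length p) ?E ?W" by (rule onefactor_factor[OF assms refl])
  have "p = factor_path (length p) ?E ?W"
    using path_of_onefactor[OF assms refl] path_of_factor[OF F] by simp
  then show ?thesis using factor_path_sum[OF F] by simp
qed

section \<open>The action of diagrams on 1-factors\<close>

definition order_rank :: "nat set \<Rightarrow> nat \<Rightarrow> nat" where
  "order_rank W i = card {a \<in> W. a < i}"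

text \<open>The diagram with prescribed upper and lower halves. White vertices are joined in order,
  the only planar way; if the two sets differ in size, the surplus stays isolated.\<close>

definition glue :: "nat set set \<Rightarrow> nat set \<Rightarrow> nat set set \<Rightarrow> nat set \<Rightarrow> diag" where
  "glue E W E' W' = (`) T ` E \<union> (`) B ` E' \<union>
     {{T i, B j} | i j. i \<in> W \<and> j \<in> W' \<and> order_rank W i = order_rank W' j}"

lemma order_rank_singleton: "order_rank {w} w = 0"
proof -
  have "{a \<in> {w}. a < w} = {}" by auto
  then show ?thesis unfolding order_rank_def by simp
qed

lemma order_rank_less:
  assumes "finite W" "i \<in> W" "i < j"
  shows "order_rank W i < order_rank W j"
  unfolding order_rank_def
proof (rule psubset_card_mono)
  have "i \<in> {a \<in> W. a < j}" "i \<notin> {a \<in> W. a < i}" using assms by auto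
  moreover have "{a \<in> W. a < i} \<subseteq> {a \<in> W. a < j}" using assms by auto
  ultimately show "{a \<in> W. a < i} \<subset> {a \<in> W. a < j}" by blast
qed (use assms in simp)

lemma order_rank_eq:
  assumes "finite W" "i \<in> W" "j \<in> W" "order_rank W i = order_rank W j"
  shows "i = j"
  using order_rank_less[OF assms(1,2), of j] order_rank_less[OF assms(1,3), of i] assms(4)
  by (metis less_irrefl linorder_neqE_nat)

lemma image_edge:
  assumes "inj f"
  shows "{f i, f j} \<in> (`) f ` E \<longleftrightarrow> {i, j} \<in> E"
proof
  assume "{f i, f j} \<in> (`) f ` E"
  then obtain e where "e \<in> E" "f ` {i, j} = f ` e" by auto
  then show "{i, j} \<in> E" using inj_image_eq_iff[OF assms] by metis
next
  assume "{i, j} \<in> E"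
  then have "f ` {i, j} \<in> (`) f ` E" by (rule imageI)
  then show "{f i, f j} \<in> (`) f ` E" by simp
qed

lemma inj_rows: "inj T" "inj B" "inj M"
  by (auto intro: injI)

lemma edge_not_in_image: "u \<notin> range f \<Longrightarrow> {u, v} \<notin> (`) f ` E"
  by (metis imageE image_subset_iff insert_subset rangeI subset_UNIV image_mono subsetD insertI1)

lemma glue_edge:
  "{T i, T j} \<in> glue E W E' W' \<longleftrightarrow> {i, j} \<in> E"
  "{B i, B j} \<in> glue E W E' W' \<longleftrightarrow> {i, j} \<in> E'"
  "{T i, B j} \<in> glue E W E' W' \<longleftrightarrow> i \<in> W \<and> j \<in> W' \<and> order_rank W i = order_rank W' j"
  "{B j, T i} \<in> glue E W E' W' \<longleftrightarrow> i \<in> W \<and> j \<in> W' \<and> order_rank W i = order_rank W' j"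
  "{M i, v} \<notin> glue E W E' W'"
  "{v, M i} \<notin> glue E W E' W'"
proof -
  have n: "{B i, v} \<notin> (`) T ` E" "{M i, v} \<notin> (`) T ` E" "{T i, v} \<notin> (`) B ` E" "{M i, v} \<notin> (`) B ` E" for i v E
    by (rule edge_not_in_image; force)+
  show "{T i, T j} \<in> glue E W E' W' \<longleftrightarrow> {i, j} \<in> E"
    "{B i, B j} \<in> glue E W E' W' \<longleftrightarrow> {i, j} \<in> E'"
    by (simp_all add: glue_def image_edge inj_rows n doubleton_eq_iff)
  show *: "{T i, B j} \<in> glue E W E' W' \<longleftrightarrow> i \<in> W \<and> j \<in> W' \<and> order_rank W i = order_rank W' j"
    using n(1)[of j "T i" E] by (auto simp: glue_def n doubleton_eq_iff insert_commute)
  show "{B j, T i} \<in> glue E W E' W' \<longleftrightarrow> i \<in> W \<and> j \<in> W' \<and> order_rank W i = order_rank W' j"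
    using * by (simp add: insert_commute)
  show **: "{M i, v} \<notin> glue E W E' W'"
    by (auto simp: glue_def n doubleton_eq_iff)
  show "{v, M i} \<notin> glue E W E' W'" using ** by (simp add: insert_commute)
qed

lemma factor_range: "factor k E W \<Longrightarrow> {i, j} \<in> E \<Longrightarrow> i \<in> {1..k} \<and> j \<in> {1..k} \<and> i \<noteq> j"
  using factorD(2)[of k E W] matching_neq[OF factorD(1), of k E W i j] by auto

text \<open>A crossing would involve two arcs of one half, an arc with a vertical edge leaving from
  under it, or two vertical edges. The first two are excluded by the conditions on a 1-factor, the
  third by monotonicity of \<open>order_rank\<close>.\<close>

lemma glue_diagram:
  assumes F: "factor k E W" and F': "factor k E' W'"
  shows "glue E W E' W' \<in> diagrams k"
proof (rule diagramI)
  let ?d = "glue E W E' W'"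
  note fW = factor_finite[OF F] factor_finite[OF F']
  show "\<exists>u v. e = {u, v} \<and> u \<noteq> v \<and> u \<in> verts k \<and> v \<in> verts k" if e: "e \<in> ?d" for e
  proof -
    consider a where "a \<in> E" "e = T ` a" | a where "a \<in> E'" "e = B ` a"
      | i j where "i \<in> W" "j \<in> W'" "e = {T i, B j}"
      using e unfolding glue_def by auto
    then show ?thesis
    proof cases
      case 1
      then obtain i j where ij: "a = {i, j}" using matching_edge[OF factorD(1)[OF F]] by blast
      then show ?thesis using 1 factor_range[OF F, of i j] by (intro exI[of _ "T i"] exI[of _ "T j"]) auto
    next
      case 2
      then obtain i j where ij: "a = {i, j}" using matching_edge[OF factorD(1)[OF F']] by blast
      then show ?thesis using 2 factor_range[OF F', of i j] by (intro exI[of _ "B i"] exI[of _ "B j"]) auto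
    next
      case 3
      then show ?thesis using factorD(3)[OF F] factorD(3)[OF F']
        by (intro exI[of _ "T i"] exI[of _ "B j"]) auto
    qed
  qed
  show "b = c" if e: "{a, b} \<in> ?d" "{a, c} \<in> ?d" for a b c
  proof (cases a)
    case (T i)
    show ?thesis
    proof (cases b; cases c)
      fix j l assume "b = T j" "c = T l"
      then show ?thesis using e T matching_unique[OF factorD(1)[OF F], of i j l] by (simp add: glue_edge)
    next
      fix j l assume "b = B j" "c = B l"
      then show ?thesis using e T order_rank_eq[OF fW(2), of j l] by (simp add: glue_edge)
    qed (use e T factor_white_edge[OF F, of i] in \<open>simp_all add: glue_edge\<close>)
  next
    case (B i)
    show ?thesis
    proof (cases b; cases c)
      fix j l assume "b = B j" "c = B l"
      then show ?thesis using e B matching_unique[OF factorD(1)[OF F'], of i j l] by (simp add: glue_edge)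
    next
      fix j l assume "b = T j" "c = T l"
      then show ?thesis using e B order_rank_eq[OF fW(1), of j l] by (simp add: glue_edge)
    qed (use e B factor_white_edge[OF F', of i] in \<open>simp_all add: glue_edge\<close>)
  qed (use e in \<open>simp add: glue_edge\<close>)
  show False if e: "{a, b} \<in> ?d" "{c, c'} \<in> ?d"
    and lt: "pos k a < pos k c" "pos k c < pos k b" "pos k b < pos k c'" for a b c c'
  proof -
    have rg: "v \<in> verts k" if "{u, v} \<in> ?d" for u v
      using that factor_range[OF F] factor_range[OF F'] subsetD[OF factorD(3)[OF F]]
        subsetD[OF factorD(3)[OF F']] by (cases u; cases v) (simp_all add: glue_edge)
    have v: "a \<in> verts k" "b \<in> verts k" "c \<in> verts k" "c' \<in> verts k"
      using rg[of a b] rg[of b a] rg[of c c'] rg[of c' c] e by (simp_all add: insert_commute)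
    note vc = verts_cases[OF v(1)] verts_cases[OF v(2)] verts_cases[OF v(3)] verts_cases[OF v(4)]
    consider i j l m where "a = T i" "b = T j" "c = T l" "c' = T m" "i < l" "l < j" "j < m"
      | i j l m where "a = T i" "b = T j" "c = T l" "c' = B m" "i < l" "l < j"
      | i j l m where "a = T i" "b = B j" "c = T l" "c' = B m" "i < l" "m < j"
      | i j l m where "a = T i" "b = B j" "c = B l" "c' = B m" "j < l" "m < j"
      | i j l m where "a = B i" "b = B j" "c = B l" "c' = B m" "m < j" "j < l" "l < i"
      using vc lt by (elim disjE exE conjE) auto
    then show False
    proof cases
      case 1
      then show ?thesis using factorD(4)[OF F, of i j l m] e by (simp add: glue_edge)
    next
      case 2
      then show ?thesis using factorD(5)[OF F, of i j l] e by (simp add: glue_edge)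
    next
      case 3
      then have "i \<in> W" "m \<in> W'" using e by (simp_all add: glue_edge)
      then have "order_rank W i < order_rank W l" "order_rank W' m < order_rank W' j"
        using order_rank_less[OF fW(1)] order_rank_less[OF fW(2)] 3 by blast+
      then show ?thesis using 3 e by (simp add: glue_edge)
    next
      case 4
      then show ?thesis using factorD(5)[OF F', of m l j] e by (simp add: glue_edge insert_commute)
    next
      case 5
      then show ?thesis using factorD(4)[OF F', of m l j i] e by (simp add: glue_edge insert_commute)
    qed
  qed
qed

lemma factor_subset:
  assumes "factor k E W" "W' \<subseteq> W"
  shows "factor k E W'"
  using assms(1) subsetD[OF assms(2)] subset_trans[OF assms(2)] unfolding factor_def by simp

lemma factor_empty: "W \<subseteq> {1..k} \<Longrightarrow> factor k {} W"
  by (simp add: factor_def matching_def)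

text \<open>Together with \<open>actW\<close> this is \<open>act_factor\<close> on edge sets and
  white sets, so that the action can be iterated without a detour through
  \<open>path_of\<close>.\<close>

definition actE :: "nat \<Rightarrow> diag \<Rightarrow> nat set set \<Rightarrow> nat set set" where
  "actE k d E = {{i, j} | i j. i \<in> {1..k} \<and> j \<in> {1..k} \<and> i \<noteq> j \<and>
     conn (upper d \<union> factor_lower E) (T i) (T j)}"

definition actW :: "nat \<Rightarrow> diag \<Rightarrow> nat set set \<Rightarrow> nat set \<Rightarrow> nat set" where
  "actW k d E W = {i \<in> {1..k}. \<exists>w\<in>W. conn (upper d \<union> factor_lower E) (T i) (M w)}"

lemma act_factor_eq:
  "act_factor k d p = (actE k d (fst (onefactor p)), actW k d (fst (onefactor p)) (snd (onefactor p)))"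
  by (simp add: act_factor_def actE_def actW_def conn2_conn Let_def split: prod.split)

lemma actE_edge:
  "{i, j} \<in> actE k d E \<longleftrightarrow> i \<noteq> j \<and> i \<in> {1..k} \<and> j \<in> {1..k} \<and>
     conn (upper d \<union> factor_lower E) (T i) (T j)"
  unfolding actE_def by (auto simp: doubleton_eq_iff intro: conn_sym)

lemma factor_lower_edge:
  "{M i, M j} \<in> factor_lower E \<longleftrightarrow> {i, j} \<in> E"
  "{T a, v} \<notin> factor_lower E" "{v, T a} \<notin> factor_lower E"
  "{B a, v} \<notin> factor_lower E" "{v, B a} \<notin> factor_lower E"
proof -
  have n: "{T a, v} \<notin> factor_lower E" "{B a, v} \<notin> factor_lower E" for a v
    unfolding factor_lower_def by (rule edge_not_in_image; force)+
  show "{M i, M j} \<in> factor_lower E \<longleftrightarrow> {i, j} \<in> E"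
    by (simp add: factor_lower_def image_edge inj_rows)
  show "{T a, v} \<notin> factor_lower E" "{v, T a} \<notin> factor_lower E"
    "{B a, v} \<notin> factor_lower E" "{v, B a} \<notin> factor_lower E"
    using n[of a v] by (simp_all add: insert_commute)
qed

lemma matching_factor_lower: "factor k E W \<Longrightarrow> matching (factor_lower E)"
  unfolding factor_lower_def by (rule matching_image[OF inj_rows(3) factorD(1)])

lemma Union_factor_lower: "\<Union>(factor_lower E) = M ` \<Union>E"
  by (auto simp: factor_lower_def)

lemma lower_glue_empty: "lower (glue E {} E' W') = factor_lower E \<union> (`) B ` E'"
proof -
  have "top_to_mid ` T ` e = M ` e" "top_to_mid ` B ` e = B ` e" for e
    by (auto simp: image_image)
  then show ?thesis by (simp add: lower_def glue_def factor_lower_def image_Un image_image)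
qed

lemma factor_lower_sub_lower_glue: "factor_lower E \<subseteq> lower (glue E W E' W')"
proof -
  have "lower (glue E {} {} {}) \<subseteq> lower (glue E W E' W')"
    unfolding lower_def glue_def by (intro image_mono) auto
  then show ?thesis by (simp add: lower_glue_empty)
qed

lemma factorI:
  assumes "\<And>e. e \<in> E \<Longrightarrow> \<exists>i j. e = {i, j} \<and> i \<noteq> j \<and> i \<in> {1..k} \<and> j \<in> {1..k}"
    and "\<And>a b c. {a, b} \<in> E \<Longrightarrow> {a, c} \<in> E \<Longrightarrow> b = c" and "W \<subseteq> {1..k}"
    and "\<And>i j a b. {i, j} \<in> E \<Longrightarrow> {a, b} \<in> E \<Longrightarrow> i < a \<Longrightarrow> a < j \<Longrightarrow> j < b \<Longrightarrow> False"
    and "\<And>i j w. {i, j} \<in> E \<Longrightarrow> w \<in> W \<Longrightarrow> i \<le> w \<Longrightarrow> w \<le> j \<Longrightarrow> False"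
  shows "factor k E W"
  unfolding factor_def
proof (intro conjI allI impI notI)
  have 1: "\<exists>i j. e = {i, j}" if "e \<in> E" for e using assms(1)[OF that] by auto
  show "matching E" unfolding matching_def
  proof (intro conjI ballI impI)
    show "\<exists>u v. e = {u, v} \<and> u \<noteq> v" if "e \<in> E" for e using assms(1)[OF that] by auto
    show "e \<inter> e' = {}" if "e \<in> E" "e' \<in> E" "e \<noteq> e'" for e e'
      by (rule disjoint_edgesI[OF 1 assms(2) that])
  qed
  show "\<Union>E \<subseteq> {1..k}"
  proof (rule Union_least)
    fix e assume "e \<in> E"
    then show "e \<subseteq> {1..k}" using assms(1)[of e] by auto
  qed
qed (use assms(3-5) in \<open>auto\<close>)

lemma act_factor_valid:
  assumes d: "d \<in> diagrams k" and F: "factor k E W"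
  shows "factor k (actE k d E) (actW k d E W)"
proof (rule factorI)
  let ?D = "compose k d (glue E {} {} {})"
  have g: "glue E {} {} {} \<in> diagrams k"
    by (rule glue_diagram[OF factor_subset[OF F] factor_empty]) auto
  have D: "?D \<in> diagrams k" by (rule compose_diagram[OF d g])
  have edge: "{i, j} \<in> actE k d E \<longleftrightarrow> {T i, T j} \<in> ?D" for i j
    by (auto simp: actE_edge compose_contract contract_edge lower_glue_empty)
  show "\<exists>i j. e = {i, j} \<and> i \<noteq> j \<and> i \<in> {1..k} \<and> j \<in> {1..k}" if "e \<in> actE k d E" for e
    using that unfolding actE_def by auto
  show "b = c" if "{a, b} \<in> actE k d E" "{a, c} \<in> actE k d E" for a b c
    using matching_unique[OF diagram_matching[OF D], of "T a" "T b" "T c"] that by (simp add: edge)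
  show "actW k d E W \<subseteq> {1..k}" by (auto simp: actW_def)
  show False if "{i, j} \<in> actE k d E" "{a, b} \<in> actE k d E" "i < a" "a < j" "j < b" for i j a b
    using diagram_noncrossing[OF D, of "T i" "T j" "T a" "T b"] that by (simp add: edge)
  show False if ij: "{i, j} \<in> actE k d E" and t: "t \<in> actW k d E W" "i \<le> t" "t \<le> j" for i j t
  proof -
    from t obtain w where w: "w \<in> W" "conn (upper d \<union> factor_lower E) (T t) (M w)"
      and t1: "t \<in> {1..k}" by (auto simp: actW_def)
    \<comment> \<open>Joining the white vertex \<open>w\<close> to the bottom vertex 1, which exists
      because \<open>t\<close> lies in \<open>{1..k}\<close>, turns the strand of \<open>t\<close>
      into a vertical edge of the product. Planarity forbids such an edge under
      \<open>{i, j}\<close>.\<close>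
    let ?g = "glue E {w} {} {1}" and ?D' = "compose k d (glue E {w} {} {1})"
    have g': "?g \<in> diagrams k"
      by (rule glue_diagram[OF factor_subset[OF F] factor_empty]) (use w(1) t1 in auto)
    have D': "?D' \<in> diagrams k" by (rule compose_diagram[OF d g'])
    have mono: "conn (upper d \<union> lower ?g) u v" if "conn (upper d \<union> factor_lower E) u v" for u v
      by (rule conn_mono[OF _ that]) (use factor_lower_sub_lower_glue in blast)
    have "{M w, B 1} \<in> lower ?g"
      unfolding lower_edge[OF g'] by (simp add: glue_edge order_rank_singleton)
    then have "conn (upper d \<union> lower ?g) (T t) (B 1)"
      by (intro conn_step[OF mono[OF w(2)]]) simp
    then have e1: "{T t, B 1} \<in> ?D'" using t1 by (simp add: compose_contract contract_edge)
    have e2: "{T i, T j} \<in> ?D'" using ij mono[of "T i" "T j"]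
      by (simp add: compose_contract contract_edge actE_edge)
    note m = diagram_matching[OF D']
    have "t \<noteq> i" using matching_unique[OF m e2, of "B 1"] e1 by auto
    moreover have "t \<noteq> j" using matching_unique[OF m e1, of "T i"] e2 by (auto simp: insert_commute)
    moreover have "j \<le> k" using ij by (simp add: actE_edge)
    ultimately show False
      using diagram_noncrossing[OF D' e2 e1] t t1 by simp
  qed
qed

text \<open>The component of a top vertex on no vertical edge never leaves the top row, so it
  reaches no white vertex. Consequently the rank of the result is at most that of the
  diagram.\<close>

lemma actW_subset_verticals:
  assumes d: "d \<in> diagrams k"
  shows "actW k d E W \<subseteq> {i. \<exists>j. {T i, B j} \<in> d}"
proof
  fix i assume "i \<in> actW k d E W"
  then obtain w where w: "conn (upper d \<union> factor_lower E) (T i) (M w)" by (auto simp: actW_def)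
  show "i \<in> {i. \<exists>j. {T i, B j} \<in> d}"
  proof (rule ccontr)
    assume no: "i \<notin> {i. \<exists>j. {T i, B j} \<in> d}"
    have up: "{T a, v} \<in> upper d \<longleftrightarrow> {T a, swap_bot v} \<in> d" for a v by (simp add: upper_edge[OF d])
    have "M w \<in> {v. v = T i \<or> (\<exists>j. v = T j \<and> {T i, T j} \<in> d)}" using w
    proof (rule conn_closed)
      fix a b assume a: "a \<in> {v. v = T i \<or> (\<exists>j. v = T j \<and> {T i, T j} \<in> d)}"
        and e: "{a, b} \<in> upper d \<union> factor_lower E"
      from a obtain l where l: "a = T l" by auto
      have eb: "{T l, swap_bot b} \<in> d" using e l by (simp add: up factor_lower_edge)
      show "b \<in> {v. v = T i \<or> (\<exists>j. v = T j \<and> {T i, T j} \<in> d)}"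
      proof (cases "l = i")
        case True
        have "swap_bot b \<in> verts k" using diagram_edge[OF d eb] by simp
        then show ?thesis using eb True no by (cases b) auto
      next
        case False
        then have "{T l, T i} \<in> d" using a l by (auto simp: insert_commute)
        then have "swap_bot b = T i" using matching_unique[OF diagram_matching[OF d] eb] by simp
        then show ?thesis by (cases b) auto
      qed
    qed auto
    then show False by simp
  qed
qed

lemma white_not_on_edge:
  assumes "factor k E W" "w \<in> W"
  shows "M w \<notin> \<Union>(factor_lower E)"
proof
  assume "M w \<in> \<Union>(factor_lower E)"
  then have "w \<in> \<Union>E" by (auto simp: Union_factor_lower)
  then obtain j where "{w, j} \<in> E" using matching_partner[OF factorD(1)[OF assms(1)]] by blast
  then show False using factor_white_edge[OF assms] by blast
qed

lemma top_not_on_factor: "T i \<notin> \<Union>(factor_lower E)"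
  by (auto simp: Union_factor_lower)

text \<open>A white vertex lies on no edge of the 1-factor, so it cannot be an inner vertex of a
  strand joining two top vertices.\<close>

lemma white_strand_unique:
  assumes d: "d \<in> diagrams k" and F: "factor k E W" and w: "w \<in> W"
    and "conn (upper d \<union> factor_lower E) (T i) (M w)" "conn (upper d \<union> factor_lower E) (T j) (M w)"
  shows "i = j"
proof (rule ccontr)
  assume "i \<noteq> j"
  have "conn (upper d \<union> factor_lower E) (T i) (T j)"
    by (rule conn_trans[OF assms(4) conn_sym[OF assms(5)]])
  then have "M w = T i \<or> M w = T j \<or> (M w \<in> \<Union>(upper d) \<and> M w \<in> \<Union>(factor_lower E))"
    by (rule two_ends[OF matching_upper[OF d] matching_factor_lower[OF F]])
      (use \<open>i \<noteq> j\<close> assms(4) top_not_on_factor[of _ E] in simp_all)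
  then show False using white_not_on_edge[OF F w] by simp
qed

text \<open>Choosing for each white vertex of the result a white vertex that it reaches is injective
  by \<open>white_strand_unique\<close>.\<close>

lemma card_actW_le:
  assumes d: "d \<in> diagrams k" and F: "factor k E W"
  shows "card (actW k d E W) \<le> card W"
proof -
  let ?P = "\<lambda>i w. w \<in> W \<and> conn (upper d \<union> factor_lower E) (T i) (M w)"
  let ?f = "\<lambda>i. SOME w. ?P i w"
  have f: "?P i (?f i)" if "i \<in> actW k d E W" for i
  proof -
    have "\<exists>w. ?P i w" using that by (auto simp: actW_def)
    then show ?thesis by (rule someI_ex)
  qed
  show ?thesis
  proof (rule card_inj_on_le[of ?f])
    show "inj_on ?f (actW k d E W)"
    proof (rule inj_onI)
      fix i j assume i: "i \<in> actW k d E W" and j: "j \<in> actW k d E W" and eq: "?f i = ?f j"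
      show "i = j"
        using white_strand_unique[OF d F, of "?f j" i j] f[OF i] f[OF j] unfolding eq by simp
    qed
    show "?f ` actW k d E W \<subseteq> W" using f by auto
  qed (rule factor_finite[OF F])
qed

section \<open>Two diagrams above a 1-factor: compatibility of the action with products\<close>

lemma factor_stack:
  assumes d1: "d1 \<in> diagrams k" and d2: "d2 \<in> diagrams k" and F: "factor k E W"
  shows "stack (upper d1) (lower d2) ((`) B ` E) (T ` {1..k}) (M ` {1..k}) (B ` {1..k}) {}"
proof
  show "matching (upper d1)" "matching (lower d2)" "matching ((`) B ` E)"
    by (rule matching_upper[OF d1] matching_lower[OF d2]
        matching_image[OF inj_rows(2) factorD(1)[OF F]])+
  show "\<Union>(upper d1) \<subseteq> T ` {1..k} \<union> M ` {1..k}" by (rule Union_upper[OF d1])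
  show "\<Union>(lower d2) \<subseteq> M ` {1..k} \<union> B ` {1..k}" by (rule Union_lower[OF d2])
  have "\<Union>((`) B ` E) = B ` \<Union>E" by auto
  then show "\<Union>((`) B ` E) \<subseteq> B ` {1..k} \<union> {}" using image_mono[OF factorD(2)[OF F], of B] by simp
qed auto

lemma factor_lower_swap: "factor_lower E = (`) swap_bot ` (`) B ` E"
  unfolding factor_lower_def by (simp add: image_image)

lemma row_shift_upper:
  assumes "d \<in> diagrams k"
  shows "(`) row_shift ` upper d = lower d"
proof -
  have "row_shift ` swap_bot ` e = swap_top ` e" if "e \<in> d" for e
    unfolding image_image
  proof (rule image_cong[OF refl])
    fix v assume "v \<in> e"
    then have "v \<in> verts k" using diagram_Union[OF assms] that by auto
    then show "row_shift (swap_bot v) = swap_top v" by (cases v) auto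
  qed
  then show ?thesis unfolding upper_swap[OF assms] lower_swap[OF assms] image_image[of "(`) row_shift"]
    by (rule image_cong[OF refl])
qed

lemma row_shift_factor_lower: "(`) row_shift ` factor_lower E = (`) B ` E"
  unfolding factor_lower_def by (simp add: image_image)

text \<open>The lower row of the product is the middle row when the product acts, but the bottom row
  of the triple stack; \<open>swap_bot\<close> translates between the two.\<close>

lemma conn_compose_factor:
  assumes d1: "d1 \<in> diagrams k" and d2: "d2 \<in> diagrams k" and F: "factor k E W"
    and "u \<notin> range M" "v \<notin> range M"
  shows "conn (upper (compose k d1 d2) \<union> factor_lower E) (swap_bot u) (swap_bot v) \<longleftrightarrow>
    conn (upper d1 \<union> lower d2 \<union> (`) B ` E) u v"
proof -
  interpret stack "upper d1" "lower d2" "(`) B ` E" "T ` {1..k}" "M ` {1..k}" "B ` {1..k}" "{}"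
    by (rule factor_stack[OF d1 d2 F])
  have "compose k d1 d2 = AB" by (simp add: compose_contract verts_def)
  moreover have "upper (compose k d1 d2) \<union> factor_lower E = (`) swap_bot ` (compose k d1 d2 \<union> (`) B ` E)"
    by (simp add: upper_swap[OF compose_diagram[OF d1 d2]] factor_lower_swap image_Un)
  ultimately show ?thesis
    using conn_contract[of u v] assms(4,5) conn_image[OF bij_is_inj[OF bij_swap_bot]] by auto
qed

lemma conn_factor_shift:
  assumes "d \<in> diagrams k"
  shows "conn (lower d \<union> (`) B ` E) (row_shift u) (row_shift v) \<longleftrightarrow>
    conn (upper d \<union> factor_lower E) u v"
  using conn_image[OF bij_is_inj[OF bij_row_shift], of "upper d \<union> factor_lower E" u v]
  by (simp add: image_Un row_shift_upper[OF assms] row_shift_factor_lower)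

text \<open>Identifies the arcs obtained by acting with a contraction of the lower two layers, so
  that the results on stacks apply to the action as well.\<close>

lemma factor_lower_actE:
  assumes "d \<in> diagrams k"
  shows "factor_lower (actE k d E) = contract (lower d \<union> (`) B ` E) (M ` {1..k})"
proof -
  have c: "conn (lower d \<union> (`) B ` E) (M i) (M j) \<longleftrightarrow> conn (upper d \<union> factor_lower E) (T i) (T j)" for i j
    using conn_factor_shift[OF assms, of E "T i" "T j"] by simp
  show ?thesis
  proof (intro subset_antisym subsetI)
    fix e assume "e \<in> factor_lower (actE k d E)"
    then obtain i j where "e = {M i, M j}" "{i, j} \<in> actE k d E"
      unfolding factor_lower_def actE_def by auto
    then show "e \<in> contract (lower d \<union> (`) B ` E) (M ` {1..k})"
      by (simp add: contract_edge actE_edge c)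
  next
    fix e assume "e \<in> contract (lower d \<union> (`) B ` E) (M ` {1..k})"
    then obtain u v where e: "e = {u, v}" "u \<noteq> v" "u \<in> M ` {1..k}" "v \<in> M ` {1..k}"
      "conn (lower d \<union> (`) B ` E) u v"
      unfolding contract_def by auto
    from e(3,4) obtain i j where "u = M i" "v = M j" "i \<in> {1..k}" "j \<in> {1..k}" by (elim imageE)
    then show "e \<in> factor_lower (actE k d E)"
      using e(1,2,5) by (simp add: factor_lower_edge actE_edge c)
  qed
qed

text \<open>Both sides are the triple stack with one row eliminated: the middle row when the
  diagrams are multiplied first, the bottom row when \<open>d2\<close> acts first. The reversed
  stack handles the second elimination.\<close>

lemma act_compose:
  assumes d1: "d1 \<in> diagrams k" and d2: "d2 \<in> diagrams k" and F: "factor k E W"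
  shows "actE k (compose k d1 d2) E = actE k d1 (actE k d2 E)"
    and "actW k (compose k d1 d2) E W = actW k d1 (actE k d2 E) (actW k d2 E W)"
proof -
  let ?BE = "(`) B ` E"
  interpret s: stack "upper d1" "lower d2" ?BE "T ` {1..k}" "M ` {1..k}" "B ` {1..k}" "{}"
    by (rule factor_stack[OF d1 d2 F])
  interpret r: stack ?BE "lower d2" "upper d1" "{}" "B ` {1..k}" "M ` {1..k}" "T ` {1..k}"
    by (rule s.reverse)
  let ?c3 = "conn (upper d1 \<union> lower d2 \<union> ?BE)"
  have AB: "r.AB = factor_lower (actE k d2 E)"
    by (simp add: factor_lower_actE[OF d2] Un_commute)
  have un: "?BE \<union> lower d2 \<union> upper d1 = upper d1 \<union> lower d2 \<union> ?BE" by auto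
  have un': "factor_lower (actE k d2 E) \<union> upper d1 = upper d1 \<union> factor_lower (actE k d2 E)" by auto
  have r1: "conn (upper d1 \<union> factor_lower (actE k d2 E)) u v \<longleftrightarrow> ?c3 u v"
    if "u \<notin> range B" "v \<notin> range B" for u v
    using r.conn_contract[of u v] that unfolding AB un un' by auto
  have l: "conn (upper (compose k d1 d2) \<union> factor_lower E) (T i) (T j) \<longleftrightarrow> ?c3 (T i) (T j)"
    "conn (upper (compose k d1 d2) \<union> factor_lower E) (T i) (M j) \<longleftrightarrow> ?c3 (T i) (B j)" for i j
    using conn_compose_factor[OF d1 d2 F, of "T i" "T j"] conn_compose_factor[OF d1 d2 F, of "T i" "B j"]
    by auto
  have "conn (upper d1 \<union> factor_lower (actE k d2 E)) (T i) (T j) \<longleftrightarrow> ?c3 (T i) (T j)" for i j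
    by (rule r1) auto
  then show "actE k (compose k d1 d2) E = actE k d1 (actE k d2 E)"
    unfolding actE_def[of k "compose k d1 d2"] actE_def[of k d1] l by simp
  have sh: "conn (upper d2 \<union> factor_lower E) (T m) (M w) \<longleftrightarrow> conn (lower d2 \<union> ?BE) (M m) (B w)" for m w
    using conn_factor_shift[OF d2, of E "T m" "M w"] by simp
  have "(\<exists>w\<in>W. ?c3 (T i) (B w)) \<longleftrightarrow>
    (\<exists>m\<in>actW k d2 E W. conn (upper d1 \<union> factor_lower (actE k d2 E)) (T i) (M m))" for i
  proof
    assume "\<exists>w\<in>W. ?c3 (T i) (B w)"
    then obtain w where w: "w \<in> W" "?c3 (T i) (B w)" by auto
    have wk: "w \<in> {1..k}" using factorD(3)[OF F] w by auto
    \<comment> \<open>For the reversed stack, \<open>conn_split\<close> cuts the strand at a vertex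
      off the bottom row from which the rest runs through the lower two layers. This vertex can only
      lie in the middle row.\<close>
    obtain z where z: "z \<notin> B ` {1..k}" "conn (upper d1 \<union> factor_lower (actE k d2 E)) (T i) z"
        "conn (?BE \<union> lower d2) z (B w)"
      using r.conn_split[of "T i" "B w"] w(2) unfolding AB un un' by auto
    have "z \<noteq> B w" using z(1) wk by auto
    then have "z \<in> \<Union>(?BE \<union> lower d2)" by (rule conn_neq_Union[OF z(3)])
    then have "z \<in> M ` {1..k}"
      using subsetD[OF s.B, of z] subsetD[OF s.C, of z] z(1) by (metis UnE Union_Un_distrib empty_iff)
    then obtain m where m: "z = M m" "m \<in> {1..k}" by auto
    have "conn (upper d2 \<union> factor_lower E) (T m) (M w)"
      using z(3) m(1) unfolding sh by (simp add: Un_commute)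
    then have "m \<in> actW k d2 E W" using m(2) w(1) by (auto simp: actW_def)
    then show "\<exists>m\<in>actW k d2 E W. conn (upper d1 \<union> factor_lower (actE k d2 E)) (T i) (M m)"
      using z(2) m by auto
  next
    assume "\<exists>m\<in>actW k d2 E W. conn (upper d1 \<union> factor_lower (actE k d2 E)) (T i) (M m)"
    then obtain m w where m: "conn (upper d1 \<union> factor_lower (actE k d2 E)) (T i) (M m)"
      and w: "w \<in> W" "conn (lower d2 \<union> ?BE) (M m) (B w)" by (auto simp: actW_def sh)
    have "?c3 (T i) (M m)" using m r1[of "T i" "M m"] by auto
    moreover have "?c3 (M m) (B w)" by (rule conn_mono[OF _ w(2)]) auto
    ultimately show "\<exists>w\<in>W. ?c3 (T i) (B w)" using w(1) conn_trans by metis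
  qed
  then show "actW k (compose k d1 d2) E W = actW k d1 (actE k d2 E) (actW k d2 E W)"
    unfolding actW_def[of k "compose k d1 d2"] actW_def[of k d1] l by simp
qed

definition kap :: "diag \<Rightarrow> nat set set \<Rightarrow> nat" where
  "kap d E = nloops (upper d) (factor_lower E)"

lemma kappa_act_kap: "kappa_act d p = kap d (fst (onefactor p))"
  by (simp add: kappa_act_def kap_def)

lemma nloops_loops: "nloops U L = card (loops U L (range M))"
proof -
  have "is_mid w \<longleftrightarrow> w \<in> range M" for w by (cases w) auto
  then show ?thesis unfolding nloops_def loops_def conn2_conn by simp
qed

lemma kap_loops:
  assumes "\<Union>E \<subseteq> {1..k}"
  shows "kap d E = card (loops (upper d) (factor_lower E) (M ` {1..k}))"
  unfolding kap_def nloops_loops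
  by (rule arg_cong[where f = card], rule loops_cong) (use assms in \<open>auto simp: Union_factor_lower\<close>)

lemma kappa_prod_loops:
  assumes "d1 \<in> diagrams k" "d2 \<in> diagrams k"
  shows "kappa_prod d1 d2 = card (loops (upper d1) (lower d2) (M ` {1..k}))"
  unfolding kappa_prod_def nloops_loops
proof (rule arg_cong[where f = card], rule loops_cong)
  fix w assume "w \<in> \<Union>(lower d2)"
  then have "w \<in> M ` {1..k} \<union> B ` {1..k}" by (rule subsetD[OF Union_lower[OF assms(2)]])
  then show "w \<in> range M \<longleftrightarrow> w \<in> M ` {1..k}" by auto
qed

text \<open>An instance of \<open>stack_loops_assoc\<close>; the facts \<open>1\<close> and
  \<open>2\<close> move the loops of the two pictures with a 1-factor in the middle row to the
  bottom row of the triple stack.\<close>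

lemma kap_compose:
  assumes d1: "d1 \<in> diagrams k" and d2: "d2 \<in> diagrams k" and F: "factor k E W"
  shows "kappa_prod d1 d2 + kap (compose k d1 d2) E = kap d2 E + kap d1 (actE k d2 E)"
proof -
  let ?BE = "(`) B ` E" and ?D = "compose k d1 d2"
  have D: "?D \<in> diagrams k" by (rule compose_diagram[OF d1 d2])
  have UE: "\<Union>E \<subseteq> {1..k}" "\<Union>(actE k d2 E) \<subseteq> {1..k}"
    using factorD(2)[OF F] factorD(2)[OF act_factor_valid[OF d2 F]] by auto
  have sM: "M ` {1..k} = swap_bot ` B ` {1..k}" "row_shift ` M ` {1..k} = B ` {1..k}"
    by (auto simp: image_image)
  have 1: "kap ?D E = card (loops ?D ?BE (B ` {1..k}))"
    unfolding kap_loops[OF UE(1)] upper_swap[OF D] factor_lower_swap sM(1)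
    by (rule card_loops_image[OF bij_swap_bot])
  have 2: "kap d2 E = card (loops (lower d2) ?BE (B ` {1..k}))"
    unfolding kap_loops[OF UE(1)] row_shift_upper[OF d2, symmetric]
      row_shift_factor_lower[of E, symmetric] sM(2)[symmetric]
    by (rule card_loops_image[OF bij_row_shift, symmetric])
  show ?thesis
    using stack_loops_assoc[OF factor_stack[OF d1 d2 F]]
    unfolding kappa_prod_loops[OF d1 d2] 1 2 kap_loops[OF UE(2)] factor_lower_actE[OF d2]
    unfolding compose_contract verts_def by simp
qed

lemma idd_glue: "idd k = glue {} {1..k} {} {1..k}"
  using order_rank_eq[of "{1..k}"] unfolding idd_def glue_def by auto

lemma idd_diagram: "idd k \<in> diagrams k"
  unfolding idd_glue by (rule glue_diagram) (simp_all add: factor_empty)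

lemma act_idd:
  assumes F: "factor k E W"
  shows "actE k (idd k) E = E" "actW k (idd k) E W = W" "kap (idd k) E = 0"
proof -
  let ?X = "upper (idd k) \<union> factor_lower E"
  have up: "{u, v} \<in> upper (idd k) \<longleftrightarrow> (\<exists>i\<in>{1..k}. (u = T i \<and> v = M i) \<or> (u = M i \<and> v = T i))" for u v
    unfolding upper_edge[OF idd_diagram]
    by (cases u; cases v) (auto simp: idd_def doubleton_eq_iff)
  have TM: "conn ?X (T i) (M i)" if "i \<in> {1..k}" for i by (rule conn_edge) (use up that in auto)
  have reach: "v \<in> {v. v = T i \<or> v = M i \<or> (\<exists>j. {i, j} \<in> E \<and> (v = T j \<or> v = M j))}"
    if "conn ?X (T i) v" for i v
    using that
  proof (rule conn_closed)
    fix a b assume a: "a \<in> {v. v = T i \<or> v = M i \<or> (\<exists>j. {i, j} \<in> E \<and> (v = T j \<or> v = M j))}"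
      and "{a, b} \<in> ?X"
    then consider "{a, b} \<in> upper (idd k)" | "{a, b} \<in> factor_lower E" by auto
    then show "b \<in> {v. v = T i \<or> v = M i \<or> (\<exists>j. {i, j} \<in> E \<and> (v = T j \<or> v = M j))}"
    proof cases
      case 1
      then show ?thesis using a unfolding up by auto
    next
      case 2
      then obtain l m where lm: "a = M l" "b = M m" "{l, m} \<in> E"
        by (cases a; cases b) (auto simp: factor_lower_edge)
      then consider "l = i" | "{i, l} \<in> E" using a by auto
      then show ?thesis
      proof cases
        case 2
        then have "{l, i} \<in> E" by (simp add: insert_commute)
        then have "m = i" using matching_unique[OF factorD(1)[OF F] lm(3)] by simp
        then show ?thesis using lm by simp
      qed (use lm in auto)
    qed
  qed simp
  have E: "{i, j} \<in> actE k (idd k) E \<longleftrightarrow> {i, j} \<in> E" for i j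
  proof
    assume "{i, j} \<in> actE k (idd k) E"
    then show "{i, j} \<in> E" using reach[of i "T j"] by (auto simp: actE_edge)
  next
    assume e: "{i, j} \<in> E"
    have ij: "i \<in> {1..k}" "j \<in> {1..k}" "i \<noteq> j" using factor_range[OF F e] by auto
    have "conn ?X (T i) (M j)"
      by (rule conn_step[OF TM[OF ij(1)]]) (simp add: factor_lower_edge e)
    then have "conn ?X (T i) (T j)" by (rule conn_trans[OF _ conn_sym[OF TM[OF ij(2)]]])
    then show "{i, j} \<in> actE k (idd k) E" using ij by (simp add: actE_edge)
  qed
  then show "actE k (idd k) E = E"
    by (rule edge_set_eqI[rotated 2])
      (erule factor_edge[OF act_factor_valid[OF idd_diagram F]], erule factor_edge[OF F])
  show "actW k (idd k) E W = W"
  proof (intro subset_antisym subsetI)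
    fix i assume "i \<in> actW k (idd k) E W"
    then obtain w where w: "w \<in> W" "conn ?X (T i) (M w)" by (auto simp: actW_def)
    then have "w = i \<or> {w, i} \<in> E" using reach[OF w(2)] by (auto simp: insert_commute)
    then show "i \<in> W" using w(1) factor_white_edge[OF F w(1)] by auto
  next
    fix i assume i: "i \<in> W"
    then have "i \<in> {1..k}" using factorD(3)[OF F] by auto
    then show "i \<in> actW k (idd k) E W" using TM i by (auto simp: actW_def)
  qed
  \<comment> \<open>A component through \<open>M i\<close> contains \<open>T i\<close>, which lies
    outside the middle row.\<close>
  have "loops (upper (idd k)) (factor_lower E) (M ` {1..k}) = {}"
  proof (rule equals0I)
    fix D assume "D \<in> loops (upper (idd k)) (factor_lower E) (M ` {1..k})"
    then obtain v where D: "D = {w. conn ?X v w}" and b: "\<And>w. w \<in> D \<Longrightarrow> w \<in> M ` {1..k}"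
      unfolding loops_def by auto
    have "v \<in> M ` {1..k}" using b[of v] D by simp
    then obtain i where i: "v = M i" "i \<in> {1..k}" by auto
    then have "T i \<in> D" using D conn_sym[OF TM[OF i(2)]] by simp
    then show False using b[of "T i"] by auto
  qed
  then show "kap (idd k) E = 0" using kap_loops[OF factorD(2)[OF F]] by simp
qed

section \<open>Halves of diagrams\<close>

definition topE :: "diag \<Rightarrow> nat set set" where
  "topE d = {{i, j} | i j. {T i, T j} \<in> d}"

definition topW :: "diag \<Rightarrow> nat set" where
  "topW d = {i. \<exists>j. {T i, B j} \<in> d}"

definition botE :: "diag \<Rightarrow> nat set set" where
  "botE d = {{i, j} | i j. {B i, B j} \<in> d}"

definition botW :: "diag \<Rightarrow> nat set" where
  "botW d = {j. \<exists>i. {T i, B j} \<in> d}"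

lemma topE_edge: "{i, j} \<in> topE d \<longleftrightarrow> {T i, T j} \<in> d"
  unfolding topE_def by (auto simp: doubleton_eq_iff insert_commute)

lemma botE_edge: "{i, j} \<in> botE d \<longleftrightarrow> {B i, B j} \<in> d"
  unfolding botE_def by (auto simp: doubleton_eq_iff insert_commute)

lemma top_factor:
  assumes d: "d \<in> diagrams k"
  shows "factor k (topE d) (topW d)"
proof (rule factorI)
  note m = diagram_matching[OF d]
  show "\<exists>i j. e = {i, j} \<and> i \<noteq> j \<and> i \<in> {1..k} \<and> j \<in> {1..k}" if e: "e \<in> topE d" for e
  proof -
    obtain i j where ij: "e = {i, j}" "{T i, T j} \<in> d" using e unfolding topE_def by auto
    then show ?thesis using diagram_edge[OF d ij(2)] by auto
  qed
  show "b = c" if "{a, b} \<in> topE d" "{a, c} \<in> topE d" for a b c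
    using matching_unique[OF m, of "T a" "T b" "T c"] that by (simp add: topE_edge)
  show "topW d \<subseteq> {1..k}"
  proof
    fix i assume "i \<in> topW d"
    then obtain j where "{T i, B j} \<in> d" unfolding topW_def by auto
    then show "i \<in> {1..k}" using diagram_edge[OF d, of "T i" "B j"] by simp
  qed
  show False if "{i, j} \<in> topE d" "{a, b} \<in> topE d" "i < a" "a < j" "j < b" for i j a b
    using diagram_noncrossing[OF d, of "T i" "T j" "T a" "T b"] that by (simp add: topE_edge)
  show False if ij: "{i, j} \<in> topE d" and w: "w \<in> topW d" "i \<le> w" "w \<le> j" for i j w
  proof -
    obtain b where b: "{T w, B b} \<in> d" using w unfolding topW_def by auto
    have e: "{T i, T j} \<in> d" using ij by (simp add: topE_edge)
    have "w \<noteq> i" using matching_unique[OF m b, of "T j"] e by auto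
    moreover have "w \<noteq> j" using matching_unique[OF m b, of "T i"] e by (auto simp: insert_commute)
    moreover have "b \<le> k" "j \<le> k" using diagram_edge[OF d b] diagram_edge[OF d e] by auto
    ultimately show False by (intro diagram_noncrossing[OF d e b]) (use w in auto)
  qed
qed

lemma bot_factor:
  assumes d: "d \<in> diagrams k"
  shows "factor k (botE d) (botW d)"
proof (rule factorI)
  note m = diagram_matching[OF d]
  show "\<exists>i j. e = {i, j} \<and> i \<noteq> j \<and> i \<in> {1..k} \<and> j \<in> {1..k}" if e: "e \<in> botE d" for e
  proof -
    obtain i j where ij: "e = {i, j}" "{B i, B j} \<in> d" using e unfolding botE_def by auto
    then show ?thesis using diagram_edge[OF d ij(2)] by auto
  qed
  show "b = c" if "{a, b} \<in> botE d" "{a, c} \<in> botE d" for a b c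
    using matching_unique[OF m, of "B a" "B b" "B c"] that by (simp add: botE_edge)
  show "botW d \<subseteq> {1..k}"
  proof
    fix j assume "j \<in> botW d"
    then obtain i where "{T i, B j} \<in> d" unfolding botW_def by auto
    then show "j \<in> {1..k}" using diagram_edge[OF d, of "T i" "B j"] by simp
  qed
  show False if e: "{i, j} \<in> botE d" "{a, b} \<in> botE d" "i < a" "a < j" "j < b" for i j a b
  proof -
    have e1: "{B b, B a} \<in> d" "{B j, B i} \<in> d" using e by (simp_all add: botE_edge insert_commute)
    have "b \<le> k" using diagram_edge[OF d e1(1)] by simp
    then show False by (intro diagram_noncrossing[OF d e1]) (use e(3-5) in auto)
  qed
  show False if ij: "{i, j} \<in> botE d" and w: "w \<in> botW d" "i \<le> w" "w \<le> j" for i j w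
  proof -
    obtain b where b: "{T b, B w} \<in> d" using w unfolding botW_def by auto
    have e: "{B i, B j} \<in> d" "{B j, B i} \<in> d" using ij by (simp_all add: botE_edge insert_commute)
    have b': "{B w, T b} \<in> d" using b by (simp add: insert_commute)
    have "w \<noteq> i" using matching_unique[OF m b', of "B j"] e by auto
    moreover have "w \<noteq> j" using matching_unique[OF m b', of "B i"] e by auto
    moreover have "b \<le> k" "j \<le> k" "w \<le> k" using diagram_edge[OF d b] diagram_edge[OF d e(1)] by auto
    ultimately show False by (intro diagram_noncrossing[OF d b e(2)]) (use w in auto)
  qed
qed

lemma vertical_mono:
  assumes d: "d \<in> diagrams k" and e: "{T a, B b} \<in> d" "{T i, B j} \<in> d"
  shows "a < i \<longleftrightarrow> b < j"
proof -
  note m = diagram_matching[OF d]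
  have lt: "b < j" if e: "{T a, B b} \<in> d" "{T i, B j} \<in> d" and "a < i" for a b i j
  proof (rule ccontr)
    assume "\<not> b < j"
    moreover have "b \<noteq> j"
      using matching_unique[OF m, of "B b" "T a" "T i"] e \<open>a < i\<close> by (auto simp: insert_commute)
    moreover have "b \<le> k" "i \<le> k" using diagram_edge[OF d e(1)] diagram_edge[OF d e(2)] by auto
    ultimately show False by (intro diagram_noncrossing[OF d e]) (use \<open>a < i\<close> in auto)
  qed
  have "a = i \<Longrightarrow> b = j" using matching_unique[OF m, of "T a" "B b" "B j"] e by auto
  then show ?thesis using lt[OF e] lt[OF e(2,1)] by (metis less_asym linorder_neqE_nat)
qed

lemma vertical_partner_unique:
  assumes d: "d \<in> diagrams k"
  shows "{T a, B b} \<in> d \<Longrightarrow> {T a, B b'} \<in> d \<Longrightarrow> b = b'"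
    and "{T a, B b} \<in> d \<Longrightarrow> {T a', B b} \<in> d \<Longrightarrow> a = a'"
  using matching_unique[OF diagram_matching[OF d], of "T a" "B b" "B b'"]
    matching_unique[OF diagram_matching[OF d], of "B b" "T a" "T a'"]
  by (auto simp: insert_commute)

text \<open>Following vertical edges is a bijection. The predicates allow its use both for all
  vertical edges and for those to the left of a given one.\<close>

lemma card_verticals:
  assumes d: "d \<in> diagrams k"
    and P: "\<And>a b. {T a, B b} \<in> d \<Longrightarrow> P a \<longleftrightarrow> Q b"
  shows "card {a \<in> topW d. P a} = card {b \<in> botW d. Q b}"
proof (rule bij_betw_same_card)
  let ?f = "\<lambda>a. THE b. {T a, B b} \<in> d"
  have f: "?f a = b" if "{T a, B b} \<in> d" for a b
    by (rule the_equality[of _ b]) (use that vertical_partner_unique(1)[OF d] in auto)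
  show "bij_betw ?f {a \<in> topW d. P a} {b \<in> botW d. Q b}"
  proof (rule bij_betwI')
    fix a a' assume "a \<in> {a \<in> topW d. P a}" "a' \<in> {a \<in> topW d. P a}"
    then obtain b b' where "{T a, B b} \<in> d" "{T a', B b'} \<in> d" unfolding topW_def by auto
    then show "?f a = ?f a' \<longleftrightarrow> a = a'"
      using f[of a b] f[of a' b'] vertical_partner_unique(2)[OF d, of a b a'] by auto
  next
    fix a assume "a \<in> {a \<in> topW d. P a}"
    then obtain b where "{T a, B b} \<in> d" "P a" unfolding topW_def by auto
    then show "?f a \<in> {b \<in> botW d. Q b}" using f[of a b] P[of a b] unfolding botW_def by auto
  next
    fix b assume "b \<in> {b \<in> botW d. Q b}"
    then obtain a where a: "{T a, B b} \<in> d" "Q b" unfolding botW_def by auto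
    then have "a \<in> {a \<in> topW d. P a}" using P[of a b] unfolding topW_def by auto
    then show "\<exists>a\<in>{a \<in> topW d. P a}. b = ?f a" using f[OF a(1)] by (intro bexI[of _ a]) auto
  qed
qed

lemma card_topW_botW: "d \<in> diagrams k \<Longrightarrow> card (topW d) = card (botW d)"
  using card_verticals[of d k "\<lambda>_. True" "\<lambda>_. True"] by simp

lemma vertical_order_rank:
  assumes "d \<in> diagrams k" "{T i, B j} \<in> d"
  shows "order_rank (topW d) i = order_rank (botW d) j"
  unfolding order_rank_def
  by (rule card_verticals[OF assms(1)]) (rule vertical_mono[OF assms(1) _ assms(2)])

lemma diagram_eqI:
  assumes "d \<in> diagrams k" "d' \<in> diagrams k"
    and "\<And>i j. {T i, T j} \<in> d \<longleftrightarrow> {T i, T j} \<in> d'"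
    and "\<And>i j. {B i, B j} \<in> d \<longleftrightarrow> {B i, B j} \<in> d'"
    and "\<And>i j. {T i, B j} \<in> d \<longleftrightarrow> {T i, B j} \<in> d'"
  shows "d = d'"
proof -
  have eq: "{u, v} \<in> d \<longleftrightarrow> {u, v} \<in> d'" if "u \<in> verts k" "v \<in> verts k" for u v
    using verts_cases[OF that(1)] verts_cases[OF that(2)] assms(3-5)
    by (elim disjE exE conjE) (simp_all add: insert_commute)
  show ?thesis
  proof (intro subset_antisym subsetI)
    fix e assume e: "e \<in> d"
    from diagramD(1)[OF assms(1) e] show "e \<in> d'" using e eq by (elim exE conjE) simp
  next
    fix e assume e: "e \<in> d'"
    from diagramD(1)[OF assms(2) e] show "e \<in> d" using e eq by (elim exE conjE) simp
  qed
qed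

text \<open>Planarity makes the vertical edges order preserving, so they join white vertices of
  equal \<open>order_rank\<close> and are determined by the two halves.\<close>

lemma diagram_eq_glue:
  assumes d: "d \<in> diagrams k"
  shows "d = glue (topE d) (topW d) (botE d) (botW d)"
proof (rule diagram_eqI[OF d glue_diagram[OF top_factor[OF d] bot_factor[OF d]]])
  fix i j
  show "{T i, B j} \<in> d \<longleftrightarrow> {T i, B j} \<in> glue (topE d) (topW d) (botE d) (botW d)"
  proof
    assume e: "{T i, B j} \<in> d"
    then show "{T i, B j} \<in> glue (topE d) (topW d) (botE d) (botW d)"
      using vertical_order_rank[OF d e] by (auto simp: glue_edge topW_def botW_def)
  next
    assume "{T i, B j} \<in> glue (topE d) (topW d) (botE d) (botW d)"
    then have ij: "i \<in> topW d" "j \<in> botW d" "order_rank (topW d) i = order_rank (botW d) j"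
      by (simp_all add: glue_edge)
    then obtain j' where j': "{T i, B j'} \<in> d" unfolding topW_def by auto
    then have "j' \<in> botW d" "order_rank (botW d) j' = order_rank (botW d) j"
      using vertical_order_rank[OF d j'] ij unfolding botW_def by auto
    then have "j' = j" using order_rank_eq[OF factor_finite[OF bot_factor[OF d]]] ij by simp
    then show "{T i, B j} \<in> d" using j' by simp
  qed
qed (simp_all add: glue_edge topE_edge botE_edge)

lemma order_rank_image:
  assumes "finite W"
  shows "order_rank W ` W = {..<card W}"
proof (rule card_subset_eq)
  show "order_rank W ` W \<subseteq> {..<card W}"
  proof (rule image_subsetI)
    fix i assume "i \<in> W"
    then have "{a \<in> W. a < i} \<subset> W" by auto
    then show "order_rank W i \<in> {..<card W}"
      unfolding order_rank_def using psubset_card_mono[OF assms] by simp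
  qed
  have "inj_on (order_rank W) W" by (rule inj_onI) (rule order_rank_eq[OF assms])
  then show "card (order_rank W ` W) = card {..<card W}" by (simp add: card_image)
qed simp

text \<open>The values of \<open>order_rank\<close> fill an initial segment, so \<open>glue\<close>
  leaves no white vertex unmatched when the two sets have equal size.\<close>

lemma order_rank_partner:
  assumes "finite W" "finite W'" "card W = card W'" "i \<in> W"
  shows "\<exists>j\<in>W'. order_rank W i = order_rank W' j"
proof -
  have "order_rank W i \<in> order_rank W' ` W'"
    using order_rank_image[OF assms(1)] order_rank_image[OF assms(2)] assms(3,4) by auto
  then show ?thesis by auto
qed

section \<open>Multiplying a diagram given by its halves from the left\<close>

lemma lower_glue_edge:
  assumes "factor k E W" "factor k E' W'"
  shows "{M a, v} \<in> lower (glue E W E' W') \<longleftrightarrow>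
      (\<exists>b. v = M b \<and> {a, b} \<in> E) \<or> (\<exists>b. v = B b \<and> {T a, B b} \<in> glue E W E' W')"
    "{B a, v} \<in> lower (glue E W E' W') \<longleftrightarrow>
      (\<exists>b. v = B b \<and> {a, b} \<in> E') \<or> (\<exists>b. v = M b \<and> {T b, B a} \<in> glue E W E' W')"
    "{T a, v} \<notin> lower (glue E W E' W')"
  unfolding lower_edge[OF glue_diagram[OF assms]] by (cases v; simp add: glue_edge; fail)+

text \<open>A strand from the top row sees only the upper half of the lower diagram until it leaves
  through a vertical edge, and at the bottom end of that edge it stops.\<close>

lemma conn_glue_from_top:
  assumes d: "d \<in> diagrams k" and F: "factor k E W" and F': "factor k E' W'"
    and "conn (upper d \<union> lower (glue E W E' W')) (T i) v"
  shows "(v \<notin> range B \<and> conn (upper d \<union> factor_lower E) (T i) v) \<or>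
    (\<exists>j w. v = B j \<and> {T w, B j} \<in> glue E W E' W' \<and> conn (upper d \<union> factor_lower E) (T i) (M w))"
proof -
  let ?g = "glue E W E' W'" and ?H = "upper d \<union> factor_lower E"
  let ?S = "{v. (v \<notin> range B \<and> conn ?H (T i) v) \<or>
    (\<exists>j w. v = B j \<and> {T w, B j} \<in> ?g \<and> conn ?H (T i) (M w))}"
  have upB: "{B a, v} \<notin> upper d" for a v
    using diagram_edge(2)[OF d, of "M a"] by (auto simp: upper_edge[OF d])
  have "v \<in> ?S" using assms(4)
  proof (rule conn_closed)
    fix a b assume a: "a \<in> ?S" and e: "{a, b} \<in> upper d \<union> lower ?g"
    show "b \<in> ?S"
    proof (cases "a \<in> range B")
      case False
      then have c: "conn ?H (T i) a" using a by auto
      from e show ?thesis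
      proof
        assume u: "{a, b} \<in> upper d"
        then have "conn ?H (T i) b" using conn_step[OF c, of b] by simp
        moreover have "b \<notin> range B" using u upB[of _ a] by (auto simp: insert_commute)
        ultimately show ?thesis by simp
      next
        assume l: "{a, b} \<in> lower ?g"
        obtain m where m: "a = M m" using l False lower_glue_edge(3)[OF F F'] by (cases a) auto
        from l consider n where "b = M n" "{m, n} \<in> E" | n where "b = B n" "{T m, B n} \<in> ?g"
          unfolding m lower_glue_edge[OF F F'] by auto
        then show ?thesis
        proof cases
          case 1
          then have "conn ?H (T i) b" using conn_step[OF c, of b] m by (simp add: factor_lower_edge)
          then show ?thesis using 1 by auto
        next
          case 2
          then show ?thesis using c m by auto
        qed
      qed
    next
      case True
      then obtain j w where j: "a = B j" "{T w, B j} \<in> ?g" "conn ?H (T i) (M w)" using a by auto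
      have "{a, b} \<in> lower ?g" using e upB[of j b] j(1) by simp
      moreover have "{a, M w} \<in> lower ?g" using j(1,2) by (auto simp: lower_glue_edge[OF F F'])
      ultimately have "b = M w"
        using matching_unique[OF matching_lower[OF glue_diagram[OF F F']]] by blast
      then show ?thesis using j by auto
    qed
  qed auto
  then show ?thesis by simp
qed

lemma conn_glue_mono:
  "conn (upper d \<union> factor_lower E) u v \<Longrightarrow> conn (upper d \<union> lower (glue E W E' W')) u v"
  by (rule conn_mono[OF Un_mono[OF order_refl factor_lower_sub_lower_glue]])

lemma topE_compose_glue:
  assumes d: "d \<in> diagrams k" and F: "factor k E W" and F': "factor k E' W'"
  shows "topE (compose k d (glue E W E' W')) = actE k d E"
proof -
  let ?g = "glue E W E' W'"
  have "conn (upper d \<union> lower ?g) (T i) (T j) \<longleftrightarrow> conn (upper d \<union> factor_lower E) (T i) (T j)" for i j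
    using conn_glue_from_top[OF d F F', of i "T j"] conn_glue_mono[of d E "T i" "T j"] by auto
  then have "{i, j} \<in> topE (compose k d ?g) \<longleftrightarrow> {i, j} \<in> actE k d E" for i j
    by (auto simp: topE_edge compose_contract contract_edge actE_edge)
  then show ?thesis
    by (rule edge_set_eqI[rotated 2]) (auto simp: topE_def[of "compose k d ?g"] actE_def)
qed

lemma topW_compose_glue:
  assumes d: "d \<in> diagrams k" and F: "factor k E W" and F': "factor k E' W'" and c: "card W = card W'"
  shows "topW (compose k d (glue E W E' W')) = actW k d E W"
proof (intro subset_antisym subsetI)
  let ?g = "glue E W E' W'"
  fix i assume "i \<in> topW (compose k d ?g)"
  then obtain j where j: "i \<in> {1..k}" "conn (upper d \<union> lower ?g) (T i) (B j)"
    by (auto simp: topW_def compose_contract contract_edge)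
  then obtain w where "{T w, B j} \<in> ?g" "conn (upper d \<union> factor_lower E) (T i) (M w)"
    using conn_glue_from_top[OF d F F' j(2)] by auto
  then show "i \<in> actW k d E W" using j(1) by (auto simp: actW_def glue_edge)
next
  let ?g = "glue E W E' W'"
  fix i assume "i \<in> actW k d E W"
  then obtain w where w: "i \<in> {1..k}" "w \<in> W" "conn (upper d \<union> factor_lower E) (T i) (M w)"
    by (auto simp: actW_def)
  obtain j where j: "j \<in> W'" "order_rank W w = order_rank W' j"
    using order_rank_partner[OF factor_finite[OF F] factor_finite[OF F'] c w(2)] by auto
  have "{M w, B j} \<in> lower ?g" using w(2) j by (auto simp: lower_glue_edge[OF F F'] glue_edge)
  then have "conn (upper d \<union> lower ?g) (T i) (B j)"
    by (intro conn_step[OF conn_glue_mono[OF w(3)]]) simp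
  moreover have "j \<in> {1..k}" using factorD(3)[OF F'] j by auto
  ultimately have "{T i, B j} \<in> compose k d ?g" using w(1) by (simp add: compose_contract contract_edge)
  then show "i \<in> topW (compose k d ?g)" unfolding topW_def by auto
qed

text \<open>If the rank does not drop, the white bottom vertices of the product form a subset of
  \<open>W'\<close> of full size, hence all of \<open>W'\<close>. A strand from any other bottom
  vertex then cannot leave the bottom row, and the lower half survives unchanged.\<close>

lemma compose_glue:
  assumes d: "d \<in> diagrams k" and F: "factor k E W" and F': "factor k E' W'"
    and c: "card W = card W'" and r: "card (actW k d E W) = card W"
  shows "compose k d (glue E W E' W') = glue (actE k d E) (actW k d E W) E' W'"
proof -
  let ?g = "glue E W E' W'" and ?D = "compose k d (glue E W E' W')"
  have g: "?g \<in> diagrams k" by (rule glue_diagram[OF F F'])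
  have D: "?D \<in> diagrams k" by (rule compose_diagram[OF d g])
  have edge: "{u, v} \<in> ?D \<longleftrightarrow> u \<noteq> v \<and> u \<in> verts k \<and> v \<in> verts k \<and> conn (upper d \<union> lower ?g) u v" for u v
    by (simp add: compose_contract contract_edge)
  have upB: "{B a, v} \<notin> upper d" for a v
    using diagram_edge(2)[OF d, of "M a"] by (auto simp: upper_edge[OF d])
  have sub: "botW ?D \<subseteq> W'"
  proof
    fix j assume "j \<in> botW ?D"
    then obtain i where "conn (upper d \<union> lower ?g) (T i) (B j)" unfolding botW_def by (auto simp: edge)
    then obtain w where "{T w, B j} \<in> ?g" using conn_glue_from_top[OF d F F'] by blast
    then show "j \<in> W'" by (simp add: glue_edge)
  qed
  have botW: "botW ?D = W'"
  proof (rule card_subset_eq[OF factor_finite[OF F'] sub])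
    show "card (botW ?D) = card W'"
      using card_topW_botW[OF D] topW_compose_glue[OF d F F' c] c r by simp
  qed
  have "{a, b} \<in> botE ?D \<longleftrightarrow> {a, b} \<in> E'" for a b
  proof
    assume "{a, b} \<in> botE ?D"
    then have e: "{B a, B b} \<in> ?D" by (simp add: botE_edge)
    have a: "a \<notin> W'"
    proof
      assume "a \<in> W'"
      then obtain i where "{B a, T i} \<in> ?D" using botW unfolding botW_def by (auto simp: insert_commute)
      then show False using matching_unique[OF diagram_matching[OF D] e] by blast
    qed
    have "B b \<in> {v. v = B a \<or> (\<exists>c. v = B c \<and> {a, c} \<in> E')}"
      using e[unfolded edge, THEN conjunct2, THEN conjunct2, THEN conjunct2]
    proof (rule conn_closed)
      fix u v assume u: "u \<in> {v. v = B a \<or> (\<exists>c. v = B c \<and> {a, c} \<in> E')}"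
        and uv: "{u, v} \<in> upper d \<union> lower ?g"
      obtain l where l: "u = B l" using u by auto
      have lv: "{B l, v} \<in> lower ?g" using uv upB[of l v] l by simp
      show "v \<in> {v. v = B a \<or> (\<exists>c. v = B c \<and> {a, c} \<in> E')}"
      proof (cases "l = a")
        case True
        then show ?thesis using lv a by (auto simp: lower_glue_edge[OF F F'] glue_edge)
      next
        case False
        then have "{l, a} \<in> E'" using u l by (auto simp: insert_commute)
        then have "{B l, B a} \<in> lower ?g" by (auto simp: lower_glue_edge[OF F F'])
        then have "v = B a" using matching_unique[OF matching_lower[OF g] lv] by simp
        then show ?thesis by simp
      qed
    qed simp
    then show "{a, b} \<in> E'" using e by (auto simp: edge)
  next
    assume e: "{a, b} \<in> E'"
    then have "{B a, B b} \<in> lower ?g" by (auto simp: lower_glue_edge[OF F F'])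
    then have "conn (upper d \<union> lower ?g) (B a) (B b)" by (intro conn_edge) simp
    then show "{a, b} \<in> botE ?D" using factor_range[OF F' e] by (simp add: botE_edge edge)
  qed
  then have "botE ?D = E'"
    by (rule edge_set_eqI[rotated 2]) (erule factor_edge[OF bot_factor[OF D]], erule factor_edge[OF F'])
  then show ?thesis
    using diagram_eq_glue[OF D] topE_compose_glue[OF d F F'] topW_compose_glue[OF d F F' c] botW by simp
qed

text \<open>A loop stays in the middle row, so it uses neither vertical edges nor arcs of the lower
  half; only \<open>E\<close> matters.\<close>

lemma kappa_prod_glue:
  assumes d: "d \<in> diagrams k" and F: "factor k E W" and F': "factor k E' W'"
  shows "kappa_prod d (glue E W E' W') = kap d E"
proof -
  let ?g = "glue E W E' W'" and ?R = "M ` {1..k}"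
  have g: "?g \<in> diagrams k" by (rule glue_diagram[OF F F'])
  have sub: "factor_lower E \<subseteq> lower ?g" by (rule factor_lower_sub_lower_glue)
  have mid: "{a, b} \<in> factor_lower E" if "{a, b} \<in> lower ?g" "a \<in> ?R" "b \<in> ?R" for a b
    using that by (auto simp: lower_glue_edge[OF F F'] factor_lower_edge)
  have "loops (upper d) (lower ?g) ?R = loops (upper d) (factor_lower E) ?R"
  proof (intro subset_antisym subsetI)
    fix D assume "D \<in> loops (upper d) (lower ?g) ?R"
    then obtain v where D: "D = {w. conn (upper d \<union> lower ?g) v w}"
      and b: "\<And>w. w \<in> D \<Longrightarrow> w \<in> ?R \<and> w \<in> \<Union>(upper d) \<and> w \<in> \<Union>(lower ?g)"
      unfolding loops_def by auto
    have step: "{a, c} \<in> factor_lower E" if "a \<in> D" "{a, c} \<in> lower ?g" for a c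
    proof -
      have "c \<in> D" using that conn_step[of "upper d \<union> lower ?g" v a c] unfolding D by simp
      then show ?thesis using mid[OF that(2)] b[OF that(1)] b[of c] by simp
    qed
    have "conn (upper d \<union> factor_lower E) v w" if "conn (upper d \<union> lower ?g) v w" for w
    proof (rule conn_absorb[OF conn_mono[OF Un_upper2 that]])
      fix a c assume "conn (upper d \<union> factor_lower E) v a" "{a, c} \<in> upper d \<union> lower ?g"
      then show "{a, c} \<in> upper d \<union> factor_lower E"
        using step[of a c] conn_glue_mono[of d E v a] unfolding D by auto
    qed
    then have "D = {w. conn (upper d \<union> factor_lower E) v w}"
      unfolding D using conn_glue_mono[of d E v] by auto
    moreover have "w \<in> \<Union>(factor_lower E)" if w: "w \<in> D" for w
    proof -
      obtain c where "{w, c} \<in> lower ?g"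
        using matching_partner[OF matching_lower[OF g], of w] b[OF w] by metis
      then have "{w, c} \<in> factor_lower E" using step w by simp
      then show ?thesis by auto
    qed
    ultimately show "D \<in> loops (upper d) (factor_lower E) ?R" using b unfolding loops_def by auto
  next
    fix D assume "D \<in> loops (upper d) (factor_lower E) ?R"
    then obtain v where D: "D = {w. conn (upper d \<union> factor_lower E) v w}"
      and b: "\<And>w. w \<in> D \<Longrightarrow> w \<in> ?R \<and> w \<in> \<Union>(upper d) \<and> w \<in> \<Union>(factor_lower E)"
      unfolding loops_def by auto
    have "conn (upper d \<union> factor_lower E) v w" if "conn (upper d \<union> lower ?g) v w" for w
    proof (rule conn_absorb[OF conn_mono[OF Un_upper2 that]])
      fix a c assume a: "conn (upper d \<union> factor_lower E) v a" and e: "{a, c} \<in> upper d \<union> lower ?g"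
      show "{a, c} \<in> upper d \<union> factor_lower E"
      proof (cases "{a, c} \<in> upper d")
        case False
        then have l: "{a, c} \<in> lower ?g" using e by simp
      obtain c' where c': "{a, c'} \<in> factor_lower E"
        using matching_partner[OF matching_factor_lower[OF F], of a] b[of a] a unfolding D by auto
        then have "c = c'" using matching_unique[OF matching_lower[OF g] l] sub by auto
        then show ?thesis using c' by simp
      qed simp
    qed
    then have "D = {w. conn (upper d \<union> lower ?g) v w}"
      unfolding D using conn_glue_mono[of d E v] by auto
    moreover have "w \<in> \<Union>(lower ?g)" if "w \<in> D" for w using b[OF that] sub by auto
    ultimately show "D \<in> loops (upper d) (lower ?g) ?R" using b unfolding loops_def by auto
  qed
  then show ?thesis by (simp add: kappa_prod_loops[OF d g] kap_loops[OF factorD(2)[OF F]])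
qed

lemma kap_empty: "kap d {} = 0"
proof -
  have "loops (upper d) (factor_lower {}) (M ` {1..0}) = {}"
  proof (rule equals0I)
    fix D assume "D \<in> loops (upper d) (factor_lower {}) (M ` {1..0})"
    then obtain v where "D = {w. conn (upper d \<union> factor_lower {}) v w}"
      "\<forall>w\<in>D. w \<in> \<Union>(factor_lower {})" unfolding loops_def by auto
    then have "v \<in> \<Union>(factor_lower {})" by simp
    then show False by (simp add: factor_lower_def)
  qed
  then show ?thesis using kap_loops[of "{}" 0 d] by simp
qed

text \<open>Below the diagram there are no edges, so the whole picture is the matching
  \<open>upper ?g\<close> and its components are edges and single vertices.\<close>

lemma act_glue_standard:
  assumes F: "factor k E W" and r: "card W = r" "r \<le> k"
  shows "actE k (glue E W {} {1..r}) {} = E" "actW k (glue E W {} {1..r}) {} {1..r} = W"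
proof -
  let ?g = "glue E W {} {1..r}"
  have g: "?g \<in> diagrams k" by (rule glue_diagram[OF F factor_empty]) (use r in auto)
  have c: "conn (upper ?g \<union> factor_lower {}) u v \<longleftrightarrow> u = v \<or> {u, v} \<in> upper ?g" for u v
    using conn_matching[OF matching_upper[OF g]] by (simp add: factor_lower_def)
  have E: "{i, j} \<in> actE k ?g {} \<longleftrightarrow> {i, j} \<in> E" for i j
    using factor_range[OF F, of i j] by (auto simp: actE_edge c upper_edge[OF g] glue_edge simp del: One_nat_def)
  then show "actE k ?g {} = E"
    by (rule edge_set_eqI[rotated 2])
      (erule factor_edge[OF act_factor_valid[OF g factor_empty[of "{}"]], rotated], simp, erule factor_edge[OF F])
  have "i \<in> actW k ?g {} {1..r} \<longleftrightarrow> i \<in> W" for i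
  proof
    assume "i \<in> actW k ?g {} {1..r}"
    then show "i \<in> W" by (auto simp: actW_def c upper_edge[OF g] glue_edge simp del: One_nat_def)
  next
    assume i: "i \<in> W"
    then obtain j where "j \<in> {1..r}" "order_rank W i = order_rank {1..r} j"
      using order_rank_partner[OF factor_finite[OF F], of "{1..r}" i] r by auto
    moreover have "i \<in> {1..k}" using factorD(3)[OF F] i by auto
    ultimately show "i \<in> actW k ?g {} {1..r}"
      using i by (auto simp: actW_def c upper_edge[OF g] glue_edge simp del: One_nat_def)
  qed
  then show "actW k ?g {} {1..r} = W" by auto
qed

text \<open>The top vertices of \<open>e\<close> on an edge are \<open>1\<close> to
  \<open>r\<close>, so no other vertex of the result is white or on an arc. If the rank stays
  \<open>r\<close>, all of them are white and none is left to bear an arc.\<close>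

lemma act_standard_idempotent:
  assumes "r \<le> k" and F: "factor k E W"
  defines "e \<equiv> glue {} {1..r} {} {1..r}"
  shows "actW k e E W \<subseteq> {1..r}"
    and "card (actW k e E W) = r \<Longrightarrow> actE k e E = {} \<and> actW k e E W = {1..r}"
proof -
  have e: "e \<in> diagrams k" unfolding e_def by (rule glue_diagram) (use assms(1) in \<open>auto intro: factor_empty\<close>)
  show sub: "actW k e E W \<subseteq> {1..r}"
    using actW_subset_verticals[OF e, of E W] unfolding e_def by (auto simp: glue_edge)
  assume "card (actW k e E W) = r"
  then have W: "actW k e E W = {1..r}" using card_subset_eq[OF _ sub] by simp
  have "{i, j} \<notin> actE k e E" for i j
  proof
    assume ij: "{i, j} \<in> actE k e E"
    then have "T i \<in> \<Union>(upper e \<union> factor_lower E)"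
      using conn_neq_Union[of "upper e \<union> factor_lower E" "T i" "T j"] by (auto simp: actE_edge)
    then have "T i \<in> \<Union>(upper e)" using top_not_on_factor[of i E] by auto
    then obtain v where "{T i, v} \<in> upper e" using matching_partner[OF matching_upper[OF e]] by metis
    then have "{T i, swap_bot v} \<in> e" by (simp add: upper_edge[OF e])
    then have "i \<in> {1..r}" unfolding e_def by (cases v) (auto simp: glue_edge)
    then have "{i, j} \<notin> actE k e E"
      using factor_white_edge[OF act_factor_valid[OF e F]] W by blast
    then show False using ij by simp
  qed
  then have "actE k e E = {}"
    by (intro edge_set_eqI[OF factor_edge[OF act_factor_valid[OF e F]]]) auto
  then show "actE k e E = {} \<and> actW k e E W = {1..r}" using W by simp
qed

section \<open>The modules of paths\<close>

definition act_path :: "nat \<Rightarrow> diag \<Rightarrow> int list \<Rightarrow> int list" where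
  "act_path k d p = factor_path k (actE k d (fst (onefactor p)))
     (actW k d (fst (onefactor p)) (snd (onefactor p)))"

definition act_rank :: "nat \<Rightarrow> diag \<Rightarrow> int list \<Rightarrow> nat" where
  "act_rank k d p = card (actW k d (fst (onefactor p)) (snd (onefactor p)))"

lemma paths_factor:
  assumes "p \<in> paths k r"
  shows "factor k (fst (onefactor p)) (snd (onefactor p))" "card (snd (onefactor p)) = r"
  using assms onefactor_factor[of p k] sum_list_onefactor[of p] by (auto simp: paths_def)

lemma factor_path_in_paths: "factor k E W \<Longrightarrow> card W = r \<Longrightarrow> factor_path k E W \<in> paths k r"
  by (simp add: paths_def factor_path_motzkin factor_path_length factor_path_sum)

lemma factor_path_onefactor:
  assumes "p \<in> paths k r"
  shows "factor_path k (fst (onefactor p)) (snd (onefactor p)) = p"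
  using path_of_factor[OF paths_factor(1)[OF assms]] path_of_onefactor[of p k] assms
  by (simp add: paths_def)

lemma finite_paths: "finite (paths k r)"
proof (rule finite_subset)
  show "paths k r \<subseteq> {p. set p \<subseteq> {-1, 0, 1} \<and> length p = k}"
    by (auto simp: paths_def motzkin_path_def)
qed (rule finite_lists_length_eq, simp)

lemma act_path_in_paths:
  assumes "d \<in> diagrams k" "p \<in> paths k r" "act_rank k d p = r"
  shows "act_path k d p \<in> paths k r"
  unfolding act_path_def
  by (rule factor_path_in_paths[OF act_factor_valid[OF assms(1) paths_factor(1)[OF assms(2)]]])
    (use assms(3) in \<open>simp add: act_rank_def\<close>)

lemma onefactor_act_path:
  assumes "d \<in> diagrams k" "p \<in> paths k r"
  shows "onefactor (act_path k d p) = (actE k d (fst (onefactor p)),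
     actW k d (fst (onefactor p)) (snd (onefactor p)))"
  unfolding act_path_def
  by (rule onefactor_factor_path[OF act_factor_valid[OF assms(1) paths_factor(1)[OF assms(2)]]])

lemma basis_act_eq:
  assumes "d \<in> diagrams k" "p \<in> paths k r"
  shows "basis_act k x r d p s =
    (if act_rank k d p = r \<and> s = act_path k d p then x ^ kap d (fst (onefactor p)) else 0)"
proof -
  note F = act_factor_valid[OF assms(1) paths_factor(1)[OF assms(2)]]
  have "path_of k (act_factor k d p) = act_path k d p"
    unfolding act_factor_eq act_path_def by (rule path_of_factor[OF F])
  moreover have "sum_list (act_path k d p) = int (act_rank k d p)"
    unfolding act_path_def act_rank_def by (rule factor_path_sum[OF F])
  ultimately show ?thesis by (simp add: basis_act_def Let_def kappa_act_kap)
qed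

lemma act_rank_le: "d \<in> diagrams k \<Longrightarrow> p \<in> paths k r \<Longrightarrow> act_rank k d p \<le> r"
  unfolding act_rank_def using card_actW_le[OF _ paths_factor(1)] paths_factor(2) by metis

lemma basis_act_support:
  "d \<in> diagrams k \<Longrightarrow> p \<in> paths k r \<Longrightarrow> s \<notin> paths k r \<Longrightarrow> basis_act k x r d p s = 0"
  using act_path_in_paths by (auto simp: basis_act_eq)

lemma sum_basis_act:
  assumes "d \<in> diagrams k" "p \<in> paths k r"
  shows "(\<Sum>q\<in>paths k r. basis_act k x r d p q * f q) =
    (if act_rank k d p = r then x ^ kap d (fst (onefactor p)) * f (act_path k d p) else 0)"
proof (cases "act_rank k d p = r")
  case True
  have "(\<Sum>q\<in>paths k r. basis_act k x r d p q * f q) =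
    (\<Sum>q\<in>paths k r. if act_path k d p = q then x ^ kap d (fst (onefactor p)) * f q else 0)"
    by (rule sum.cong) (auto simp: basis_act_eq[OF assms] True)
  then show ?thesis using True act_path_in_paths[OF assms True] by (simp add: finite_paths)
next
  case False
  then show ?thesis by (simp add: basis_act_eq[OF assms])
qed

text \<open>The powers of \<open>x\<close> agree by \<open>kap_compose\<close>. If the rank already
  drops under \<open>d2\<close>, it cannot recover under \<open>d1\<close>, so both sides
  vanish.\<close>

lemma basis_act_compose:
  assumes d1: "d1 \<in> diagrams k" and d2: "d2 \<in> diagrams k" and p: "p \<in> paths k r"
  shows "(\<Sum>q\<in>paths k r. basis_act k x r d2 p q * basis_act k x r d1 q s) =
    x ^ kappa_prod d1 d2 * basis_act k x r (compose k d1 d2) p s"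
proof -
  let ?E = "fst (onefactor p)" and ?W = "snd (onefactor p)" and ?D = "compose k d1 d2"
  note F = paths_factor(1)[OF p]
  note F2 = act_factor_valid[OF d2 F]
  have D: "?D \<in> diagrams k" by (rule compose_diagram[OF d1 d2])
  have AE: "actE k ?D ?E = actE k d1 (actE k d2 ?E)"
    and AW: "actW k ?D ?E ?W = actW k d1 (actE k d2 ?E) (actW k d2 ?E ?W)"
    by (rule act_compose[OF d1 d2 F])+
  show ?thesis
  proof (cases "act_rank k d2 p = r")
    case True
    let ?q = "act_path k d2 p"
    have q: "?q \<in> paths k r" by (rule act_path_in_paths[OF d2 p True])
    have one: "onefactor ?q = (actE k d2 ?E, actW k d2 ?E ?W)" by (rule onefactor_act_path[OF d2 p])
    have "act_rank k d1 ?q = act_rank k ?D p" "act_path k d1 ?q = act_path k ?D p"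
      unfolding act_rank_def act_path_def[of k d1] act_path_def[of k ?D] one AE AW by simp_all
    moreover have "kap d2 ?E + kap d1 (fst (onefactor ?q)) = kappa_prod d1 d2 + kap ?D ?E"
      using kap_compose[OF d1 d2 F] one by simp
    ultimately show ?thesis
      unfolding sum_basis_act[OF d2 p] basis_act_eq[OF D p] basis_act_eq[OF d1 q]
      using True by (auto simp: power_add[symmetric])
  next
    case False
    have "act_rank k ?D p \<le> card (actW k d2 ?E ?W)"
      unfolding act_rank_def AW by (rule card_actW_le[OF d1 F2])
    then have "act_rank k ?D p \<noteq> r"
      using False act_rank_le[OF d2 p] unfolding act_rank_def by simp
    then show ?thesis unfolding sum_basis_act[OF d2 p] basis_act_eq[OF D p] using False by simp
  qed
qed

lemma basis_act_idd:
  assumes p: "p \<in> paths k r"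
  shows "basis_act k x r (idd k) p s = (if s = p then 1 else 0)"
  using act_idd[OF paths_factor(1)[OF p]] factor_path_onefactor[OF p] paths_factor(2)[OF p]
  by (simp add: basis_act_eq[OF idd_diagram p] act_rank_def act_path_def)

definition delta :: "'b \<Rightarrow> 'b \<Rightarrow> 'a::zero_neq_one" where
  "delta d = (\<lambda>d'. if d' = d then 1 else 0)"

lemma delta_alg: "d \<in> diagrams k \<Longrightarrow> delta d \<in> alg k"
  by (auto simp: delta_def alg_def)

lemma Cmod_simps [simp]:
  "mcar (Cmod k x r) = {v. \<forall>p. p \<notin> paths k r \<longrightarrow> v p = 0}"
  "mzero (Cmod k x r) = (\<lambda>_. 0)"
  "madd (Cmod k x r) = (\<lambda>u v s. u s + v s)"
  "msmult (Cmod k x r) = (\<lambda>c v s. c * v s)"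
  by (simp_all add: Cmod_def)

lemma Cmod_act:
  "mact (Cmod k x r) a v =
    (\<lambda>s. \<Sum>d\<in>diagrams k. \<Sum>p\<in>paths k r. a d * v p * basis_act k x r d p s)"
  by (simp add: Cmod_def)

lemma sum_alg_mult:
  fixes f :: "diag \<Rightarrow> 'a::field"
  shows "(\<Sum>d\<in>diagrams k. alg_mult k x a b d * f d) =
    (\<Sum>d1\<in>diagrams k. \<Sum>d2\<in>diagrams k. x ^ kappa_prod d1 d2 * a d1 * b d2 * f (compose k d1 d2))"
proof -
  let ?D = "diagrams k"
  have "(\<Sum>d\<in>?D. alg_mult k x a b d * f d) = (\<Sum>d\<in>?D. \<Sum>d1\<in>?D. \<Sum>d2\<in>?D.
      if compose k d1 d2 = d then x ^ kappa_prod d1 d2 * a d1 * b d2 * f d else 0)"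
    unfolding alg_mult_def sum_distrib_right by (intro sum.cong refl) auto
  also have "\<dots> = (\<Sum>d1\<in>?D. \<Sum>d\<in>?D. \<Sum>d2\<in>?D.
      if compose k d1 d2 = d then x ^ kappa_prod d1 d2 * a d1 * b d2 * f d else 0)"
    by (rule sum.swap)
  also have "\<dots> = (\<Sum>d1\<in>?D. \<Sum>d2\<in>?D. \<Sum>d\<in>?D.
      if compose k d1 d2 = d then x ^ kappa_prod d1 d2 * a d1 * b d2 * f d else 0)"
    by (intro sum.cong refl sum.swap)
  also have "\<dots> = (\<Sum>d1\<in>?D. \<Sum>d2\<in>?D. x ^ kappa_prod d1 d2 * a d1 * b d2 * f (compose k d1 d2))"
    by (intro sum.cong refl) (simp add: finite_diagrams compose_diagram)
  finally show ?thesis .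
qed

lemma alg_mult_closed: "alg_mult k x a b \<in> alg k"
proof -
  have "alg_mult k x a b d = 0" if "d \<notin> diagrams k" for d
    unfolding alg_mult_def by (intro sum.neutral ballI) (use compose_diagram that in auto)
  then show ?thesis by (simp add: alg_def)
qed

lemma Cmod_act_mult:
  "mact (Cmod k x r) (alg_mult k x a b) v = mact (Cmod k x r) a (mact (Cmod k x r) b v)"
proof
  fix s
  let ?D = "diagrams k" and ?P = "paths k r" and ?b = "basis_act k x r"
  let ?t = "\<lambda>d1 d2 p q. a d1 * b d2 * v p * (?b d2 p q * ?b d1 q s)"
  have "mact (Cmod k x r) (alg_mult k x a b) v s =
    (\<Sum>d\<in>?D. alg_mult k x a b d * (\<Sum>p\<in>?P. v p * ?b d p s))"
    by (simp add: Cmod_act sum_distrib_left mult.assoc)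
  also have "\<dots> = (\<Sum>d1\<in>?D. \<Sum>d2\<in>?D. \<Sum>p\<in>?P.
      a d1 * b d2 * v p * (x ^ kappa_prod d1 d2 * ?b (compose k d1 d2) p s))"
    unfolding sum_alg_mult by (simp add: sum_distrib_left mult_ac)
  also have "\<dots> = (\<Sum>d1\<in>?D. \<Sum>d2\<in>?D. \<Sum>p\<in>?P. \<Sum>q\<in>?P. ?t d1 d2 p q)"
    by (intro sum.cong refl) (simp add: basis_act_compose[symmetric] sum_distrib_left)
  also have "\<dots> = (\<Sum>d1\<in>?D. \<Sum>d2\<in>?D. \<Sum>q\<in>?P. \<Sum>p\<in>?P. ?t d1 d2 p q)"
    by (intro sum.cong refl sum.swap)
  also have "\<dots> = (\<Sum>d1\<in>?D. \<Sum>q\<in>?P. \<Sum>d2\<in>?D. \<Sum>p\<in>?P. ?t d1 d2 p q)"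
    by (intro sum.cong refl sum.swap)
  also have "\<dots> = mact (Cmod k x r) a (mact (Cmod k x r) b v) s"
    by (simp add: Cmod_act sum_distrib_left sum_distrib_right mult_ac)
  finally show "mact (Cmod k x r) (alg_mult k x a b) v s =
    mact (Cmod k x r) a (mact (Cmod k x r) b v) s" .
qed

lemma Cmod_act_delta:
  assumes "d \<in> diagrams k"
  shows "mact (Cmod k x r) (delta d) v = (\<lambda>s. \<Sum>p\<in>paths k r. v p * basis_act k x r d p s)"
proof
  fix s
  have "mact (Cmod k x r) (delta d) v s =
    (\<Sum>d'\<in>diagrams k. if d' = d then \<Sum>p\<in>paths k r. v p * basis_act k x r d' p s else 0)"
    unfolding Cmod_act by (intro sum.cong refl) (simp add: delta_def)
  then show "mact (Cmod k x r) (delta d) v s = (\<Sum>p\<in>paths k r. v p * basis_act k x r d p s)"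
    using assms by (simp add: finite_diagrams)
qed

lemma Cmod_act_closed: "mact (Cmod k x r) a v \<in> mcar (Cmod k x r)"
  by (auto intro!: sum.neutral simp: Cmod_act basis_act_support)

lemma Cmod_act_one:
  fixes x :: "'a::field"
  assumes "v \<in> mcar (Cmod k x r)"
  shows "mact (Cmod k x r) (alg_one k) v = v"
proof
  fix s
  have "(alg_one k :: diag \<Rightarrow> 'a) = delta (idd k)" by (simp add: alg_one_def delta_def)
  then have "mact (Cmod k x r) (alg_one k) v s = (\<Sum>p\<in>paths k r. v p * basis_act k x r (idd k) p s)"
    using Cmod_act_delta[OF idd_diagram, of k x r v] by simp
  also have "\<dots> = (\<Sum>p\<in>paths k r. if s = p then v p else 0)"
    by (intro sum.cong refl) (simp add: basis_act_idd)
  also have "\<dots> = v s" using assms by (simp add: finite_paths)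
  finally show "mact (Cmod k x r) (alg_one k) v s = v s" .
qed

lemma Cmod_is_module: "is_module k x (Cmod k x r)"
proof -
  have inv: "\<exists>w\<in>mcar (Cmod k x r). madd (Cmod k x r) v w = mzero (Cmod k x r)"
    if "v \<in> mcar (Cmod k x r)" for v
    using that by (intro bexI[of _ "\<lambda>s. - v s"]) auto
  show ?thesis
    unfolding is_module_def
    by (intro conjI ballI allI Cmod_act_mult Cmod_act_closed Cmod_act_one inv)
      (auto simp: Cmod_act algebra_simps sum.distrib sum_distrib_left intro!: ext)
qed

section \<open>Arithmetic in an abstract module\<close>

locale motzkin_module =
  fixes k :: nat and x :: "'a::field" and V :: "('a, 'm) amod"
  assumes is_module: "is_module k x V"
begin

lemma zero_closed: "mzero V \<in> mcar V"
  and add_closed: "u \<in> mcar V \<Longrightarrow> v \<in> mcar V \<Longrightarrow> madd V u v \<in> mcar V"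
  and smult_closed: "v \<in> mcar V \<Longrightarrow> msmult V c v \<in> mcar V"
  and act_closed: "a \<in> alg k \<Longrightarrow> v \<in> mcar V \<Longrightarrow> mact V a v \<in> mcar V"
  and add_commute: "u \<in> mcar V \<Longrightarrow> v \<in> mcar V \<Longrightarrow> madd V u v = madd V v u"
  and smult_add: "v \<in> mcar V \<Longrightarrow> msmult V (c + c') v = madd V (msmult V c v) (msmult V c' v)"
  and smult_smult: "v \<in> mcar V \<Longrightarrow> msmult V c (msmult V c' v) = msmult V (c * c') v"
  and smult_one: "v \<in> mcar V \<Longrightarrow> msmult V 1 v = v"
  and act_add_alg: "a \<in> alg k \<Longrightarrow> b \<in> alg k \<Longrightarrow> v \<in> mcar V \<Longrightarrow>
    mact V (\<lambda>d. a d + b d) v = madd V (mact V a v) (mact V b v)"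
  and act_smult_alg: "a \<in> alg k \<Longrightarrow> v \<in> mcar V \<Longrightarrow> mact V (\<lambda>d. c * a d) v = msmult V c (mact V a v)"
  and act_smult: "a \<in> alg k \<Longrightarrow> v \<in> mcar V \<Longrightarrow> mact V a (msmult V c v) = msmult V c (mact V a v)"
  and act_mult: "a \<in> alg k \<Longrightarrow> b \<in> alg k \<Longrightarrow> v \<in> mcar V \<Longrightarrow>
    mact V (alg_mult k x a b) v = mact V a (mact V b v)"
  and act_one: "v \<in> mcar V \<Longrightarrow> mact V (alg_one k) v = v"
  using is_module unfolding is_module_def by simp_all

lemma add_assoc: "u \<in> mcar V \<Longrightarrow> v \<in> mcar V \<Longrightarrow> w \<in> mcar V \<Longrightarrow>
    madd V (madd V u v) w = madd V u (madd V v w)"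
  and zero_add: "v \<in> mcar V \<Longrightarrow> madd V (mzero V) v = v"
  and add_inverse: "v \<in> mcar V \<Longrightarrow> \<exists>w\<in>mcar V. madd V v w = mzero V"
  by (use is_module[unfolded is_module_def] in meson)+

lemma add_zero: "v \<in> mcar V \<Longrightarrow> madd V v (mzero V) = v"
  using add_commute zero_add zero_closed by metis

lemma add_cancel:
  assumes "u \<in> mcar V" "v \<in> mcar V" "madd V u v = u"
  shows "v = mzero V"
proof -
  obtain w where w: "w \<in> mcar V" "madd V u w = mzero V" using add_inverse assms(1) by blast
  have "v = madd V (madd V w u) v"
    using zero_add[OF assms(2)] add_commute[OF w(1) assms(1)] w(2) by simp
  also have "\<dots> = madd V w (madd V u v)" using add_assoc w assms by simp
  also have "\<dots> = mzero V" using assms add_commute[OF w(1) assms(1)] w(2) by simp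
  finally show ?thesis .
qed

lemma smult_zero_left: "v \<in> mcar V \<Longrightarrow> msmult V 0 v = mzero V"
  using add_cancel[of "msmult V 0 v" "msmult V 0 v"] smult_add[of v 0 0] smult_closed by simp

lemma smult_zero_right: "msmult V c (mzero V) = mzero V"
  using smult_smult[OF zero_closed, of c 0] smult_zero_left[OF zero_closed] by simp

lemma act_zero_right: "a \<in> alg k \<Longrightarrow> mact V a (mzero V) = mzero V"
  using act_smult[OF _ zero_closed, of a 0] smult_zero_left[OF zero_closed]
    smult_zero_left[OF act_closed[OF _ zero_closed], of a] by simp

lemma act_zero_left: "v \<in> mcar V \<Longrightarrow> mact V (\<lambda>_. 0) v = mzero V"
  using act_smult_alg[of "\<lambda>_. 0" v 0] smult_zero_left[of "mact V (\<lambda>_. 0) v"] act_closed[of "\<lambda>_. 0" v]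
  by (simp add: alg_def)

text \<open>Splits off one diagram at a time from the support, which reduces the action of an
  algebra element to that of single diagrams.\<close>

lemma act_supported:
  assumes "finite S" "S \<subseteq> diagrams k" and kill: "\<And>d. d \<in> S \<Longrightarrow> mact V (delta d) v = mzero V"
    and v: "v \<in> mcar V" and "\<And>d. d \<notin> S \<Longrightarrow> a d = 0"
  shows "mact V a v = mzero V"
  using assms(1,2,3,5)
proof (induction S arbitrary: a rule: finite_induct)
  case empty
  then have "a = (\<lambda>_. 0)" by auto
  then show ?case using act_zero_left[OF v] by simp
next
  case (insert d S)
  let ?b = "a(d := 0)" and ?c = "\<lambda>d'. a d * delta d d'"
  have d: "d \<in> diagrams k" using insert by simp
  have ba: "?b \<in> alg k" "?c \<in> alg k"
    using insert.prems(1,3) by (auto simp: alg_def delta_def)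
  have "mact V ?b v = mzero V" by (rule insert.IH) (use insert in auto)
  moreover have "mact V ?c v = mzero V"
    using act_smult_alg[OF delta_alg[OF d] v, of "a d"] insert.prems(2)[of d] smult_zero_right by simp
  moreover have "a = (\<lambda>d'. ?b d' + ?c d')" by (auto simp: delta_def)
  ultimately show ?case using act_add_alg[OF ba v] zero_add[OF zero_closed] by simp
qed

end

text \<open>The classification constructs its homomorphism out of a path module, whereas its
  statement asks for an isomorphism onto one.\<close>

lemma mod_iso_sym:
  assumes "mod_iso k V W"
    and "\<And>u v. u \<in> mcar V \<Longrightarrow> v \<in> mcar V \<Longrightarrow> madd V u v \<in> mcar V"
    and "\<And>c v. v \<in> mcar V \<Longrightarrow> msmult V c v \<in> mcar V"
    and "\<And>a v. a \<in> alg k \<Longrightarrow> v \<in> mcar V \<Longrightarrow> mact V a v \<in> mcar V"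
  shows "mod_iso k W V"
proof -
  obtain f where f: "bij_betw f (mcar V) (mcar W)"
    and hom: "\<And>u v. u \<in> mcar V \<Longrightarrow> v \<in> mcar V \<Longrightarrow> f (madd V u v) = madd W (f u) (f v)"
      "\<And>c v. v \<in> mcar V \<Longrightarrow> f (msmult V c v) = msmult W c (f v)"
      "\<And>a v. a \<in> alg k \<Longrightarrow> v \<in> mcar V \<Longrightarrow> f (mact V a v) = mact W a (f v)"
    using assms(1) unfolding mod_iso_def by blast
  let ?g = "the_inv_into (mcar V) f"
  have inj: "inj_on f (mcar V)" and img: "f ` mcar V = mcar W"
    using f by (auto simp: bij_betw_def)
  have g: "?g w \<in> mcar V" "f (?g w) = w" if "w \<in> mcar W" for w
    using that the_inv_into_into[OF inj, of w "mcar V"] f_the_inv_into_f[OF inj, of w] img by auto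
  have eq: "?g w = v" if "v \<in> mcar V" "f v = w" for v w
    using the_inv_into_f_f[OF inj that(1)] that(2) by simp
  show ?thesis
    unfolding mod_iso_def
  proof (intro exI[of _ ?g] conjI ballI allI)
    show "bij_betw ?g (mcar W) (mcar V)" by (rule bij_betw_the_inv_into[OF f])
  qed (rule eq; simp add: assms(2-4) g hom)+
qed

section \<open>The generator, the rank idempotent, indecomposability and irreducibility\<close>

context
  fixes k r :: nat and x :: "'a::field"
  assumes rk: "r \<le> k"
begin

private abbreviation (input) C where "C \<equiv> Cmod k x r"

private definition "p0 = factor_path k {} {1..r}"

private definition "up p = glue (fst (onefactor p)) (snd (onefactor p)) {} {1..r}"

private definition "e0 = glue {} {1..r} {} {1..r}"

lemma std_factor: "factor k {} {1..r}"
  using rk by (auto intro: factor_empty)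

lemma p0_paths: "p0 \<in> paths k r"
  unfolding p0_def by (rule factor_path_in_paths[OF std_factor]) simp

lemma onefactor_p0: "onefactor p0 = ({}, {1..r})"
  unfolding p0_def by (rule onefactor_factor_path[OF std_factor])

lemma up_diagram: "p \<in> paths k r \<Longrightarrow> up p \<in> diagrams k"
  unfolding up_def by (rule glue_diagram[OF paths_factor(1) std_factor])

lemma basis_act_up:
  assumes p: "p \<in> paths k r"
  shows "basis_act k x r (up p) p0 s = delta p s"
proof -
  note a = act_glue_standard[OF paths_factor[OF p] rk]
  have "act_rank k (up p) p0 = r"
    unfolding act_rank_def onefactor_p0 up_def by (simp only: fst_conv snd_conv a paths_factor(2)[OF p])
  moreover have "act_path k (up p) p0 = p"
    unfolding act_path_def onefactor_p0 up_def
    by (simp only: fst_conv snd_conv a factor_path_onefactor[OF p])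
  ultimately show ?thesis
    by (simp add: basis_act_eq[OF up_diagram[OF p] p0_paths] onefactor_p0 kap_empty delta_def)
qed

lemma e0_eq_up: "e0 = up p0"
  by (simp add: e0_def up_def onefactor_p0)

lemma e0_diagram: "e0 \<in> diagrams k"
  unfolding e0_eq_up by (rule up_diagram[OF p0_paths])

lemma basis_act_e0:
  assumes p: "p \<in> paths k r" and "s \<noteq> p0"
  shows "basis_act k x r e0 p s = 0"
proof -
  have "act_path k e0 p = p0" if "act_rank k e0 p = r"
    using act_standard_idempotent(2)[OF rk paths_factor(1)[OF p]] that
    unfolding act_path_def act_rank_def e0_def p0_def by simp
  then show ?thesis using assms(2) by (auto simp: basis_act_eq[OF e0_diagram p])
qed

text \<open>The element \<open>\<Sum> v p (p, p0)\<close> of the algebra, a preimage of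
  \<open>v\<close> under the map that sends \<open>a\<close> to \<open>a p0\<close>.\<close>

definition gen_coeff :: "(int list \<Rightarrow> 'a) \<Rightarrow> diag \<Rightarrow> 'a" where
  "gen_coeff v = (\<lambda>d. \<Sum>p\<in>paths k r. if d = up p then v p else 0)"

lemma gen_coeff_alg: "gen_coeff v \<in> alg k"
proof -
  have "gen_coeff v d = 0" if "d \<notin> diagrams k" for d
    unfolding gen_coeff_def by (intro sum.neutral ballI) (use that up_diagram in auto)
  then show ?thesis by (simp add: alg_def)
qed

lemma delta_p0_car: "delta p0 \<in> mcar C"
  using p0_paths by (auto simp: delta_def)

lemma act_on_p0: "mact C a (delta p0) = (\<lambda>s. \<Sum>d\<in>diagrams k. a d * basis_act k x r d p0 s)"
proof
  fix s
  have "mact C a (delta p0) s =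
    (\<Sum>d\<in>diagrams k. \<Sum>p\<in>paths k r. if p = p0 then a d * basis_act k x r d p s else 0)"
    unfolding Cmod_act by (intro sum.cong refl) (simp add: delta_def)
  then show "mact C a (delta p0) s = (\<Sum>d\<in>diagrams k. a d * basis_act k x r d p0 s)"
    using p0_paths by (simp add: finite_paths)
qed

lemma gen_coeff_act:
  assumes v: "v \<in> mcar C"
  shows "mact C (gen_coeff v) (delta p0) = v"
proof
  fix s
  let ?D = "diagrams k" and ?P = "paths k r"
  have "mact C (gen_coeff v) (delta p0) s =
    (\<Sum>d\<in>?D. \<Sum>p\<in>?P. if d = up p then v p * basis_act k x r d p0 s else 0)"
    unfolding act_on_p0 gen_coeff_def sum_distrib_right by (intro sum.cong refl) auto
  also have "\<dots> = (\<Sum>p\<in>?P. \<Sum>d\<in>?D. if d = up p then v p * basis_act k x r d p0 s else 0)"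
    by (rule sum.swap)
  also have "\<dots> = (\<Sum>p\<in>?P. if s = p then v p else 0)"
    by (intro sum.cong refl) (simp add: finite_diagrams up_diagram basis_act_up delta_def)
  also have "\<dots> = v s" using v by (simp add: finite_paths)
  finally show "mact C (gen_coeff v) (delta p0) s = v s" .
qed

lemma submodule_generated:
  assumes "submodule k C U" "delta p0 \<in> U"
  shows "U = mcar C"
proof (intro subset_antisym subsetI)
  fix v assume v: "v \<in> mcar C"
  have "mact C (gen_coeff v) (delta p0) \<in> U"
    using assms gen_coeff_alg unfolding submodule_def by blast
  then show "v \<in> U" using gen_coeff_act[OF v] by simp
qed (use assms in \<open>auto simp: submodule_def\<close>)

lemma e0_act: "mact C (delta e0) v = (\<lambda>s. mact C (delta e0) v p0 * delta p0 s)"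
proof
  fix s
  have "mact C (delta e0) v s = 0" if "s \<noteq> p0"
    using that unfolding Cmod_act_delta[OF e0_diagram]
    by (intro sum.neutral ballI) (simp add: basis_act_e0)
  then show "mact C (delta e0) v s = mact C (delta e0) v p0 * delta p0 s"
    by (cases "s = p0") (simp_all only: delta_def if_True if_False mult_1_right mult_zero_right simp_thms)
qed

lemma e0_act_p0: "mact C (delta e0) (delta p0) = delta p0"
proof
  fix s
  have "mact C (delta e0) (delta p0) s = (\<Sum>d\<in>diagrams k. if d = e0 then basis_act k x r d p0 s else 0)"
    unfolding act_on_p0 by (intro sum.cong refl) (simp add: delta_def)
  also have "\<dots> = basis_act k x r e0 p0 s" using e0_diagram by (simp add: finite_diagrams)
  also have "\<dots> = delta p0 s" unfolding e0_eq_up by (rule basis_act_up[OF p0_paths])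
  finally show "mact C (delta e0) (delta p0) s = delta p0 s" .
qed

lemma Cmod_nonzero: "mcar C \<noteq> {mzero C}"
proof
  assume "mcar C = {mzero C}"
  then have "delta p0 = (\<lambda>_. 0 :: 'a)" using delta_p0_car by simp
  then have "delta p0 p0 = (0 :: 'a)" by simp
  then show False by (simp add: delta_def)
qed

text \<open>The idempotent \<open>e0\<close> projects onto the line spanned by the generator, so one of the two summands
  contains the generator.\<close>
lemma Cmod_indecomposable: "indecomposable k C"
  unfolding indecomposable_def
proof (intro conjI allI impI Cmod_nonzero)
  fix U W assume a: "submodule k C U \<and> submodule k C W \<and> direct_sum C U W"
  then have U: "submodule k C U" and W: "submodule k C W"
    and int: "U \<inter> W = {mzero C}" and sum: "{madd C u w | u w. u \<in> U \<and> w \<in> W} = mcar C"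
    by (auto simp: direct_sum_def)
  interpret motzkin_module k x C by (rule motzkin_module.intro[OF Cmod_is_module])
  have "delta p0 \<in> {madd C u w | u w. u \<in> U \<and> w \<in> W}" unfolding sum by (rule delta_p0_car)
  then obtain u w where uw: "u \<in> U" "w \<in> W" "delta p0 = madd C u w" by blast
  let ?e = "delta e0 :: diag \<Rightarrow> 'a"
  have e: "?e \<in> alg k" by (rule delta_alg[OF e0_diagram])
  \<comment> \<open>If \<open>e0\<close> does not kill \<open>u\<close>, it sends \<open>u\<close>
    to a nonzero multiple of \<open>delta p0\<close>, which can be rescaled.\<close>
  have gen: "delta p0 \<in> X" if X: "submodule k C X" and u: "u \<in> X" and c: "mact C ?e u p0 \<noteq> 0" for X u
  proof -
    have "mact C ?e u \<in> X" using X u e unfolding submodule_def by blast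
    then have "msmult C (inverse (mact C ?e u p0)) (mact C ?e u) \<in> X"
      using X unfolding submodule_def by blast
    moreover have "msmult C (inverse (mact C ?e u p0)) (mact C ?e u) = delta p0"
      unfolding Cmod_simps(4)
      by (subst (2) e0_act) (use c in \<open>simp only: mult.assoc[symmetric] left_inverse mult_1_left not_False_eq_True\<close>)
    ultimately show ?thesis by simp
  qed
  have car: "u \<in> mcar C" "w \<in> mcar C" using uw U W by (auto simp: submodule_def)
  have "mact C ?e (madd C u w) = madd C (mact C ?e u) (mact C ?e w)"
    using is_module e car unfolding is_module_def by blast
  then have "delta p0 p0 = mact C ?e u p0 + mact C ?e w p0"
    using e0_act_p0 uw(3) by (simp only: Cmod_simps(3)) (metis (no_types, lifting))
  \<comment> \<open>As \<open>e0\<close> fixes \<open>delta p0\<close>, the coordinates of its two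
    parts sum to 1, so one of them is nonzero.\<close>
  then have "mact C ?e u p0 + mact C ?e w p0 = 1" by (simp only: delta_def if_True simp_thms)
  then consider "mact C ?e u p0 \<noteq> 0" | "mact C ?e w p0 \<noteq> 0" by force
  then show "U = {mzero C} \<or> W = {mzero C}"
  proof cases
    case 1
    then have "U = mcar C" using submodule_generated[OF U gen[OF U uw(1)]] by blast
    then have "W = {mzero C}" using int W unfolding submodule_def by blast
    then show ?thesis ..
  next
    case 2
    then have "W = mcar C" using submodule_generated[OF W gen[OF W uw(2)]] by blast
    then have "U = {mzero C}" using int U unfolding submodule_def by blast
    then show ?thesis ..
  qed
qed

text \<open>White vertices of the result lie on vertical edges of \<open>d\<close>, and there are
  fewer than \<open>r\<close> of these.\<close>

lemma Cmod_act_low_rank: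
  assumes "d \<in> diagrams k" "card (topW d) < r"
  shows "mact C (delta d) v = mzero C"
proof -
  have "basis_act k x r d p s = 0" if p: "p \<in> paths k r" for p s
  proof -
    have "act_rank k d p \<le> card (topW d)"
      unfolding act_rank_def topW_def
      by (rule card_mono[OF _ actW_subset_verticals[OF assms(1)]])
        (use factor_finite[OF top_factor[OF assms(1)]] in \<open>simp add: topW_def\<close>)
    then show ?thesis using assms(2) by (simp add: basis_act_eq[OF assms(1) p])
  qed
  then show ?thesis unfolding Cmod_act_delta[OF assms(1)] by simp
qed

lemma topW_e0: "card (topW e0) \<le> r"
proof -
  have "topW e0 \<subseteq> {1..r}" by (auto simp: topW_def e0_def glue_edge)
  then show ?thesis using card_mono[of "{1..r}"] by fastforce
qed

text \<open>The existential form exports the behaviour of \<open>e0\<close> on the generator without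
  its private name, for comparing modules of different rank.\<close>

lemma Cmod_rank_witness:
  "\<exists>d\<in>diagrams k. card (topW d) \<le> r \<and> (\<exists>v\<in>mcar C. mact C (delta d) v = v \<and> v \<noteq> mzero C)"
proof (intro bexI conjI)
  show "mact C (delta e0) (delta p0) = delta p0" by (rule e0_act_p0)
  show "delta p0 \<noteq> mzero C"
  proof
    assume "delta p0 = mzero C"
    then have "delta p0 p0 = (0 :: 'a)" by simp
    then show False by (simp add: delta_def)
  qed
qed (rule topW_e0 delta_p0_car e0_diagram)+

text \<open>The map \<open>?f\<close> from the regular module is onto. The preimage of
  \<open>U\<close> has a complement \<open>Y\<close> there, and the image of \<open>Y\<close> is a
  complement of \<open>U\<close>.\<close>

lemma Cmod_semisimple:
  assumes "semisimple_algebra k x"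
  shows "semisimple_module k C"
  unfolding semisimple_module_def
proof (intro allI impI)
  fix U assume U: "submodule k C U"
  interpret motzkin_module k x C by (rule motzkin_module.intro[OF Cmod_is_module])
  let ?R = "regmod k x"
  let ?f = "\<lambda>a. mact C a (delta p0)"
  let ?pre = "{a \<in> alg k. ?f a \<in> U}"
  note car = delta_p0_car
  have R: "mcar ?R = alg k" "mzero ?R = (\<lambda>_. 0)" "madd ?R = (\<lambda>f g d. f d + g d)"
     "msmult ?R = (\<lambda>c f d. c * f d)" "mact ?R = alg_mult k x"
    by (simp_all add: regmod_def)
  have fadd: "?f (\<lambda>d. a d + b d) = madd C (?f a) (?f b)" if "a \<in> alg k" "b \<in> alg k" for a b
    using act_add_alg[OF that car] .
  have fsm: "?f (\<lambda>d. c * a d) = msmult C c (?f a)" if "a \<in> alg k" for a c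
    using act_smult_alg[OF that car] .
  have fmul: "?f (alg_mult k x a b) = mact C a (?f b)" for a b by (rule Cmod_act_mult)
  have al: "(\<lambda>_. 0 :: 'a) \<in> alg k"
    "\<And>a b :: diag \<Rightarrow> 'a. a \<in> alg k \<Longrightarrow> b \<in> alg k \<Longrightarrow> (\<lambda>d. a d + b d) \<in> alg k"
    "\<And>c (a :: diag \<Rightarrow> 'a). a \<in> alg k \<Longrightarrow> (\<lambda>d. c * a d) \<in> alg k"
    by (auto simp: alg_def)
  have U0: "mzero C \<in> U" and Uadd: "\<And>u w. u \<in> U \<Longrightarrow> w \<in> U \<Longrightarrow> madd C u w \<in> U"
    and Usm: "\<And>c u. u \<in> U \<Longrightarrow> msmult C c u \<in> U"
    and Uact: "\<And>a u. a \<in> alg k \<Longrightarrow> u \<in> U \<Longrightarrow> mact C a u \<in> U" and Ucar: "U \<subseteq> mcar C"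
    using U unfolding submodule_def by blast+
  have "submodule k ?R ?pre"
    unfolding submodule_def R
  proof (intro conjI ballI allI)
    show "(\<lambda>_. 0) \<in> ?pre" using al(1) act_zero_left[OF car] U0 by (simp only: mem_Collect_eq simp_thms)
    show "(\<lambda>d. a d + b d) \<in> ?pre" if "a \<in> ?pre" "b \<in> ?pre" for a b
      using that al(2) fadd Uadd by (simp only: mem_Collect_eq simp_thms)
    show "(\<lambda>d. c * a d) \<in> ?pre" if "a \<in> ?pre" for a c
      using that al(3) fsm Usm by (simp only: mem_Collect_eq simp_thms)
    show "alg_mult k x a b \<in> ?pre" if "a \<in> alg k" "b \<in> ?pre" for a b
      using that alg_mult_closed fmul Uact by (simp only: mem_Collect_eq simp_thms)
  qed blast
  then obtain Y where Y: "submodule k ?R Y" and ds: "direct_sum ?R ?pre Y"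
    using assms unfolding semisimple_algebra_def semisimple_module_def by blast
  have Y0: "(\<lambda>_. 0) \<in> Y" and Yadd: "\<And>a b. a \<in> Y \<Longrightarrow> b \<in> Y \<Longrightarrow> (\<lambda>d. a d + b d) \<in> Y"
    and Ysm: "\<And>c a. a \<in> Y \<Longrightarrow> (\<lambda>d. c * a d) \<in> Y"
    and Yact: "\<And>a b. a \<in> alg k \<Longrightarrow> b \<in> Y \<Longrightarrow> alg_mult k x a b \<in> Y" and Ycar: "Y \<subseteq> alg k"
    using Y unfolding submodule_def R by blast+
  have int: "?pre \<inter> Y = {\<lambda>_. 0}" and sum: "{(\<lambda>d. a d + b d) | a b. a \<in> ?pre \<and> b \<in> Y} = alg k"
    using ds unfolding direct_sum_def R by blast+
  have "submodule k C (?f ` Y)"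
    unfolding submodule_def
  proof (intro conjI ballI allI)
    show "?f ` Y \<subseteq> mcar C" using Cmod_act_closed by blast
    show "mzero C \<in> ?f ` Y" using act_zero_left[OF car] Y0 by (metis image_eqI)
    show "madd C u w \<in> ?f ` Y" if "u \<in> ?f ` Y" "w \<in> ?f ` Y" for u w
    proof -
      from that obtain a b where ab: "a \<in> Y" "b \<in> Y" "u = ?f a" "w = ?f b" by (elim imageE)
      show ?thesis
        unfolding ab fadd[OF subsetD[OF Ycar ab(1)] subsetD[OF Ycar ab(2)], symmetric]
        by (rule imageI[OF Yadd[OF ab(1,2)]])
    qed
    show "msmult C c u \<in> ?f ` Y" if "u \<in> ?f ` Y" for c u
    proof -
      from that obtain a where a: "a \<in> Y" "u = ?f a" by (elim imageE)
      show ?thesis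
        unfolding a fsm[OF subsetD[OF Ycar a(1)], symmetric] by (rule imageI[OF Ysm[OF a(1)]])
    qed
    show "mact C a u \<in> ?f ` Y" if "a \<in> alg k" "u \<in> ?f ` Y" for a u
    proof -
      from that(2) obtain b where b: "b \<in> Y" "u = ?f b" by (elim imageE)
      show ?thesis unfolding b fmul[symmetric] by (rule imageI[OF Yact[OF that(1) b(1)]])
    qed
  qed
  moreover have "direct_sum C U (?f ` Y)"
    unfolding direct_sum_def
  proof (intro conjI subset_antisym subsetI)
    fix u assume "u \<in> U \<inter> ?f ` Y"
    then obtain a where a: "a \<in> Y" "u = ?f a" "u \<in> U" by blast
    \<comment> \<open>A common element of \<open>U\<close> and the image has a lift in
      \<open>Y\<close> that also lies in the preimage of \<open>U\<close>, so the lift is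
      zero.\<close>
    then have "a \<in> ?pre \<inter> Y" using Ycar by blast
    then have "a = (\<lambda>_. 0)" using int by blast
    then show "u \<in> {mzero C}" using a(2) act_zero_left[OF car] by (simp only: singleton_iff)
  next
    fix u assume "u \<in> {mzero C}"
    then show "u \<in> U \<inter> ?f ` Y" using U0 Y0 act_zero_left[OF car] by (metis IntI image_eqI singletonD)
  next
    fix v assume "v \<in> {madd C u w | u w. u \<in> U \<and> w \<in> ?f ` Y}"
    then show "v \<in> mcar C" using add_closed Ucar Cmod_act_closed by blast
  next
    fix v assume v: "v \<in> mcar C"
    have "gen_coeff v \<in> {(\<lambda>d. a d + b d) | a b. a \<in> ?pre \<and> b \<in> Y}"
      unfolding sum by (rule gen_coeff_alg)
    then obtain a b where ab: "gen_coeff v = (\<lambda>d. a d + b d)" "a \<in> ?pre" "b \<in> Y" by blast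
    have "?f (\<lambda>d. a d + b d) = madd C (?f a) (?f b)"
      by (rule fadd) (use ab Ycar in auto)
    then have "v = madd C (?f a) (?f b)" using gen_coeff_act[OF v] unfolding ab(1) by (rule trans[OF sym, rotated])
    then show "v \<in> {madd C u w | u w. u \<in> U \<and> w \<in> ?f ` Y}" using ab(2,3) by blast
  qed
  ultimately show "\<exists>W. submodule k C W \<and> direct_sum C U W" by blast
qed

lemma Cmod_irreducible:
  assumes "semisimple_algebra k x"
  shows "irreducible_mod k C"
  unfolding irreducible_mod_def
proof (intro conjI allI impI Cmod_nonzero)
  fix U assume U: "submodule k C U"
  interpret motzkin_module k x C by (rule motzkin_module.intro[OF Cmod_is_module])
  obtain W where W: "submodule k C W" "direct_sum C U W"
    using Cmod_semisimple[OF assms] U unfolding semisimple_module_def by blast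
  then consider "U = {mzero C}" | "W = {mzero C}"
    using Cmod_indecomposable U unfolding indecomposable_def by blast
  then show "U = {mzero C} \<or> U = mcar C"
  proof cases
    case 2
    have "v \<in> U" if "v \<in> mcar C" for v
    proof -
      have "v \<in> {madd C u w | u w. u \<in> U \<and> w \<in> W}" using W(2) that unfolding direct_sum_def by blast
      then obtain u where "u \<in> U" "v = madd C u (mzero C)" using 2 by blast
      moreover have "u \<in> mcar C" using U \<open>u \<in> U\<close> unfolding submodule_def by blast
      ultimately show ?thesis using add_zero by metis
    qed
    then show ?thesis using U unfolding submodule_def by blast
  qed simp
qed

end

section \<open>Classification of the irreducible modules\<close>

text \<open>A diagram of the smaller rank fixes a nonzero vector of one module and kills the other.
  Since \<open>f\<close> has a fixed direction, the vector is pushed forward when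
  \<open>r < s\<close> and pulled back when \<open>s < r\<close>.\<close>

lemma Cmod_mod_iso_rank:
  fixes x :: "'a::field"
  assumes r: "r \<le> k" and s: "s \<le> k" and iso: "mod_iso k (Cmod k x r) (Cmod k x s)"
  shows "r = s"
proof (rule ccontr)
  assume "r \<noteq> s"
  let ?V = "Cmod k x r" and ?W = "Cmod k x s"
  interpret V: motzkin_module k x ?V by (rule motzkin_module.intro[OF Cmod_is_module])
  interpret W: motzkin_module k x ?W by (rule motzkin_module.intro[OF Cmod_is_module])
  obtain f where f: "bij_betw f (mcar ?V) (mcar ?W)"
    and smult: "\<And>c v. v \<in> mcar ?V \<Longrightarrow> f (msmult ?V c v) = msmult ?W c (f v)"
    and act: "\<And>a v. a \<in> alg k \<Longrightarrow> v \<in> mcar ?V \<Longrightarrow> f (mact ?V a v) = mact ?W a (f v)"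
    using iso unfolding mod_iso_def by blast
  have inj: "inj_on f (mcar ?V)" and img: "f ` mcar ?V = mcar ?W" using f by (auto simp: bij_betw_def)
  have f0: "f (mzero ?V) = mzero ?W"
  proof -
    have "f (mzero ?V) \<in> mcar ?W" using img V.zero_closed by blast
    then show ?thesis
      using smult[OF V.zero_closed, of 0] unfolding V.smult_zero_right by (simp only: W.smult_zero_left)
  qed
  consider "r < s" | "s < r" using \<open>r \<noteq> s\<close> by linarith
  then show False
  proof cases
    case 1
    obtain d v where d: "d \<in> diagrams k" "card (topW d) \<le> r"
      and v: "v \<in> mcar ?V" "mact ?V (delta d) v = v" "v \<noteq> mzero ?V"
      using Cmod_rank_witness[OF r, of x] by blast
    have "f v = mact ?W (delta d) (f v)" using act[OF delta_alg[OF d(1)] v(1)] v(2) by simp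
    also have "\<dots> = mzero ?W" by (rule Cmod_act_low_rank[OF s d(1)]) (use d(2) 1 in simp)
    finally have "f v = f (mzero ?V)" using f0 by (simp only:)
    then show False using inj_onD[OF inj _ v(1) V.zero_closed] v(3) by blast
  next
    case 2
    obtain d w where d: "d \<in> diagrams k" "card (topW d) \<le> s"
      and w: "w \<in> mcar ?W" "mact ?W (delta d) w = w" "w \<noteq> mzero ?W"
      using Cmod_rank_witness[OF s, of x] by blast
    obtain v where v: "v \<in> mcar ?V" "w = f v" using w(1) img by blast
    have "mact ?V (delta d) v = mzero ?V" by (rule Cmod_act_low_rank[OF r d(1)]) (use d(2) 2 in simp)
    then have "w = mzero ?W" using act[OF delta_alg[OF d(1)] v(1)] w(2) v(2) f0 by (simp only:)
    then show False using w(3) by blast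
  qed
qed

context motzkin_module
begin

text \<open>With \<open>G c\<close> the combination of the diagrams \<open>g p\<close> with
  coefficients \<open>c p\<close>, left multiplication by \<open>a\<close> acts on \<open>c\<close>
  as on the path module, up to terms whose rank drops. By \<open>low\<close> these terms act as
  zero, so \<open>c\<close> to \<open>G c v\<close> is a homomorphism.\<close>

lemma act_alg_mult_glue:
  fixes a :: "diag \<Rightarrow> 'a" and c :: "int list \<Rightarrow> 'a"
  assumes F': "factor k E' W'" and r: "card W' = r"
    and low: "\<And>d v. d \<in> diagrams k \<Longrightarrow> card (topW d) < r \<Longrightarrow> v \<in> mcar V \<Longrightarrow> mact V (delta d) v = mzero V"
    and v: "v \<in> mcar V"
  defines "g \<equiv> \<lambda>p. glue (fst (onefactor p)) (snd (onefactor p)) E' W'"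
  defines "G \<equiv> \<lambda>c d. \<Sum>p\<in>paths k r. if d = g p then c p else (0::'a)"
  shows "mact V (alg_mult k x a (G c)) v = mact V (G (mact (Cmod k x r) a c)) v"
proof -
  let ?D = "diagrams k" and ?P = "paths k r"
  have gd: "g p \<in> ?D" if "p \<in> ?P" for p
    unfolding g_def by (rule glue_diagram[OF paths_factor(1)[OF that] F'])
  have Galg: "G c \<in> alg k" for c
  proof -
    have "G c d = 0" if "d \<notin> ?D" for d
      unfolding G_def by (intro sum.neutral ballI) (use that gd in auto)
    then show ?thesis by (simp add: alg_def)
  qed
  have rank: "card (topW (compose k d (g p))) = act_rank k d p" if "d \<in> ?D" "p \<in> ?P" for d p
    unfolding g_def act_rank_def
    using topW_compose_glue[OF that(1) paths_factor(1)[OF that(2)] F'] paths_factor(2)[OF that(2)] r by simp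
  have comp: "compose k d (g p) = g (act_path k d p)"
    if "d \<in> ?D" "p \<in> ?P" "act_rank k d p = r" for d p
    using compose_glue[OF that(1) paths_factor(1)[OF that(2)] F'] paths_factor(2)[OF that(2)] r that(3)
    unfolding g_def onefactor_act_path[OF that(1,2)] act_rank_def by simp
  have kappa: "kappa_prod d (g p) = kap d (fst (onefactor p))" if "d \<in> ?D" "p \<in> ?P" for d p
    unfolding g_def by (rule kappa_prod_glue[OF that(1) paths_factor(1)[OF that(2)] F'])
  define t where "t d p = x ^ kap d (fst (onefactor p)) * a d * c p" for d p
  \<comment> \<open>The error term, collecting all products whose rank drops. By \<open>rank\<close>
    it is supported on diagrams of rank less than \<open>r\<close>, so \<open>act_supported\<close>
    applies.\<close>
  define l where "l d3 = (\<Sum>d\<in>?D. \<Sum>p\<in>?P.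
    if act_rank k d p \<noteq> r \<and> compose k d (g p) = d3 then t d p else 0)" for d3
  have 1: "alg_mult k x a (G c) d3 = (\<Sum>d\<in>?D. \<Sum>p\<in>?P. if compose k d (g p) = d3 then t d p else 0)" for d3
  proof -
    have "alg_mult k x a (G c) d3 = (\<Sum>d\<in>?D. \<Sum>d2\<in>?D. \<Sum>p\<in>?P.
      if d2 = g p then if compose k d d2 = d3 then x ^ kappa_prod d d2 * a d * c p else 0 else 0)"
      unfolding alg_mult_def G_def
    proof (intro sum.cong refl)
      fix d d2
      show "(if compose k d d2 = d3 then x ^ kappa_prod d d2 * a d * (\<Sum>p\<in>?P. if d2 = g p then c p else 0)
          else 0) = (\<Sum>p\<in>?P. if d2 = g p
            then if compose k d d2 = d3 then x ^ kappa_prod d d2 * a d * c p else 0 else 0)"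
      proof (cases "compose k d d2 = d3")
        case True
        then show ?thesis unfolding sum_distrib_left if_P[OF True] by (intro sum.cong refl) simp
      next
        case False
        then show ?thesis unfolding if_not_P[OF False] by simp
      qed
    qed
    also have "\<dots> = (\<Sum>d\<in>?D. \<Sum>p\<in>?P. \<Sum>d2\<in>?D.
      if d2 = g p then if compose k d d2 = d3 then x ^ kappa_prod d d2 * a d * c p else 0 else 0)"
      by (intro sum.cong refl sum.swap)
    also have "\<dots> = (\<Sum>d\<in>?D. \<Sum>p\<in>?P. if compose k d (g p) = d3 then t d p else 0)"
      by (intro sum.cong refl) (simp add: finite_diagrams gd kappa t_def)
    finally show ?thesis .
  qed
  have 2: "G (mact (Cmod k x r) a c) d3 = (\<Sum>d\<in>?D. \<Sum>p\<in>?P.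
    if act_rank k d p = r \<and> compose k d (g p) = d3 then t d p else 0)" for d3
  proof -
    have "G (mact (Cmod k x r) a c) d3 = (\<Sum>q\<in>?P. \<Sum>d\<in>?D. \<Sum>p\<in>?P.
      a d * c p * (basis_act k x r d p q * (if d3 = g q then 1 else 0)))"
      unfolding G_def Cmod_act by (intro sum.cong refl) (simp add: mult_ac)
    also have "\<dots> = (\<Sum>d\<in>?D. \<Sum>q\<in>?P. \<Sum>p\<in>?P.
      a d * c p * (basis_act k x r d p q * (if d3 = g q then 1 else 0)))"
      by (rule sum.swap)
    also have "\<dots> = (\<Sum>d\<in>?D. \<Sum>p\<in>?P. \<Sum>q\<in>?P.
      a d * c p * (basis_act k x r d p q * (if d3 = g q then 1 else 0)))"
      by (intro sum.cong refl sum.swap)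
    also have "\<dots> = (\<Sum>d\<in>?D. \<Sum>p\<in>?P.
      if act_rank k d p = r \<and> compose k d (g p) = d3 then t d p else 0)"
      by (intro sum.cong refl)
        (auto simp: sum_distrib_left[symmetric] sum_basis_act comp t_def mult_ac)
    finally show ?thesis .
  qed
  have "alg_mult k x a (G c) d3 = G (mact (Cmod k x r) a c) d3 + l d3" for d3
    unfolding 1 2 l_def sum.distrib[symmetric] by (intro sum.cong refl) auto
  then have eq: "alg_mult k x a (G c) = (\<lambda>d3. G (mact (Cmod k x r) a c) d3 + l d3)" by (rule ext)
  have lz: "l d3 = 0" if "d3 \<notin> {d \<in> ?D. card (topW d) < r}" for d3
    unfolding l_def
  proof (intro sum.neutral ballI)
    fix d p assume dp: "d \<in> ?D" "p \<in> ?P"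
    have "compose k d (g p) \<in> ?D" by (rule compose_diagram[OF dp(1) gd[OF dp(2)]])
    moreover have "act_rank k d p \<noteq> r \<Longrightarrow> act_rank k d p < r" using act_rank_le[OF dp] by simp
    ultimately show "(if act_rank k d p \<noteq> r \<and> compose k d (g p) = d3 then t d p else 0) = 0"
      using that rank[OF dp] by auto
  qed
  have "mact V l v = mzero V"
    by (rule act_supported[of "{d \<in> ?D. card (topW d) < r}"])
      (use finite_diagrams low v lz in auto)
  moreover have "l \<in> alg k" using lz by (auto simp: alg_def)
  ultimately show ?thesis
    unfolding eq using act_add_alg[OF Galg _ v, of l] add_zero[OF act_closed[OF Galg v]] by simp
qed

text \<open>If \<open>r\<close> is the least rank of a diagram \<open>d0\<close> acting non-trivially on \<open>V\<close>, then replacing the upper half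
  of \<open>d0\<close> by an arbitrary path of rank \<open>r\<close> gives a non-zero homomorphism from the \<open>r\<close>-th module to \<open>V\<close>.\<close>
lemma irreducible_iso_Cmod:
  assumes irr: "irreducible_mod k V"
    and C: "\<And>r. r \<le> k \<Longrightarrow> irreducible_mod k (Cmod k x r)"
  shows "\<exists>r\<le>k. mod_iso k V (Cmod k x r)"
proof -
  let ?P = "\<lambda>r. \<exists>d\<in>diagrams k. card (topW d) = r \<and> (\<exists>v\<in>mcar V. mact V (delta d) v \<noteq> mzero V)"
  have one: "(alg_one k :: diag \<Rightarrow> 'a) = delta (idd k)" by (simp add: alg_one_def delta_def)
  have "mcar V \<noteq> {mzero V}" using irr unfolding irreducible_mod_def by blast
  then obtain v1 where "v1 \<in> mcar V" "v1 \<noteq> mzero V" using zero_closed by blast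
  \<comment> \<open>The identity diagram acts as 1, so some rank occurs and a least one
    exists.\<close>
  then have "?P (card (topW (idd k)))"
    using act_one[of v1] one by (intro bexI[of _ "idd k"] bexI[of _ v1] conjI idd_diagram) simp_all
  then have ex: "\<exists>r. ?P r" by blast
  define r where "r = (LEAST r. ?P r)"
  have "?P r" unfolding r_def using ex by (rule LeastI_ex)
  then obtain d0 v where d0: "d0 \<in> diagrams k" "card (topW d0) = r"
    and v: "v \<in> mcar V" "mact V (delta d0) v \<noteq> mzero V" by blast
  have low: "mact V (delta d) w = mzero V"
    if "d \<in> diagrams k" "card (topW d) < r" "w \<in> mcar V" for d w
    using not_less_Least[of "card (topW d)" ?P] that unfolding r_def by blast
  have rk: "r \<le> k"
    using card_mono[OF _ factorD(3)[OF top_factor[OF d0(1)]]] d0(2) by simp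
  let ?M = "Cmod k x r"
  interpret M: motzkin_module k x ?M by (rule motzkin_module.intro[OF Cmod_is_module])
  note F' = bot_factor[OF d0(1)]
  have cW': "card (botW d0) = r" using card_topW_botW[OF d0(1)] d0(2) by simp
  define g where "g p = glue (fst (onefactor p)) (snd (onefactor p)) (botE d0) (botW d0)" for p
  define G where "G c d = (\<Sum>p\<in>paths k r. if d = g p then c p else (0::'a))" for c d
  define f where "f c = mact V (G c) v" for c
  have gd: "g p \<in> diagrams k" if "p \<in> paths k r" for p
    unfolding g_def by (rule glue_diagram[OF paths_factor(1)[OF that] F'])
  have Galg: "G c \<in> alg k" for c
  proof -
    have "G c d = 0" if "d \<notin> diagrams k" for d
      unfolding G_def by (intro sum.neutral ballI) (use that gd in auto)
    then show ?thesis by (simp add: alg_def)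
  qed
  have fcar: "f c \<in> mcar V" for c unfolding f_def by (rule act_closed[OF Galg v(1)])
  have Gadd: "G (\<lambda>s. c s + c' s) = (\<lambda>d. G c d + G c' d)" for c c'
    unfolding G_def sum.distrib[symmetric] by (intro ext sum.cong refl) auto
  have Gsm: "G (\<lambda>s. b * c s) = (\<lambda>d. b * G c d)" for b c
    unfolding G_def sum_distrib_left by (intro ext sum.cong refl) auto
  have fadd: "f (madd ?M c c') = madd V (f c) (f c')" for c c'
    unfolding f_def Cmod_simps Gadd by (rule act_add_alg[OF Galg Galg v(1)])
  have fsm: "f (msmult ?M b c) = msmult V b (f c)" for b c
    unfolding f_def Cmod_simps Gsm by (rule act_smult_alg[OF Galg v(1)])
  have fact: "f (mact ?M a c) = mact V a (f c)" if "a \<in> alg k" for a c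
  proof -
    have "mact V (alg_mult k x a (G c)) v = mact V (G (mact ?M a c)) v"
      using act_alg_mult_glue[OF F' cW' low v(1), of a c] unfolding G_def[abs_def] g_def by simp
    then show ?thesis unfolding f_def act_mult[OF that Galg v(1)] by (rule sym)
  qed
  have f0: "f (mzero ?M) = mzero V"
    using fsm[of 0 "mzero ?M"] unfolding M.smult_zero_right by (simp only: smult_zero_left[OF fcar])
  \<comment> \<open>The upper half of \<open>d0\<close>. Then \<open>g ?p\<close> is
    \<open>d0\<close> itself, so \<open>f\<close> sends \<open>delta ?p\<close> to the nonzero
    vector obtained from \<open>v\<close> by \<open>d0\<close>.\<close>
  let ?p = "factor_path k (topE d0) (topW d0)"
  have p: "?p \<in> paths k r" by (rule factor_path_in_paths[OF top_factor[OF d0(1)] d0(2)])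
  have "g ?p = d0"
    unfolding g_def onefactor_factor_path[OF top_factor[OF d0(1)]] fst_conv snd_conv
    by (rule diagram_eq_glue[OF d0(1), symmetric])
  have "G (delta ?p) = delta d0"
  proof
    fix d
    have "G (delta ?p) d = (\<Sum>q\<in>paths k r. if q = ?p then if d = g q then 1 else 0 else 0)"
      unfolding G_def by (intro sum.cong refl) (simp add: delta_def)
    then show "G (delta ?p) d = delta d0 d"
      using p \<open>g ?p = d0\<close> by (simp add: finite_paths delta_def)
  qed
  then have fp: "f (delta ?p) \<noteq> mzero V" unfolding f_def using v(2) by simp
  have pcar: "delta ?p \<in> mcar ?M" using p by (auto simp: delta_def)
  \<comment> \<open>Schur's argument: the kernel is a proper submodule, hence zero, and the image is
    a nonzero submodule, hence everything.\<close>
  let ?K = "{c \<in> mcar ?M. f c = mzero V}"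
  have "submodule k ?M ?K"
    unfolding submodule_def
  proof (intro conjI ballI allI)
    show "mzero ?M \<in> ?K" using f0 M.zero_closed by blast
    show "madd ?M u w \<in> ?K"
      if "u \<in> ?K" "w \<in> ?K" for u w
      using that fadd[of u w] M.add_closed zero_add[OF zero_closed] by auto
    show "msmult ?M b u \<in> ?K"
      if "u \<in> ?K" for b u
      using that fsm[of b u] M.smult_closed smult_zero_right by auto
    show "mact ?M a u \<in> ?K"
      if a: "a \<in> alg k" and "u \<in> ?K" for a u
    proof -
      have u: "u \<in> mcar ?M" "f u = mzero V" using that(2) by blast+
      show ?thesis
        using M.act_closed[OF a u(1)] fact[OF a, of u] act_zero_right[OF a] u(2)
        by (simp only: mem_Collect_eq simp_thms)
    qed
  qed blast
  then have "?K = {mzero ?M} \<or> ?K = mcar ?M"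
    using C[OF rk] unfolding irreducible_mod_def by blast
  then have ker: "?K = {mzero ?M}" using fp pcar by blast
  have inj: "inj_on f (mcar ?M)"
  proof (rule inj_onI)
    fix c c' assume c: "c \<in> mcar ?M" "c' \<in> mcar ?M" "f c = f c'"
    let ?m = "madd ?M c (msmult ?M (-1) c')"
    have "f ?m = madd V (f c') (msmult V (-1) (f c'))" unfolding fadd fsm c(3) ..
    also have "\<dots> = msmult V (1 + -1) (f c')"
      unfolding smult_add[OF fcar] smult_one[OF fcar] ..
    also have "\<dots> = mzero V" using smult_zero_left[OF fcar] by simp
    finally have "?m \<in> ?K"
      using M.add_closed[OF c(1) M.smult_closed[OF c(2)]] by blast
    then have "?m = mzero ?M" using ker by blast
    then have "c s + -1 * c' s = 0" for s unfolding Cmod_simps by (rule fun_cong)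
    then show "c = c'" by (intro ext) (simp add: eq_neg_iff_add_eq_0)
  qed
  have "submodule k V (f ` mcar ?M)"
    unfolding submodule_def
  proof (intro conjI ballI allI)
    show "f ` mcar ?M \<subseteq> mcar V" using fcar by blast
    show "mzero V \<in> f ` mcar ?M" using f0 M.zero_closed by (rule image_eqI[OF sym])
    show "madd V u w \<in> f ` mcar ?M" if uw: "u \<in> f ` mcar ?M" "w \<in> f ` mcar ?M" for u w
    proof -
      from uw obtain c c' where c: "u = f c" "c \<in> mcar ?M" "w = f c'" "c' \<in> mcar ?M" by (elim imageE)
      show ?thesis unfolding c(1,3) fadd[symmetric] by (rule imageI[OF M.add_closed[OF c(2,4)]])
    qed
    show "msmult V b u \<in> f ` mcar ?M" if u: "u \<in> f ` mcar ?M" for b u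
    proof -
      from u obtain c where c: "u = f c" "c \<in> mcar ?M" by (elim imageE)
      show ?thesis unfolding c(1) fsm[symmetric] by (rule imageI[OF M.smult_closed[OF c(2)]])
    qed
    show "mact V a u \<in> f ` mcar ?M" if a: "a \<in> alg k" and u: "u \<in> f ` mcar ?M" for a u
    proof -
      from u obtain c where c: "u = f c" "c \<in> mcar ?M" by (elim imageE)
      show ?thesis unfolding c(1) fact[OF a, symmetric] by (rule imageI[OF M.act_closed[OF a c(2)]])
    qed
  qed
  then have "f ` mcar ?M = {mzero V} \<or> f ` mcar ?M = mcar V"
    using irr unfolding irreducible_mod_def by blast
  then have "f ` mcar ?M = mcar V" using fp pcar by blast
  then have "bij_betw f (mcar ?M) (mcar V)" using inj unfolding bij_betw_def by blast
  then have "mod_iso k ?M V" unfolding mod_iso_def using fadd fsm fact by blast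
  then have "mod_iso k V ?M"
    by (rule mod_iso_sym) (rule M.add_closed M.smult_closed M.act_closed; assumption)+
  then show ?thesis using rk by blast
qed

end

theorem mainTheorem9:
  fixes x :: "'a::field" and k :: nat
  shows "(\<forall>r\<le>k. is_module k x (Cmod k x r) \<and> indecomposable k (Cmod k x r)) \<and>
    (semisimple_algebra k x \<longrightarrow>
       (\<forall>r\<le>k. irreducible_mod k (Cmod k x r)) \<and>
       (\<forall>r\<le>k. \<forall>s\<le>k. r \<noteq> s \<longrightarrow> \<not> mod_iso k (Cmod k x r) (Cmod k x s)) \<and>
       (\<forall>V :: ('a, 'm) amod. is_module k x V \<and> irreducible_mod k V \<longrightarrow>
          (\<exists>r\<le>k. mod_iso k V (Cmod k x r))))"
proof (intro conjI allI impI)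
  fix V :: "('a, 'm) amod"
  assume ss: "semisimple_algebra k x" and V: "is_module k x V \<and> irreducible_mod k V"
  interpret motzkin_module k x V by (rule motzkin_module.intro) (use V in blast)
  show "\<exists>r\<le>k. mod_iso k V (Cmod k x r)"
    by (rule irreducible_iso_Cmod) (use V ss Cmod_irreducible in blast)+
qed (use Cmod_is_module Cmod_indecomposable Cmod_irreducible Cmod_mod_iso_rank in blast)+

end
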